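(* Let $G$ be a non-cyclic finite group with a cyclic subgroup of index $2$, and let $K$ be a field containing an element of multiplicative order $|G|$. Then \[\beta_{\mathrm{sep}}^K(G)=\frac{1}{2}|G|+\begin{cases}2 & \text{if } G\cong\mathrm{Dic}_{4m} \text{ for some integer } m>1;\\ 1 & \text{otherwise.}\end{cases}\]
   Context: Let $K$ be a field and $G$ a finite group. A $KG$-module is a finite dimensional $K$-vector space $V$ with a representation $G\to\mathrm{GL}(V)$. $K[V]$ denotes the coordinate ring of $V$, identified with the polynomial algebra $K[x_1,\dots,x_n]$, where $x_1,\dots,x_n$ are the coordinate functions on $V$ with respect to a basis (the symmetric algebra of $V^*$), with the standard grading ($\deg x_i=1$). $G$ acts on $K[V]$ by $K$-algebra automorphisms via $(g\cdot f)(v)=f(g^{-1}v)$; $K[V]^G$ is the algebra of invariants and $K[V]^G_{\le d}$ is the sum of its homogeneous components of degree at most $d$. A subset $S\subseteq K[V]^G$ is a separating set if for all $v,w\in V$, $f(v)=f(w)$ for all $f\in S$ implies that $v$ and $w$ have the same $G$-orbit. Put $\beta_{\mathrm{sep}}(G,V):=\min\{d\in\mathbb{N}_0\mid K[V]^G_{\le d}\text{ is a separating set}\}$. The separating Noether number of $G$ over $K$ is $\beta_{\mathrm{sep}}^K(G):=\sup\{\beta_{\mathrm{sep}}(G,V)\mid V\text{ a finite dimensional }KG\text{-module}\}$. For $m>1$ the dicyclic group $\mathrm{Dic}_{4m}$ of order $4m$ is defined as follows. For $n\ge 3$, $\mathrm{Dic}_{2^n}=\langle a,b\mid a^{2^{n-1}}=1,\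 b^2=a^{2^{n-2}},\ bab^{-1}=a^{-1}\rangle$. If $m=2^{n-2}r$ is even with $r$ odd, $\mathrm{Dic}_{4m}=\mathrm{C}_r\rtimes_{-1}\mathrm{Dic}_{2^n}$, where $a$ acts trivially and $b$ acts by inversion on the cyclic group $\mathrm{C}_r$ of order $r$; if $m>1$ is odd, $\mathrm{Dic}_{4m}=\mathrm{C}_m\rtimes_{-1}\mathrm{C}_4$, where a generator of $\mathrm{C}_4$ acts on $\mathrm{C}_m$ by inversion. (Equivalently, $\mathrm{Dic}_{4m}=\langle a,b\mid a^{2m}=1,\ b^2=a^m,\ bab^{-1}=a^{-1}\rangle$.) *)

theory Defs
  imports
    "Jordan_Normal_Form.Matrix"
    "HOL-Algebra.Elementary_Groups"
    "HOL-Library.Extended_Nat"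
    "HOL-Library.Poly_Mapping"
begin

section \<open>Representations\<close>

text \<open>
  A \<open>KG\<close>-module of dimension \<open>n\<close> is, after a choice of basis, the space \<open>K\<^sup>n\<close> of
  column vectors with a homomorphism from \<open>G\<close> to \<open>GL\<^sub>n(K)\<close>; \<open>n = 0\<close> is allowed.
\<close>

definition general_linear_group :: "'k::field itself \<Rightarrow> nat \<Rightarrow> 'k mat monoid" where
  "general_linear_group K n = units_of (ring_mat K n ())"

definition representations ::
    "('g, 'b) monoid_scheme \<Rightarrow> nat \<Rightarrow> ('g \<Rightarrow> 'k::field mat) set" where
  "representations G n = hom G (general_linear_group TYPE('k) n)"

definition same_orbit ::
    "('g, 'b) monoid_scheme \<Rightarrow> ('g \<Rightarrow> 'k::field mat) \<Rightarrow> 'k vec \<Rightarrow> 'k vec \<Rightarrow> bool" where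
  "same_orbit G \<rho> v w \<longleftrightarrow> (\<exists>g\<in>carrier G. w = \<rho> g *\<^sub>v v)"


section \<open>The coordinate ring and its invariants\<close>

text \<open>
  Polynomials are finitely supported maps from exponent vectors to coefficients, with the ring
  structure of \<^theory>\<open>HOL-Library.Poly_Mapping\<close>. They are kept distinct from
  the functions they induce, since \<open>K\<close> may be finite.
\<close>

type_synonym 'k polynomial = "(nat \<Rightarrow>\<^sub>0 nat) \<Rightarrow>\<^sub>0 'k"

definition const :: "'k::field \<Rightarrow> 'k polynomial" where
  "const c = Poly_Mapping.single 0 c"

definition var :: "nat \<Rightarrow> 'k::field polynomial" where
  "var i = Poly_Mapping.single (Poly_Mapping.single i 1) 1"

definition coordinate_ring :: "nat \<Rightarrow> 'k::field polynomial set" where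
  "coordinate_ring n = {p. \<forall>m\<in>Poly_Mapping.keys p. Poly_Mapping.keys m \<subseteq> {..<n}}"

definition monomial_degree :: "(nat \<Rightarrow>\<^sub>0 nat) \<Rightarrow> nat" where
  "monomial_degree m = (\<Sum>i\<in>Poly_Mapping.keys m. Poly_Mapping.lookup m i)"

definition homogeneous :: "nat \<Rightarrow> 'k::field polynomial \<Rightarrow> bool" where
  "homogeneous e p \<longleftrightarrow> (\<forall>m\<in>Poly_Mapping.keys p. monomial_degree m = e)"

definition poly_eval :: "'k::field polynomial \<Rightarrow> 'k vec \<Rightarrow> 'k" where
  "poly_eval p v = (\<Sum>m\<in>Poly_Mapping.keys p.
     Poly_Mapping.lookup p m * (\<Prod>i\<in>Poly_Mapping.keys m. (v $ i) ^ Poly_Mapping.lookup m i))"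

definition poly_subst :: "(nat \<Rightarrow> 'k::field polynomial) \<Rightarrow> 'k polynomial \<Rightarrow> 'k polynomial" where
  "poly_subst \<sigma> p = (\<Sum>m\<in>Poly_Mapping.keys p.
     const (Poly_Mapping.lookup p m) * (\<Prod>i\<in>Poly_Mapping.keys m. \<sigma> i ^ Poly_Mapping.lookup m i))"

text \<open>
  The action \<open>(g \<cdot> f)(v) = f(g\<^sup>-\<^sup>1 v)\<close>: the algebra automorphism sending the coordinate function
  \<open>x\<^sub>i\<close> to the linear form given by the \<open>i\<close>-th row of \<open>\<rho>(g\<^sup>-\<^sup>1)\<close>.
  See \<open>poly_eval_poly_action\<close> below.
\<close>

definition poly_action ::
    "('g, 'b) monoid_scheme \<Rightarrow> nat \<Rightarrow> ('g \<Rightarrow> 'k::field mat) \<Rightarrow> 'g \<Rightarrow> 'k polynomial \<Rightarrow> 'k polynomial"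
where
  "poly_action G n \<rho> g f =
     poly_subst (\<lambda>i. \<Sum>j<n. const (\<rho> (inv\<^bsub>G\<^esub> g) $$ (i, j)) * var j) f"

definition invariants ::
    "('g, 'b) monoid_scheme \<Rightarrow> nat \<Rightarrow> ('g \<Rightarrow> 'k::field mat) \<Rightarrow> 'k polynomial set" where
  "invariants G n \<rho> = {f \<in> coordinate_ring n. \<forall>g\<in>carrier G. poly_action G n \<rho> g f = f}"

definition invariants_upto ::
    "('g, 'b) monoid_scheme \<Rightarrow> nat \<Rightarrow> ('g \<Rightarrow> 'k::field mat) \<Rightarrow> nat \<Rightarrow> 'k polynomial set" where
  "invariants_upto G n \<rho> d =
     {\<Sum>e\<le>d. h e | h. \<forall>e\<le>d. h e \<in> invariants G n \<rho> \<and> homogeneous e (h e)}"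


section \<open>The separating Noether number\<close>

definition separating_set ::
    "('g, 'b) monoid_scheme \<Rightarrow> nat \<Rightarrow> ('g \<Rightarrow> 'k::field mat) \<Rightarrow> 'k polynomial set \<Rightarrow> bool" where
  "separating_set G n \<rho> S \<longleftrightarrow> S \<subseteq> invariants G n \<rho> \<and>
     (\<forall>v\<in>carrier_vec n. \<forall>w\<in>carrier_vec n.
        (\<forall>f\<in>S. poly_eval f v = poly_eval f w) \<longrightarrow> same_orbit G \<rho> v w)"

text \<open>
  Both numbers are taken in \<^typ>\<open>enat\<close>, so that the infimum of a nonempty set is its minimum
  (and \<open>\<infinity>\<close> for the empty set), and the supremum of an unbounded set is \<open>\<infinity>\<close>.
\<close>

definition beta_sep_rep ::
    "('g, 'b) monoid_scheme \<Rightarrow> nat \<Rightarrow> ('g \<Rightarrow> 'k::field mat) \<Rightarrow> enat" where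
  "beta_sep_rep G n \<rho> = Inf {enat d | d. separating_set G n \<rho> (invariants_upto G n \<rho> d)}"

definition beta_sep :: "'k::field itself \<Rightarrow> ('g, 'b) monoid_scheme \<Rightarrow> enat" where
  "beta_sep K G =
     Sup {beta_sep_rep G n \<rho> | n (\<rho> :: 'g \<Rightarrow> 'k mat). \<rho> \<in> representations G n}"

definition has_multiplicative_order :: "'k::field \<Rightarrow> nat \<Rightarrow> bool" where
  "has_multiplicative_order z n \<longleftrightarrow> 0 < n \<and> z ^ n = 1 \<and> (\<forall>k. 0 < k \<and> k < n \<longrightarrow> z ^ k \<noteq> 1)"


section \<open>Groups given by generators and relations\<close>

text \<open>
  A letter \<open>(x, True)\<close> stands for the generator \<open>x\<close> and \<open>(x, False)\<close> for its inverse; a relation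
  \<open>u = v\<close> is the pair \<open>(u, v)\<close> of words. The group consists of the classes of the
  smallest congruence on words containing the free cancellations and the given relations.
\<close>

type_synonym 'x word = "('x \<times> bool) list"

inductive word_cong :: "('x word \<times> 'x word) set \<Rightarrow> 'x word \<Rightarrow> 'x word \<Rightarrow> bool" for R where
  relation: "(u, v) \<in> R \<Longrightarrow> word_cong R u v"
| cancel: "word_cong R [(x, e), (x, \<not> e)] []"
| refl: "word_cong R u u"
| sym: "word_cong R u v \<Longrightarrow> word_cong R v u"
| trans: "word_cong R u v \<Longrightarrow> word_cong R v w \<Longrightarrow> word_cong R u w"
| append: "word_cong R u v \<Longrightarrow> word_cong R u' v' \<Longrightarrow> word_cong R (u @ u') (v @ v')"

definition word_class :: "('x word \<times> 'x word) set \<Rightarrow> 'x word \<Rightarrow> 'x word set" where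
  "word_class R u = {v. word_cong R u v}"

definition presented_group :: "('x word \<times> 'x word) set \<Rightarrow> 'x word set monoid" where
  "presented_group R =
     \<lparr>carrier = range (word_class R),
      Group.monoid.mult = (\<lambda>A B. \<Union>u\<in>A. \<Union>v\<in>B. word_class R (u @ v)),
      one = word_class R []\<rparr>"

datatype dic_generator = Dic_a | Dic_b

text \<open>
  \<open>Dic\<^bsub>4m\<^esub> = \<langle>a, b | a\<^sup>2\<^sup>m = 1, b\<^sup>2 = a\<^sup>m, b a b\<^sup>-\<^sup>1 = a\<^sup>-\<^sup>1\<rangle>\<close>. The argument is \<open>m\<close>, not the order \<open>4m\<close>.
\<close>

definition dicyclic_group :: "nat \<Rightarrow> dic_generator word set monoid" where
  "dicyclic_group m = presented_group
     {(replicate (2 * m) (Dic_a, True), []),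
      ([(Dic_b, True), (Dic_b, True)], replicate m (Dic_a, True)),
      ([(Dic_b, True), (Dic_a, True), (Dic_b, False)], [(Dic_a, False)])}"


section \<open>Consistency of the definitions\<close>

lemma poly_eval_superset:
  assumes "finite S" "Poly_Mapping.keys p \<subseteq> S"
  shows "poly_eval p v = (\<Sum>m\<in>S.
    Poly_Mapping.lookup p m * (\<Prod>i\<in>Poly_Mapping.keys m. (v $ i) ^ Poly_Mapping.lookup m i))"
  unfolding poly_eval_def using assms
  by (intro sum.mono_neutral_left) (auto simp: in_keys_iff)

lemma poly_eval_add: "poly_eval (p + q) v = poly_eval p v + poly_eval q v"
proof -
  let ?S = "Poly_Mapping.keys p \<union> Poly_Mapping.keys q"
  have "Poly_Mapping.keys (p + q) \<subseteq> ?S" by (rule Poly_Mapping.keys_add)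
  then show ?thesis
    by (simp add: poly_eval_superset[of ?S] lookup_add distrib_right sum.distrib)
qed

lemma poly_eval_zero [simp]: "poly_eval 0 v = 0"
  by (simp add: poly_eval_def)

lemma poly_eval_sum: "poly_eval (\<Sum>x\<in>S. f x) v = (\<Sum>x\<in>S. poly_eval (f x) v)"
  by (induction S rule: infinite_finite_induct) (auto simp: poly_eval_add)

lemma poly_eval_single:
  "poly_eval (Poly_Mapping.single m c) v = c * (\<Prod>i\<in>Poly_Mapping.keys m. (v $ i) ^ Poly_Mapping.lookup m i)"
  by (cases "c = 0") (auto simp: poly_eval_def)

lemma monomial_eval_superset:
  fixes v :: "'k::field vec"
  assumes "finite S" "Poly_Mapping.keys m \<subseteq> S"
  shows "(\<Prod>i\<in>Poly_Mapping.keys m. (v $ i) ^ Poly_Mapping.lookup m i) =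
    (\<Prod>i\<in>S. (v $ i) ^ Poly_Mapping.lookup m i)"
  using assms by (intro prod.mono_neutral_left) (auto simp: in_keys_iff)

lemma monomial_eval_add:
  fixes v :: "'k::field vec"
  shows "(\<Prod>i\<in>Poly_Mapping.keys (l + m). (v $ i) ^ Poly_Mapping.lookup (l + m) i) =
    (\<Prod>i\<in>Poly_Mapping.keys l. (v $ i) ^ Poly_Mapping.lookup l i) *
    (\<Prod>i\<in>Poly_Mapping.keys m. (v $ i) ^ Poly_Mapping.lookup m i)"
proof -
  let ?S = "Poly_Mapping.keys l \<union> Poly_Mapping.keys m"
  have "Poly_Mapping.keys (l + m) \<subseteq> ?S" by (rule Poly_Mapping.keys_add)
  then have "(\<Prod>i\<in>Poly_Mapping.keys (l + m). (v $ i) ^ Poly_Mapping.lookup (l + m) i) =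
      (\<Prod>i\<in>?S. (v $ i) ^ Poly_Mapping.lookup (l + m) i)"
    by (intro monomial_eval_superset) auto
  also have "\<dots> = (\<Prod>i\<in>?S. (v $ i) ^ Poly_Mapping.lookup l i) *
      (\<Prod>i\<in>?S. (v $ i) ^ Poly_Mapping.lookup m i)"
    by (simp add: lookup_add power_add prod.distrib)
  also have "(\<Prod>i\<in>?S. (v $ i) ^ Poly_Mapping.lookup l i) =
      (\<Prod>i\<in>Poly_Mapping.keys l. (v $ i) ^ Poly_Mapping.lookup l i)"
    by (intro monomial_eval_superset[symmetric]) auto
  also have "(\<Prod>i\<in>?S. (v $ i) ^ Poly_Mapping.lookup m i) =
      (\<Prod>i\<in>Poly_Mapping.keys m. (v $ i) ^ Poly_Mapping.lookup m i)"
    by (intro monomial_eval_superset[symmetric]) auto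
  finally show ?thesis .
qed

lemma polynomial_induct [case_names zero add_monomial]:
  fixes p :: "'k::field polynomial"
  assumes "P 0" and "\<And>f m c. P f \<Longrightarrow> P (f + Poly_Mapping.single m c)"
  shows "P p"
proof (induction p rule: Poly_Mapping.update_induct)
  case const
  show ?case by (rule assms)
next
  case (update f m c)
  then have "Poly_Mapping.update m c f = f + Poly_Mapping.single m c"
    by (intro poly_mapping_eqI)
      (auto simp: lookup_update lookup_add lookup_single when_def in_keys_iff)
  with update show ?case using assms(2) by simp
qed

lemma poly_eval_mult: "poly_eval (p * q) v = poly_eval p v * poly_eval q v"
proof -
  have *: "poly_eval (p * Poly_Mapping.single m c) v =
      poly_eval p v * poly_eval (Poly_Mapping.single m c) v" for p m c
  proof (induction p rule: polynomial_induct)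
    case zero
    show ?case by simp
  next
    case (add_monomial f l b)
    have "poly_eval (Poly_Mapping.single l b * Poly_Mapping.single m c) v =
        poly_eval (Poly_Mapping.single l b) v * poly_eval (Poly_Mapping.single m c) v"
      unfolding mult_single poly_eval_single monomial_eval_add by (simp add: mult_ac)
    with add_monomial show ?case
      by (simp only: distrib_right poly_eval_add)
  qed
  show ?thesis
  proof (induction q rule: polynomial_induct)
    case zero
    show ?case by simp
  next
    case (add_monomial f m c)
    then show ?case by (simp only: * distrib_left poly_eval_add)
  qed
qed

lemma poly_eval_const [simp]: "poly_eval (const c) v = c"
  by (simp add: const_def poly_eval_single)

lemma poly_eval_var [simp]: "poly_eval (var i) v = v $ i"
  by (simp add: var_def poly_eval_single)

lemma poly_eval_one [simp]: "poly_eval 1 v = 1"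
  using poly_eval_const[of 1 v] by (simp add: const_def)

lemma poly_eval_power: "poly_eval (p ^ k) v = poly_eval p v ^ k"
  by (induction k) (auto simp: poly_eval_mult)

lemma poly_eval_prod: "poly_eval (\<Prod>x\<in>S. f x) v = (\<Prod>x\<in>S. poly_eval (f x) v)"
  by (induction S rule: infinite_finite_induct) (auto simp: poly_eval_mult)

lemma poly_eval_poly_action:
  fixes \<rho> :: "'g \<Rightarrow> 'k::field mat"
  assumes G: "group G" and \<rho>: "\<rho> \<in> representations G n" and g: "g \<in> carrier G"
    and f: "f \<in> coordinate_ring n" and v: "v \<in> carrier_vec n"
  shows "poly_eval (poly_action G n \<rho> g f) v = poly_eval f (\<rho> (inv\<^bsub>G\<^esub> g) *\<^sub>v v)"
proof -
  let ?M = "\<rho> (inv\<^bsub>G\<^esub> g)"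
  have "?M \<in> carrier (general_linear_group TYPE('k) n)"
    using group.inv_closed[OF G g] \<rho> by (auto simp: representations_def hom_def)
  then have M: "?M \<in> carrier_mat n n"
    by (simp add: general_linear_group_def units_of_def Units_def ring_mat_def)
  have *: "(\<Sum>j<n. ?M $$ (i, j) * v $ j) = (?M *\<^sub>v v) $ i" if "i < n" for i
  proof -
    have "(?M *\<^sub>v v) $ i = (\<Sum>j\<in>{0..<n}. row ?M i $ j * v $ j)"
      using that M v by (simp add: scalar_prod_def)
    also have "\<dots> = (\<Sum>j\<in>{0..<n}. ?M $$ (i, j) * v $ j)"
      using that M by (intro sum.cong) auto
    finally show ?thesis by (simp add: lessThan_atLeast0)
  qed
  have "poly_eval (poly_action G n \<rho> g f) v = (\<Sum>m\<in>Poly_Mapping.keys f.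
      Poly_Mapping.lookup f m *
      (\<Prod>i\<in>Poly_Mapping.keys m. (\<Sum>j<n. ?M $$ (i, j) * v $ j) ^ Poly_Mapping.lookup m i))"
    unfolding poly_action_def poly_subst_def
    by (simp only: poly_eval_sum poly_eval_mult poly_eval_prod poly_eval_power
        poly_eval_const poly_eval_var)
  also have "\<dots> = poly_eval f (?M *\<^sub>v v)"
    unfolding poly_eval_def
  proof (intro sum.cong prod.cong arg_cong2[where f = "(*)"] arg_cong2[where f = "(^)"] * HOL.refl)
    show "i < n" if "m \<in> Poly_Mapping.keys f" "i \<in> Poly_Mapping.keys m" for m i
      using that f by (auto simp: coordinate_ring_def)
  qed
  finally show ?thesis .
qed

lemma word_class_eq_iff: "word_class R u = word_class R v \<longleftrightarrow> word_cong R u v"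
proof
  assume "word_class R u = word_class R v"
  moreover have "word_cong R v v" by (rule word_cong.refl)
  ultimately show "word_cong R u v" by (auto simp: word_class_def)
next
  assume "word_cong R u v"
  then show "word_class R u = word_class R v"
    unfolding word_class_def
    by (intro Collect_cong iffI) (metis word_cong.sym word_cong.trans)+
qed

lemma presented_group_mult:
  "word_class R u \<otimes>\<^bsub>presented_group R\<^esub> word_class R v = word_class R (u @ v)"
proof -
  have *: "word_class R (u' @ v') = word_class R (u @ v)"
    if "u' \<in> word_class R u" "v' \<in> word_class R v" for u' v'
  proof -
    have "word_cong R (u @ v) (u' @ v')"
      using that by (intro word_cong.append) (simp_all add: word_class_def)
    then show ?thesis
      unfolding word_class_eq_iff by (rule word_cong.sym)
  qed
  have mem: "w \<in> word_class R w" for w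
    by (simp add: word_class_def word_cong.refl)
  have "(\<Union>u'\<in>word_class R u. \<Union>v'\<in>word_class R v. word_class R (u' @ v')) =
      (\<Union>u'\<in>word_class R u. \<Union>v'\<in>word_class R v. word_class R (u @ v))"
    by (intro SUP_cong HOL.refl *)
  also have "\<dots> = word_class R (u @ v)"
    using mem[of u] mem[of v] by (simp add: UN_constant split: if_splits) blast
  finally show ?thesis
    unfolding presented_group_def by simp
qed

lemma group_presented_group: "group (presented_group R)"
proof (rule groupI)
  let ?inv = "\<lambda>u. rev (map (\<lambda>(x, e). (x, \<not> e)) u)"
  have carr: "carrier (presented_group R) = range (word_class R)"
    and one: "\<one>\<^bsub>presented_group R\<^esub> = word_class R []"
    by (simp_all add: presented_group_def)
  note simps = carr one presented_group_mult
  have inv: "word_cong R (?inv u @ u) []" for u :: "'a word"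
  proof (induction u)
    case Nil
    show ?case by (simp add: word_cong.refl)
  next
    case (Cons l u)
    obtain x e where l: "l = (x, e)" by (cases l)
    have "word_cong R ([(x, \<not> e), (x, e)] @ u) ([] @ u)"
      using word_cong.cancel[of R x "\<not> e"] by (intro word_cong.append word_cong.refl) simp
    then have "word_cong R (?inv u @ [(x, \<not> e), (x, e)] @ u) (?inv u @ u)"
      by (intro word_cong.append word_cong.refl) simp
    from word_cong.trans[OF this Cons.IH] show ?case by (simp add: l)
  qed
  show "x \<otimes>\<^bsub>presented_group R\<^esub> y \<in> carrier (presented_group R)"
    if "x \<in> carrier (presented_group R)" "y \<in> carrier (presented_group R)" for x y
    using that by (auto simp: simps)
  show "\<one>\<^bsub>presented_group R\<^esub> \<in> carrier (presented_group R)"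
    by (simp add: simps)
  show "x \<otimes>\<^bsub>presented_group R\<^esub> y \<otimes>\<^bsub>presented_group R\<^esub> z =
      x \<otimes>\<^bsub>presented_group R\<^esub> (y \<otimes>\<^bsub>presented_group R\<^esub> z)"
    if "x \<in> carrier (presented_group R)" "y \<in> carrier (presented_group R)"
      "z \<in> carrier (presented_group R)" for x y z
    using that by (auto simp: simps)
  show "\<one>\<^bsub>presented_group R\<^esub> \<otimes>\<^bsub>presented_group R\<^esub> x = x"
    if "x \<in> carrier (presented_group R)" for x
    using that by (auto simp: simps)
  show "\<exists>y\<in>carrier (presented_group R). y \<otimes>\<^bsub>presented_group R\<^esub> x = \<one>\<^bsub>presented_group R\<^esub>"
    if "x \<in> carrier (presented_group R)" for x
  proof -
    from that obtain u where "x = word_class R u" by (auto simp: carr)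
    then show ?thesis
      by (intro bexI[of _ "word_class R (?inv u)"]) (auto simp: simps word_class_eq_iff inv)
  qed
qed

end

theory Submission
  imports
    Defs
    "HOL-Number_Theory.Cong"
    "HOL-Computational_Algebra.Computational_Algebra"
    "HOL-Algebra.Multiplicative_Group"
begin

text \<open>
  Let \<open>a\<close> generate the cyclic subgroup, of order \<open>N\<close>, let \<open>b\<close> be an element outside of it, and write
  \<open>b a b\<^sup>-\<^sup>1 = a\<^sup>k\<close> and \<open>b\<^sup>2 = a\<^sup>s\<close>. Then \<open>k\<^sup>2 = 1\<close> and \<open>k s = s\<close> modulo \<open>N\<close>, and the group is cyclic if
  \<open>k = 1\<close> and one of \<open>N\<close>, \<open>s\<close> is odd. Otherwise it is dicyclic if and only if \<open>a\<close>, \<open>b\<close> can be chosen with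
  \<open>k = - 1\<close>, \<open>N\<close> even and \<open>s = N/2\<close>. The claim is that invariants of degree \<open>N + 1\<close>, or \<open>N + 2\<close> in the
  dicyclic case, are needed and suffice.

  They are needed. Let \<open>x, y\<close> be the coordinates of the representation induced from a faithful
  character of \<open>\<langle>a\<rangle>\<close>, and \<open>t\<close> the coordinate of the sign character of \<open>G/\<langle>a\<rangle>\<close>. At points with \<open>y = 0\<close> the
  first invariant that sees the sign of \<open>t\<close> is \<open>t (x\<^sup>N - y\<^sup>N)\<close>. In the dicyclic case \<open>x y\<close> and
  \<open>x\<^sup>N - y\<^sup>N\<close> are both negated by \<open>b\<close>, and the first invariant that is not symmetric in \<open>x\<close> and \<open>y\<close> is
  \<open>x y (x\<^sup>N - y\<^sup>N)\<close>.

  They suffice. The sum over the group of the translates of a product of linear forms is an invariant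
  (\<open>orbit_sum_invariant\<close>). If \<open>v\<close> and \<open>w\<close> agree on the invariants of degree at most \<open>D\<close>, then
  \<open>M(v) + M(b v) = M(w) + M(b w)\<close> for each \<open>a\<close>-invariant product \<open>M\<close> of at most \<open>D\<close> linear forms, and from
  here on only these equations are used (\<open>orbits_separated\<close>). Assume that \<open>w\<close> is not in the orbit of
  \<open>v\<close>. Then neither \<open>w\<close> nor \<open>b w\<close> is in the orbit of \<open>v\<close> under the rotations \<open>a\<^sup>i\<close>, so there are
  \<open>a\<close>-invariant products \<open>M\<close> with \<open>M(v) \<noteq> M(w)\<close> and \<open>M'\<close> with \<open>M'(v) \<noteq> M'(b w)\<close>. The point is that
  \<open>deg M + deg M' \<le> D\<close> is impossible (\<open>failure_degrees\<close>): \<open>b\<close> acts on the values of the invariants of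
  \<open>a\<close> as a group of order two, and orbits of such a group are separated by invariants of degree at
  most two.

  It remains to find such witnesses of small total degree. Because pairwise compatible congruences have a
  common solution, witnesses can be sought among the monomials in two eigenforms of \<open>a\<close>; if
  all forms whose weight generates the character group of \<open>\<langle>a\<rangle>\<close> vanish at the points in question, these
  monomials have degree at most \<open>N/2\<close> (\<open>rotation_from_unfaithful\<close>), which is a contradiction. So some faithful form \<open>x\<close>
  does not vanish, and the equations for \<open>x\<^sup>N\<close> and for a power of the norm \<open>x y\<close>, where \<open>y = x \<circ> b\<close>, allow
  us to move \<open>w\<close> within its orbit to a point with \<open>x(v) = x(w)\<close>. From then on every form \<open>f\<close> with
  \<open>f(v) \<noteq> f(w)\<close> yields a witness \<open>x\<^sup>g f\<close> with \<open>g < N\<close>, and likewise for \<open>b w\<close>, unless \<open>x\<^sup>N\<close>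
  is a witness there. In the first case powers of \<open>x\<^sup>N\<close> can be cancelled from the products of the two
  witnesses; in the second, the equations for the monomials \<open>x\<^sup>i y\<^sup>j f\<close> and \<open>x\<^sup>i y\<^sup>j\<close> are contradictory
  (\<open>degree_bound_normalized\<close>). Whether enough of these monomials are short enough is a question
  about \<open>N\<close>, \<open>k\<close>, \<open>s\<close> alone (\<open>twist_arithmetic\<close>), and the exception that it leaves is the dicyclic case.
\<close>

section \<open>Arithmetic of an involution modulo \<open>N\<close>\<close>

text \<open>
  Here \<open>k\<close> is the action of \<open>b\<close> on exponents and \<open>b\<^sup>2 = a\<^sup>s\<close>. For coordinates \<open>x\<close>, \<open>y\<close> of weights \<open>1\<close>
  and \<open>k\<close> that \<open>b\<close> exchanges, \<open>d\<close> is the order of \<open>k + 1\<close>, so that \<open>(x y)\<^sup>d\<close> is invariant under \<open>a\<close>; \<open>b\<close>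
  multiplies it by \<open>1\<close> or \<open>- 1\<close>, and \<open>(x y)\<^sup>t\<close> is invariant in either case. The last clause provides a
  short \<open>a\<close>-invariant monomial \<open>x\<^sup>i y\<^sup>j\<close> with \<open>\<bar>i - j\<bar> = c\<close>, unless \<open>k = - 1\<close> and \<open>s = N/2\<close>.

  With \<open>k + 1 = c l\<close> the exponents \<open>(j + c, j)\<close> work if \<open>l j = - 1\<close> modulo \<open>d\<close>, and \<open>0 \<le> j < d\<close> bounds their
  sum. The bound is good enough for large \<open>c\<close>. For \<open>c = 2\<close> the exponents \<open>(d - j - 2, d - j)\<close> are the
  alternative. The remaining value \<open>j = d - 1\<close> forces \<open>l = 1\<close> modulo \<open>d\<close>, which leaves \<open>k = 1\<close> for \<open>c = 2\<close>
  and \<open>N = 8\<close>, \<open>k = 3\<close> for \<open>c = 4\<close>, where \<open>s\<close> rules out \<open>t = 2 d\<close>.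
\<close>

lemma twist_arithmetic_int:
  fixes N k s :: int
  assumes N: "N > 0" and kk: "N dvd (k - 1) * (k + 1)" and ks: "N dvd (k - 1) * s"
    and nc: "\<not> (N dvd k - 1 \<and> (odd N \<or> odd s))"
  obtains c d t where "N = c * d" "c > 0" "d > 0" "t = d \<or> t = 2 * d" "t dvd N" "2 * t \<le> N"
    "N dvd (k + 1) * d" "N dvd s * t"
    "\<And>g. 1 \<le> g \<Longrightarrow> g < t \<Longrightarrow> \<not> N dvd k - 1 \<Longrightarrow>
       (g = 1 \<and> N dvd k + 1 \<and> even N \<and> N dvd s - N div 2) \<or>
       (\<exists>i j. 0 \<le> i \<and> 0 \<le> j \<and> (i = j + c \<or> j = i + c) \<and> N dvd i + k * j \<and> i + j \<le> N - g)"
proof -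
  define c where "c = gcd N (k + 1)"
  define d where "d = N div c"
  define l where "l = (k + 1) div c"
  have c: "c > 0" using N by (simp add: c_def)
  have Ncd: "N = c * d" by (simp add: d_def c_def)
  have d: "d > 0" using N c Ncd by (metis zero_less_mult_pos)
  have kl: "k + 1 = c * l" by (simp add: l_def c_def)
  have cop: "coprime d l"
    using N unfolding d_def l_def c_def by (intro div_gcd_coprime) auto
  have dk: "d dvd k - 1"
  proof -
    have "c * d dvd c * ((k - 1) * l)" using kk kl Ncd by (simp add: ac_simps)
    then have "d dvd (k - 1) * l" using c by simp
    then show ?thesis using cop by (simp add: coprime_dvd_mult_left_iff)
  qed
  obtain j where j: "0 \<le> j" "j < d" "d dvd l * j + 1"
  proof -
    obtain u where u: "[l * u = 1] (mod d)"
      using cong_solve_coprime_int[of l d] cop by (auto simp: coprime_commute)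
    have "[l * ((- u) mod d) + 1 = l * (- u) + 1] (mod d)"
      by (intro cong_add cong_mult) (auto simp: cong_def)
    also have "[l * (- u) + 1 = 0] (mod d)"
      using u by (simp add: cong_iff_dvd_diff dvd_diff_commute)
    finally have "d dvd l * ((- u) mod d) + 1" by (simp add: cong_0_iff)
    then show thesis using that[of "(- u) mod d"] d by simp
  qed
  have sol: "N dvd j + c + k * j"
  proof -
    have "j + c + k * j = c * (l * j + 1)" using kl by (simp add: algebra_simps) (metis distrib_left mult.right_neutral mult.left_commute)
    then show ?thesis using j(3) Ncd by simp
  qed
  have c2: "c \<ge> 2"
  proof (rule ccontr)
    assume "\<not> c \<ge> 2"
    then have c1: "c = 1" using c by simp
    then have "N dvd k - 1" using dk Ncd by simp
    moreover have "odd N"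
    proof
      assume "even N"
      moreover from this have "even (k - 1)" using \<open>N dvd k - 1\<close> by (meson dvd_trans)
      ultimately have "2 dvd c" unfolding c_def by (intro gcd_greatest) auto
      then show False using c1 by simp
    qed
    ultimately show False using nc by blast
  qed
  have kd: "N dvd (k + 1) * d" using kl Ncd by simp
  have twosd: "N dvd 2 * (s * d)"
  proof -
    have "2 * (s * d) = (k + 1) * d * s - (k - 1) * s * d" by (simp add: algebra_simps)
    then show ?thesis using kd ks by (metis dvd_diff dvd_mult2)
  qed
  have last: "N dvd k + 1 - c" if "j = d - 1"
  proof -
    have "d dvd l * d - (l * j + 1)" using j(3) by (intro dvd_diff) auto
    then have "d dvd l - 1" using that by (simp add: algebra_simps)
    then have "c * d dvd c * (l - 1)" by simp
    then show ?thesis using kl Ncd by (simp add: algebra_simps)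
  qed
  show thesis
  proof (cases "N dvd s * d")
    case True
    show thesis
    proof (rule that[of c d d])
      show "2 * d \<le> N" using c2 d Ncd by simp
      show "(g = 1 \<and> N dvd k + 1 \<and> even N \<and> N dvd s - N div 2) \<or>
        (\<exists>i j. 0 \<le> i \<and> 0 \<le> j \<and> (i = j + c \<or> j = i + c) \<and> N dvd i + k * j \<and> i + j \<le> N - g)"
        if g: "1 \<le> g" "g < d" and nk: "\<not> N dvd k - 1" for g
      proof (cases "2 * j + c \<le> N - g")
        case True
        then show ?thesis using j c sol by (intro disjI2 exI[of _ "j + c"] exI[of _ j]) auto
      next
        case False
        have "c = 2"
        proof (rule ccontr)
          assume "c \<noteq> 2"
          then have "0 \<le> (c - 3) * (d - 1)" using c2 d by simp
          then have "3 * d + c \<le> N + 3" using Ncd by (simp add: algebra_simps)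
          then show False using False j g by simp
        qed
        have "j \<noteq> d - 1" using last nk \<open>c = 2\<close> by auto
        have "N dvd (d - j - 2) + k * (d - j)"
        proof -
          have "(d - j - 2) + k * (d - j) = (k + 1) * d - (j + c + k * j)"
            using \<open>c = 2\<close> by (simp add: algebra_simps)
          then show ?thesis using kd sol by (metis dvd_diff)
        qed
        then show ?thesis using \<open>c = 2\<close> \<open>j \<noteq> d - 1\<close> j g False Ncd
          by (intro disjI2 exI[of _ "d - j - 2"] exI[of _ "d - j"]) auto
      qed
    qed (use True c d Ncd kd in auto)
  next
    case False
    have "even N"
    proof (rule ccontr)
      assume "odd N"
      then have "N dvd s * d" using twosd coprime_dvd_mult_right_iff[of N 2] by simp
      then show False using False by simp
    qed
    have half: "N dvd s * d - N div 2"
    proof -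
      obtain q where q: "2 * (s * d) = N * q" using twosd by auto
      have "odd q"
      proof
        assume "even q"
        then obtain r where "q = 2 * r" by auto
        then have "s * d = N * r" using q by simp
        then show False using False by simp
      qed
      then obtain r where r: "q = 2 * r + 1" by (rule oddE)
      obtain n where n: "N = 2 * n" using \<open>even N\<close> by auto
      have "s * d = n * q" using q n by simp
      then have "s * d - N div 2 = N * r" using n r by (simp add: algebra_simps)
      then show ?thesis by simp
    qed
    obtain q where q: "2 * (s * d) = N * q" using twosd by auto
    then have scq: "2 * s = c * q" using Ncd d by (simp add: mult.commute mult.left_commute)
    have oq: "odd q"
    proof
      assume "even q"
      then obtain r where "q = 2 * r" by auto
      then have "s * d = N * r" using q by simp
      then show False using False by simp
    qed
    have evc: "even c" using scq oq by (metis dvd_triv_left even_mult_iff)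
    have ok: "odd k"
    proof
      assume "even k"
      then have "odd ((k - 1) * (k + 1))" by simp
      then show False using kk \<open>even N\<close> by (meson dvd_trans)
    qed
    have c4: "c \<ge> 4"
    proof (rule ccontr)
      assume "\<not> c \<ge> 4"
      then have "c = 2 \<or> c = 3" using c2 by auto
      then have "c = 2" using evc by auto
      then have sq: "s = q" using scq by simp
      obtain r where r: "k - 1 = d * r" using dk by auto
      have "d * 2 dvd d * (r * s)" using ks r Ncd \<open>c = 2\<close> by (simp add: ac_simps)
      then have "2 dvd r * s" using d by simp
      then have "even r" using oq sq by simp
      then have "N dvd k - 1" using r Ncd \<open>c = 2\<close> by auto
      then show False using nc sq oq by blast
    qed
    show thesis
    proof (rule that[of c d "2 * d"])
      show "2 * d dvd N" using Ncd evc by auto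
      show "2 * (2 * d) \<le> N" using Ncd c4 d by simp
      show "N dvd s * (2 * d)" using twosd by (simp add: ac_simps)
      show "(g = 1 \<and> N dvd k + 1 \<and> even N \<and> N dvd s - N div 2) \<or>
        (\<exists>i j. 0 \<le> i \<and> 0 \<le> j \<and> (i = j + c \<or> j = i + c) \<and> N dvd i + k * j \<and> i + j \<le> N - g)"
        if g: "1 \<le> g" "g < 2 * d" and nk: "\<not> N dvd k - 1" for g
      proof (cases "d = 1")
        case True
        then show ?thesis using g kd half \<open>even N\<close> by (intro disjI1) auto
      next
        case dn1: False
        show ?thesis
        proof (cases "2 * j + c \<le> N - g")
          case True
          then show ?thesis using j c sol by (intro disjI2 exI[of _ "j + c"] exI[of _ j]) auto
        next
          case far: False
          have "c = 4"
          proof (rule ccontr)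
            assume "c \<noteq> 4"
            then have "c \<ge> 5" using c4 by simp
            then have "1 \<le> (c - 4) * (d - 1)" using dn1 d by (simp add: pos_zmult_eq_1_iff_lemma int_one_le_iff_zero_less)
            then have "4 * d + c \<le> N + 3" using Ncd by (simp add: algebra_simps)
            then show False using far j g by simp
          qed
          have "j = d - 1" using far g j Ncd \<open>c = 4\<close> by simp
          then have "N dvd k - 3" using last \<open>c = 4\<close> by simp
          then have "N dvd (k - 1) * (k + 1) - (k - 3) * (k + 3)" using kk by (intro dvd_diff) auto
          then have "N dvd 8" by (simp add: algebra_simps)
          then have "4 * d dvd (4 * 2 :: int)" using Ncd \<open>c = 4\<close> by simp
          then have "d dvd 2" unfolding dvd_mult_cancel_left by simp
          then have "d = 2" using dn1 d zdvd_imp_le[of d 2] by auto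
          then have N8: "N = 8" using Ncd \<open>c = 4\<close> by simp
          have "N dvd (k - 1) * s - (k - 3) * s" using ks \<open>N dvd k - 3\<close> by (intro dvd_diff) auto
          then have "N dvd s * d" using \<open>d = 2\<close> by (simp add: algebra_simps)
          then show ?thesis using False by simp
        qed
      qed
    qed (use c d Ncd kd in auto)
  qed
qed

lemma twist_arithmetic:
  fixes N k s :: nat
  assumes N: "N > 0" and kk: "[k * k = 1] (mod N)" and ks: "[k * s = s] (mod N)"
    and nc: "\<not> ([k = 1] (mod N) \<and> (odd N \<or> odd s))"
  obtains c d t where "N = c * d" "t = d \<or> t = 2 * d" "t > 0" "t dvd N" "2 * t \<le> N"
    "N dvd d + k * d" "N dvd t + k * t" "N dvd s * t"
    "\<And>g. 1 \<le> g \<Longrightarrow> g < t \<Longrightarrow> \<not> [k = 1] (mod N) \<Longrightarrow>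
       (g = 1 \<and> N dvd k + 1 \<and> even N \<and> [s = N div 2] (mod N)) \<or>
       (\<exists>i j. (i = j + c \<or> j = i + c) \<and> N dvd i + k * j \<and> i + j + g \<le> N)"
proof -
  have k1: "[k = 1] (mod N) \<longleftrightarrow> int N dvd int k - 1"
    by (metis cong_iff_dvd_diff cong_int_iff of_nat_1)
  have kk': "int N dvd (int k - 1) * (int k + 1)"
    using kk by (simp add: cong_iff_dvd_diff flip: cong_int_iff) (simp add: algebra_simps)
  have ks': "int N dvd (int k - 1) * int s"
    using ks by (simp add: cong_iff_dvd_diff flip: cong_int_iff) (simp add: algebra_simps)
  have nc': "\<not> (int N dvd int k - 1 \<and> (odd (int N) \<or> odd (int s)))"
    using nc k1 by simp
  have N': "int N > 0" using N by simp
  show thesis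
  proof (rule twist_arithmetic_int[OF N' kk' ks' nc'], goal_cases)
    case (1 c d t)
    note * = 1(1-8) and ** = 1(9)
    define c' d' t' where "c' = nat c" "d' = nat d" "t' = nat t"
    have nats: "c = int c'" "d = int d'" "t = int t'" using * by (auto simp: c'_d'_t'_def)
    show ?case
    proof (rule that[of c' d' t'])
      show "N = c' * d'" using *(1) unfolding nats by (metis of_nat_eq_iff of_nat_mult)
      show td: "t' = d' \<or> t' = 2 * d'" and "t' > 0" using * nats by auto
      show "t' dvd N" "2 * t' \<le> N" using *(5,6) unfolding nats(3) by (auto simp: int_dvd_int_iff)
      show dk: "N dvd d' + k * d'"
        using *(7) unfolding nats(2) by (simp add: algebra_simps flip: int_dvd_int_iff)
      then show "N dvd t' + k * t'"
        using td dvd_mult[OF dk, of 2] by (auto simp: algebra_simps)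
      show "N dvd s * t'" using *(8) unfolding nats by (metis int_dvd_int_iff of_nat_mult)
      fix g :: nat assume g: "1 \<le> g" "g < t'" "\<not> [k = 1] (mod N)"
      consider "g = 1" "int N dvd int k + 1" "even N" "int N dvd int s - int N div 2"
        | i j where "0 \<le> i" "0 \<le> j" "i = j + c \<or> j = i + c" "int N dvd i + int k * j" "i + j \<le> int N - int g"
        using **[of "int g"] g k1 nats by auto
      then show "(g = 1 \<and> N dvd k + 1 \<and> even N \<and> [s = N div 2] (mod N)) \<or>
         (\<exists>i j. (i = j + c' \<or> j = i + c') \<and> N dvd i + k * j \<and> i + j + g \<le> N)"
      proof cases
        case 1
        then have "N dvd k + 1" by (metis int_dvd_int_iff of_nat_1 of_nat_add)
        moreover have "[s = N div 2] (mod N)"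
          using 1(4) by (metis cong_iff_dvd_diff cong_int_iff of_nat_numeral zdiv_int)
        ultimately show ?thesis using 1 by simp
      next
        case (2 i j)
        then have "int N dvd int (nat i) + int k * int (nat j)" by simp
        then have "N dvd nat i + k * nat j"
          by (metis int_dvd_int_iff of_nat_add of_nat_mult)
        moreover have "nat i = nat j + c' \<or> nat j = nat i + c'" using 2 nats by auto
        moreover have "nat i + nat j + g \<le> N" using 2 by linarith
        ultimately show ?thesis by blast
      qed
    qed
  qed
qed

lemma square_cong_1_coprime:
  fixes k N :: nat
  assumes "[k * k = 1] (mod N)"
  shows "coprime k N"
  using cong_imp_coprime[of 1 "k * k" N] assms by (simp add: cong_sym_eq)

section \<open>Roots of unity\<close>

lemma root_of_unity_power_eq_iff:
  fixes z :: "'k::field"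
  assumes "has_multiplicative_order z N"
  shows "z ^ i = z ^ j \<longleftrightarrow> [i = j] (mod N)"
proof -
  have N: "N > 0" "z ^ N = 1" and min: "\<And>k. 0 < k \<Longrightarrow> k < N \<Longrightarrow> z ^ k \<noteq> 1"
    using assms by (auto simp: has_multiplicative_order_def)
  have z0: "z \<noteq> 0" using N by (metis power_0_left zero_neq_one less_irrefl)
  have red: "z ^ i = z ^ (i mod N)" for i
    by (metis N(2) div_mult_mod_eq mult.left_neutral mult.commute power_add power_mult power_one)
  have *: "i = j" if "z ^ i = z ^ j" "i \<le> j" "j < N" for i j
  proof (rule ccontr)
    assume "i \<noteq> j"
    have "z ^ i * z ^ (j - i) = z ^ i * 1"
      using that by (metis le_add_diff_inverse mult.right_neutral power_add)
    then have "z ^ (j - i) = 1" using z0 by simp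
    then show False using min[of "j - i"] that \<open>i \<noteq> j\<close> by simp
  qed
  show ?thesis
  proof
    assume "z ^ i = z ^ j"
    then have "z ^ (i mod N) = z ^ (j mod N)" using red by metis
    then have "i mod N = j mod N" using *[of "i mod N" "j mod N"] *[of "j mod N" "i mod N"] N
      by (metis mod_less_divisor nat_le_linear)
    then show "[i = j] (mod N)" by (simp add: cong_def)
  next
    assume "[i = j] (mod N)"
    then show "z ^ i = z ^ j" using red by (metis cong_def)
  qed
qed

lemma root_of_unity_power_eq_1_iff:
  fixes z :: "'k::field"
  assumes "has_multiplicative_order z N"
  shows "z ^ i = 1 \<longleftrightarrow> N dvd i"
  using root_of_unity_power_eq_iff[OF assms, of i 0] by (simp add: cong_0_iff)

lemma inj_on_root_powers:
  fixes z :: "'k::field"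
  assumes "has_multiplicative_order z N"
  shows "inj_on (\<lambda>i. z ^ i) {..<N}"
  by (auto simp: inj_on_def root_of_unity_power_eq_iff[OF assms] cong_def)

lemma root_of_unity_is_power:
  fixes z :: "'k::field"
  assumes z: "has_multiplicative_order z N" and y: "y ^ N = 1"
  obtains i where "i < N" "y = z ^ i"
proof -
  have N: "N > 0" "z ^ N = 1" using z by (auto simp: has_multiplicative_order_def)
  define p where "p = (Polynomial.monom 1 N - 1 :: 'k poly)"
  have deg: "degree p = N"
    using N degree_add_eq_left[of "- 1" "Polynomial.monom 1 N :: 'k poly"]
    by (simp add: p_def degree_monom_eq)
  then have p0: "p \<noteq> 0" using N by auto
  have roots: "poly p x = 0 \<longleftrightarrow> x ^ N = 1" for x by (simp add: p_def poly_monom)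
  have "(z ^ i) ^ N = 1" for i
    by (subst power_mult[symmetric], subst mult.commute) (simp add: power_mult N)
  then have sub: "(\<lambda>i. z ^ i) ` {..<N} \<subseteq> {x. poly p x = 0}"
    by (auto simp: roots)
  have "card {x. poly p x = 0} \<le> N"
    using card_poly_roots_bound[OF p0] unfolding deg .
  then have "card {x. poly p x = 0} \<le> card ((\<lambda>i. z ^ i) ` {..<N})"
    unfolding card_image[OF inj_on_root_powers[OF z]] card_lessThan .
  from card_seteq[OF poly_roots_finite[OF p0] sub this]
  have "(\<lambda>i. z ^ i) ` {..<N} = {x. poly p x = 0}" .
  moreover have "y \<in> {x. poly p x = 0}" unfolding mem_Collect_eq roots by (rule y)
  ultimately have "y \<in> (\<lambda>i. z ^ i) ` {..<N}" by (rule ssubst)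
  then show thesis by (rule imageE) (rule that, simp_all)
qed

text \<open>
  If \<open>N\<close> were zero in the field, then \<open>1 + X + \<dots> + X\<^sup>N\<^sup>-\<^sup>1\<close> would have the root \<open>1\<close> in addition to the
  \<open>N - 1\<close> nontrivial powers of \<open>z\<close>.
\<close>

lemma root_of_unity_order_ne_0:
  fixes z :: "'k::field"
  assumes z: "has_multiplicative_order z N"
  shows "of_nat N \<noteq> (0 :: 'k)"
proof
  assume "of_nat N = (0 :: 'k)"
  have N: "N > 0" "z ^ N = 1" using z by (auto simp: has_multiplicative_order_def)
  let ?q = "\<Sum>i<N. Polynomial.monom 1 i :: 'k poly"
  have coeff: "Polynomial.coeff ?q (N - 1) = 1"
    using N by (simp add: coeff_sum)
  then have q0: "?q \<noteq> 0" by (metis coeff_0 zero_neq_one)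
  have deg: "degree ?q \<le> N - 1"
    by (intro degree_sum_le) (auto intro: order_trans[OF degree_monom_le])
  have "poly ?q (z ^ i) = 0" if "i < N" for i
  proof (cases "i = 0")
    case True
    then show ?thesis using \<open>of_nat N = 0\<close> by (simp add: poly_sum poly_monom)
  next
    case False
    then have "z ^ i \<noteq> 1" using z that by (auto simp: has_multiplicative_order_def)
    moreover have "(z ^ i) ^ N = 1" by (subst power_mult[symmetric], subst mult.commute) (simp add: power_mult N)
    ultimately show ?thesis by (simp add: poly_sum poly_monom geometric_sum)
  qed
  then have "(\<lambda>i. z ^ i) ` {..<N} \<subseteq> {x. poly ?q x = 0}" by auto
  from card_mono[OF poly_roots_finite[OF q0] this] have "N \<le> card {x. poly ?q x = 0}"
    unfolding card_image[OF inj_on_root_powers[OF z]] card_lessThan .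
  then show False using card_poly_roots_bound[OF q0] deg N(1) by linarith
qed

lemma root_of_unity_power_coprime:
  fixes z :: "'k::field"
  assumes z: "has_multiplicative_order z N" and e: "coprime e N"
  shows "has_multiplicative_order (z ^ e) N"
  unfolding has_multiplicative_order_def
proof (intro conjI allI impI)
  show "0 < N" using z by (simp add: has_multiplicative_order_def)
  have iff: "(z ^ e) ^ i = 1 \<longleftrightarrow> N dvd i" for i
    using e by (simp add: root_of_unity_power_eq_1_iff[OF z] coprime_dvd_mult_right_iff
        coprime_commute flip: power_mult)
  show "(z ^ e) ^ N = 1" by (simp add: iff)
  show "(z ^ e) ^ i \<noteq> 1" if "0 < i \<and> i < N" for i
    using that by (auto simp: iff dest: nat_dvd_not_less)
qed

lemma root_of_unity_square:
  fixes z :: "'k::field"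
  assumes z: "has_multiplicative_order z (2 * N)"
  shows "has_multiplicative_order (z ^ 2) N"
  unfolding has_multiplicative_order_def
proof (intro conjI allI impI)
  show "0 < N" using z by (simp add: has_multiplicative_order_def)
  have iff: "(z ^ 2) ^ i = 1 \<longleftrightarrow> N dvd i" for i
    using root_of_unity_power_eq_1_iff[OF z, of "2 * i"] by (simp only: power_mult) simp
  show "(z ^ 2) ^ N = 1" by (simp add: iff)
  show "(z ^ 2) ^ i \<noteq> 1" if "0 < i \<and> i < N" for i
    using that by (simp only: iff) (auto dest: nat_dvd_not_less)
qed

lemma sum_root_powers:
  fixes z :: "'k::field"
  assumes z: "has_multiplicative_order z N"
  shows "(\<Sum>i<N. z ^ (e * i)) = (if N dvd e then of_nat N else 0)"
proof (cases "N dvd e")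
  case True
  then have "z ^ (e * i) = 1" for i by (simp add: root_of_unity_power_eq_1_iff[OF z])
  then show ?thesis using True by simp
next
  case False
  have "(z ^ e) ^ N = 1" by (simp add: root_of_unity_power_eq_1_iff[OF z] flip: power_mult)
  moreover have "z ^ e \<noteq> 1" using False by (simp add: root_of_unity_power_eq_1_iff[OF z])
  ultimately show ?thesis using False by (simp add: power_mult geometric_sum)
qed

section \<open>Systems of congruences\<close>

lemma gcd_Lcm_dvd:
  fixes n x :: int
  assumes "finite A" "\<And>a. a \<in> A \<Longrightarrow> gcd a n dvd x"
  shows "gcd (Lcm A) n dvd x"
  using assms
proof (induction A)
  case (insert a A)
  have "gcd (Lcm (insert a A)) n = lcm (gcd a n) (gcd (Lcm A) n)"
    using gcd_lcm_distrib[of n a "Lcm A"] by (simp add: gcd.commute)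
  then show ?case using insert by simp
qed simp

text \<open>
  Ideals of \<open>\<int>\<close> form a distributive lattice, so a system of congruences whose members are
  pairwise compatible is solvable.
\<close>

lemma pairwise_compatible_congruences:
  fixes A :: "(int \<times> int) set"
  assumes "finite A"
    and "\<And>n t n' t'. (n, t) \<in> A \<Longrightarrow> (n', t') \<in> A \<Longrightarrow> [t = t'] (mod gcd n n')"
  shows "\<exists>x. \<forall>(n, t)\<in>A. [x = t] (mod n)"
  using assms
proof (induction A)
  case (insert p A)
  obtain n t where p: "p = (n, t)" by (cases p)
  obtain x where x: "\<And>m u. (m, u) \<in> A \<Longrightarrow> [x = u] (mod m)"
    using insert.IH insert.prems by blast
  let ?L = "Lcm (fst ` A)"
  have "gcd ?L n dvd t - x"
  proof (rule gcd_Lcm_dvd)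
    show "finite (fst ` A)" using insert.hyps by simp
    fix m assume "m \<in> fst ` A"
    then obtain u where u: "(m, u) \<in> A" by force
    have "[t = u] (mod gcd m n)"
      using insert.prems[of n t m u] u p by (simp add: gcd.commute)
    moreover have "[x = u] (mod gcd m n)"
      using x[OF u] by (rule cong_dvd_modulus) simp
    ultimately have "[t = x] (mod gcd m n)" by (metis cong_sym cong_trans)
    then show "gcd m n dvd t - x" by (simp add: cong_iff_dvd_diff)
  qed
  then obtain q where q: "t - x = gcd ?L n * q" by (rule dvdE)
  obtain u v where uv: "u * ?L + v * n = gcd ?L n" using bezout_int by blast
  have L: "?L dvd (x + u * ?L * q) - x" by simp
  have n: "n dvd (x + u * ?L * q) - t"
  proof -
    have "(x + u * ?L * q) - t = n * (- v * q)"
      using q uv by (simp add: algebra_simps) (metis distrib_left mult.commute mult.left_commute)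
    then show ?thesis by (metis dvd_triv_left)
  qed
  show ?case
  proof (intro exI[of _ "x + u * ?L * q"] ballI)
    fix y assume "y \<in> insert p A"
    then consider "y = p" | m w where "y = (m, w)" "(m, w) \<in> A" by (cases y) auto
    then show "case y of (n, t) \<Rightarrow> [x + u * ?L * q = t] (mod n)"
    proof cases
      case 1
      then show ?thesis using n p by (simp add: cong_iff_dvd_diff)
    next
      case (2 m w)
      have "m dvd ?L" using 2 by (intro dvd_Lcm) force
      then have "[x + u * ?L * q = x] (mod m)"
        using L unfolding cong_iff_dvd_diff by (rule dvd_trans)
      then show ?thesis using x[OF 2(2)] 2(1) by (auto intro: cong_trans)
    qed
  qed
qed simp

section \<open>Products of linear forms under a twisted action\<close>

text \<open>
  Pairs with equal sums and equal sums of squares are equal up to a swap. If the first pairs are unequal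
  and hence swapped, then the mixed equation swaps the second pairs as well.
\<close>

lemma swapped_pairs_contradiction:
  fixes p q p' q' r t r' t' :: "'k::field"
  assumes two: "(2::'k) \<noteq> 0"
    and sums: "p + q = p' + q'" "r + t = r' + t'"
    and squares: "p\<^sup>2 + q\<^sup>2 = p'\<^sup>2 + q'\<^sup>2"
    and mixed: "p * r + q * t = p' * r' + q' * t'"
    and ne: "p \<noteq> p'"
  shows "r = t'"
proof -
  have "2 * (p * q) = 2 * (p' * q')"
    using squares arg_cong[OF sums(1), of "\<lambda>x. x\<^sup>2"] by (simp add: power2_sum)
  then have pq: "p * q = p' * q'" using two by simp
  have "(p - p') * (p - q') = p * p - p * (p' + q') + p' * q'" by (simp add: algebra_simps)
  also have "\<dots> = 0" using pq by (simp add: algebra_simps flip: sums(1))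
  finally have pq': "p = q'" using ne by simp
  then have qp': "q = p'" using sums(1) by simp
  have "(p - q) * (r - t') = (p * r + q * t) - (p' * r' + q' * t') - q * ((r + t) - (r' + t'))"
    unfolding pq' qp' by (simp add: algebra_simps)
  then have "(p - q) * (r - t') = 0" using mixed sums(2) by simp
  then show ?thesis using ne qp' by simp
qed

definition form_products :: "('v \<Rightarrow> 'k::field) set \<Rightarrow> nat \<Rightarrow> ('v \<Rightarrow> 'k) set" where
  "form_products F d = {\<lambda>v. \<Prod>f\<leftarrow>fs. f v | fs. set fs \<subseteq> F \<and> length fs \<le> d}"

lemma forms_one: "(\<lambda>v. 1) \<in> form_products F d"
  unfolding form_products_def by (intro CollectI exI[of _ "[]"]) simp

lemma forms_single: "f \<in> F \<Longrightarrow> f \<in> form_products F 1"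
  unfolding form_products_def by (intro CollectI exI[of _ "[f]"]) simp

lemma forms_mult:
  assumes "M \<in> form_products F d" "M' \<in> form_products F d'"
  shows "(\<lambda>v. M v * M' v) \<in> form_products F (d + d')"
proof -
  obtain fs fs' where "M = (\<lambda>v. \<Prod>f\<leftarrow>fs. f v)" "set fs \<subseteq> F" "length fs \<le> d"
    "M' = (\<lambda>v. \<Prod>f\<leftarrow>fs'. f v)" "set fs' \<subseteq> F" "length fs' \<le> d'"
    using assms unfolding form_products_def by blast
  then show ?thesis
    unfolding form_products_def by (intro CollectI exI[of _ "fs @ fs'"]) simp
qed

lemma forms_mono: "M \<in> form_products F d \<Longrightarrow> d \<le> d' \<Longrightarrow> M \<in> form_products F d'"
  unfolding form_products_def by (auto intro: order_trans)

text \<open>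
  The points are acted on by a group with generators \<open>\<alpha>\<close> and \<open>\<beta>\<close>, and \<open>F\<close> plays the role of the linear
  forms. Working with functions instead of polynomials is harmless here because only values at points
  are compared.
\<close>

locale twisted_action =
  fixes V :: "'v set" and \<alpha> \<beta> :: "'v \<Rightarrow> 'v" and N k s :: nat
    and F :: "('v \<Rightarrow> 'k::field) set"
  assumes N_pos: "N > 0"
    and \<alpha>_closed: "v \<in> V \<Longrightarrow> \<alpha> v \<in> V"
    and \<beta>_closed: "v \<in> V \<Longrightarrow> \<beta> v \<in> V"
    and \<alpha>_order: "v \<in> V \<Longrightarrow> (\<alpha> ^^ N) v = v"
    and \<beta>_\<alpha>: "v \<in> V \<Longrightarrow> \<beta> (\<alpha> v) = (\<alpha> ^^ k) (\<beta> v)"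
    and \<beta>_\<beta>: "v \<in> V \<Longrightarrow> \<beta> (\<beta> v) = (\<alpha> ^^ s) v"
    and F_\<alpha>: "f \<in> F \<Longrightarrow> (\<lambda>v. f (\<alpha> v)) \<in> F"
    and F_\<beta>: "f \<in> F \<Longrightarrow> (\<lambda>v. f (\<beta> v)) \<in> F"
    and F_zero: "(\<lambda>v. 0) \<in> F"
    and F_linear: "f \<in> F \<Longrightarrow> g \<in> F \<Longrightarrow> (\<lambda>v. f v + c * g v) \<in> F"
    and F_separates: "p \<in> V \<Longrightarrow> q \<in> V \<Longrightarrow> (\<And>f. f \<in> F \<Longrightarrow> f p = f q) \<Longrightarrow> p = q"
    and k_square: "[k * k = 1] (mod N)"
    and k_s: "[k * s = s] (mod N)"
begin

lemma \<alpha>_pow_closed: "v \<in> V \<Longrightarrow> (\<alpha> ^^ i) v \<in> V"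
  by (induction i) (auto intro: \<alpha>_closed)

lemma \<alpha>_pow_mult_order: "v \<in> V \<Longrightarrow> (\<alpha> ^^ (N * i)) v = v"
  by (induction i) (simp_all add: funpow_add \<alpha>_order)

lemma \<beta>_\<alpha>_pow: "v \<in> V \<Longrightarrow> \<beta> ((\<alpha> ^^ i) v) = (\<alpha> ^^ (k * i)) (\<beta> v)"
proof (induction i)
  case (Suc i)
  have "\<beta> (\<alpha> ((\<alpha> ^^ i) v)) = (\<alpha> ^^ k) ((\<alpha> ^^ (k * i)) (\<beta> v))"
    using Suc \<alpha>_pow_closed by (simp add: \<beta>_\<alpha>)
  then show ?case by (simp add: funpow_add)
qed simp

text \<open>
  Weights are exponents of a root of unity \<open>z\<close>, which is a parameter because it will be
  replaced by another primitive root in order to give a chosen form the weight \<open>1\<close>.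
\<close>

definition semiinvariants :: "'k \<Rightarrow> nat \<Rightarrow> nat \<Rightarrow> ('v \<Rightarrow> 'k) set" where
  "semiinvariants z d e = {M \<in> form_products F d. \<forall>v\<in>V. M (\<alpha> v) = z ^ e * M v}"

definition eigenforms :: "'k \<Rightarrow> nat \<Rightarrow> ('v \<Rightarrow> 'k) set" where
  "eigenforms z e = {f \<in> F. \<forall>v\<in>V. f (\<alpha> v) = z ^ e * f v}"

lemma eig_semi: "f \<in> eigenforms z e \<Longrightarrow> f \<in> semiinvariants z 1 e"
  by (simp add: eigenforms_def semiinvariants_def forms_single[simplified])

lemma semi_one: "(\<lambda>v. 1) \<in> semiinvariants z 0 0"
  by (simp add: semiinvariants_def forms_one)

lemma semi_mult:
  assumes "M \<in> semiinvariants z d e" "M' \<in> semiinvariants z d' e'"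
  shows "(\<lambda>v. M v * M' v) \<in> semiinvariants z (d + d') (e + e')"
  using assms by (auto simp: semiinvariants_def forms_mult power_add mult_ac)

lemma semi_power:
  assumes "M \<in> semiinvariants z d e"
  shows "(\<lambda>v. M v ^ n) \<in> semiinvariants z (n * d) (n * e)"
proof (induction n)
  case 0
  then show ?case by (simp add: semi_one)
next
  case (Suc n)
  then show ?case using semi_mult[OF assms Suc] by simp
qed

lemma semi_mono:
  assumes "M \<in> semiinvariants z d e" "has_multiplicative_order z N" "d \<le> d'" "[e = e'] (mod N)"
  shows "M \<in> semiinvariants z d' e'"
  using assms(1,3) root_of_unity_power_eq_iff[OF assms(2), of e e'] assms(4)
  by (auto simp: semiinvariants_def forms_mono)

lemma semi_\<alpha>_pow:
  assumes "M \<in> semiinvariants z d e" "v \<in> V"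
  shows "M ((\<alpha> ^^ i) v) = z ^ (e * i) * M v"
proof (induction i)
  case (Suc i)
  have "M (\<alpha> ((\<alpha> ^^ i) v)) = z ^ e * M ((\<alpha> ^^ i) v)"
    using assms(1) \<alpha>_pow_closed[OF assms(2)] by (simp add: semiinvariants_def)
  then show ?case using Suc by (simp add: power_add)
qed simp

lemma eig_\<alpha>_pow: "f \<in> eigenforms z e \<Longrightarrow> v \<in> V \<Longrightarrow> f ((\<alpha> ^^ i) v) = z ^ (e * i) * f v"
  by (rule semi_\<alpha>_pow[OF eig_semi])

lemma semi_invariant: "M \<in> semiinvariants z d 0 \<Longrightarrow> v \<in> V \<Longrightarrow> M ((\<alpha> ^^ i) v) = M v"
  using semi_\<alpha>_pow[of M z d 0 v i] by simp

lemma eig_\<beta>: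
  assumes "f \<in> eigenforms z e"
  shows "(\<lambda>v. f (\<beta> v)) \<in> eigenforms z (k * e)"
  using assms F_\<beta> eig_\<alpha>_pow[OF assms]
  by (auto simp: eigenforms_def \<beta>_\<alpha> \<beta>_closed mult.commute)

lemma eig_\<beta>_\<beta>: "f \<in> eigenforms z e \<Longrightarrow> v \<in> V \<Longrightarrow> f (\<beta> (\<beta> v)) = z ^ (e * s) * f v"
  by (simp add: \<beta>_\<beta> eig_\<alpha>_pow)

text \<open>
  The discrete Fourier transform writes \<open>N f\<close> as a sum of eigenforms.
\<close>

lemma eig_separates:
  assumes z: "has_multiplicative_order z N" and pq: "p \<in> V" "q \<in> V" "p \<noteq> q"
  obtains e f where "e < N" "f \<in> eigenforms z e" "f p \<noteq> f q"
proof -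
  obtain f where f: "f \<in> F" "f p \<noteq> f q" using F_separates pq by blast
  have f_pow: "(\<lambda>v. f ((\<alpha> ^^ i) v)) \<in> F" for i
    using f(1)
  proof (induction i)
    case (Suc i)
    show ?case using F_\<alpha>[OF Suc.IH[OF Suc.prems]] by (simp add: funpow_swap1)
  qed simp
  \<comment> \<open>the projection of \<open>f\<close> onto its component of weight \<open>e\<close>\<close>
  define g where "g e v = (\<Sum>i<N. z ^ ((N - 1) * e * i) * f ((\<alpha> ^^ i) v))" for e v
  have gF: "g e \<in> F" for e
  proof -
    have "(\<lambda>v. \<Sum>i<n. z ^ ((N - 1) * e * i) * f ((\<alpha> ^^ i) v)) \<in> F" for n
    proof (induction n)
      case (Suc n)
      show ?case using F_linear[OF Suc f_pow[of n]] by simp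
    qed (simp add: F_zero)
    then show ?thesis unfolding g_def .
  qed
  have "g e (\<alpha> v) = z ^ e * g e v" if v: "v \<in> V" for e v
  proof -
    let ?h = "\<lambda>i. z ^ ((N - 1) * e * i) * f ((\<alpha> ^^ i) v)"
    have step: "z ^ ((N - 1) * e * i) * f ((\<alpha> ^^ i) (\<alpha> v)) = z ^ e * ?h (Suc i)" for i
    proof -
      have "[(N - 1) * e * i = e + (N - 1) * e * Suc i] (mod N)"
      proof -
        have "e + (N - 1) * e * Suc i = N * e + (N - 1) * e * i"
          using N_pos by (cases N) (auto simp: algebra_simps)
        then show ?thesis unfolding cong_def by (simp only: mod_mult_self4)
      qed
      then have "z ^ ((N - 1) * e * i) = z ^ (e + (N - 1) * e * Suc i)"
        by (simp only: root_of_unity_power_eq_iff[OF z])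
      then show ?thesis by (simp only: power_add mult.assoc funpow.simps o_apply funpow_swap1)
    qed
    have last: "?h N = ?h 0"
    proof -
      have "z ^ ((N - 1) * e * N) = 1" by (simp add: root_of_unity_power_eq_1_iff[OF z])
      then show ?thesis using \<alpha>_order[OF v] by simp
    qed
    have "?h 0 + (\<Sum>i<N. ?h (Suc i)) = (\<Sum>i<N. ?h i) + ?h N"
      using sum.lessThan_Suc[of ?h N] sum.lessThan_Suc_shift[of ?h N] by (simp only:)
    then have shift: "(\<Sum>i<N. ?h (Suc i)) = (\<Sum>i<N. ?h i)"
      unfolding last by (simp only: add.commute add_left_cancel)
    have "g e (\<alpha> v) = (\<Sum>i<N. z ^ e * ?h (Suc i))" unfolding g_def step ..
    also have "\<dots> = z ^ e * g e v" unfolding sum_distrib_left[symmetric] shift g_def ..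
    finally show ?thesis .
  qed
  then have eig: "g e \<in> eigenforms z e" for e using gF by (simp add: eigenforms_def)
  have total: "(\<Sum>e<N. g e v) = of_nat N * f v" if v: "v \<in> V" for v
  proof -
    have "(\<Sum>e<N. g e v) = (\<Sum>i<N. (\<Sum>e<N. z ^ (((N - 1) * i) * e)) * f ((\<alpha> ^^ i) v))"
      unfolding g_def sum_distrib_right by (subst sum.swap) (simp only: mult.assoc mult.commute mult.left_commute)
    also have "\<dots> = (\<Sum>i<N. if i = 0 then of_nat N * f v else 0)"
    proof (rule sum.cong)
      fix i assume "i \<in> {..<N}"
      have "coprime N (N - 1)"
        using coprime_diff_one_left_nat[OF N_pos] by (rule coprime_imp_coprime) auto
      then have "N dvd (N - 1) * i \<longleftrightarrow> N dvd i" by (rule coprime_dvd_mult_right_iff)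
      also have "\<dots> \<longleftrightarrow> i = 0" using \<open>i \<in> {..<N}\<close> by (auto dest: nat_dvd_not_less)
      finally have "N dvd (N - 1) * i \<longleftrightarrow> i = 0" .
      then show "(\<Sum>e<N. z ^ (((N - 1) * i) * e)) * f ((\<alpha> ^^ i) v) =
          (if i = 0 then of_nat N * f v else 0)"
        by (simp only: sum_root_powers[OF z]) simp
    qed simp
    also have "\<dots> = of_nat N * f v" using N_pos by simp
    finally show ?thesis .
  qed
  have "\<exists>e<N. g e p \<noteq> g e q"
  proof (rule ccontr)
    assume "\<not> ?thesis"
    then have "(\<Sum>e<N. g e p) = (\<Sum>e<N. g e q)" by (intro sum.cong) auto
    then show False using total pq f(2) root_of_unity_order_ne_0[OF z] by simp
  qed
  then show thesis using that eig by blast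
qed

text \<open>
  For a representation, this says that \<open>v\<close> and \<open>w\<close> agree on the invariants that are averages of
  products of at most \<open>D\<close> linear forms: the sum over the rotations of an \<open>\<alpha>\<close>-invariant product only
  contributes a factor \<open>N\<close>, and it vanishes for products of any other weight.
\<close>

definition agree :: "nat \<Rightarrow> 'v \<Rightarrow> 'v \<Rightarrow> bool" where
  "agree D v w \<longleftrightarrow> (\<forall>M\<in>form_products F D. (\<forall>u\<in>V. M (\<alpha> u) = M u) \<longrightarrow> M v + M (\<beta> v) = M w + M (\<beta> w))"

lemma agreeD:
  assumes "agree D v w" "M \<in> semiinvariants z d 0" "d \<le> D"
  shows "M v + M (\<beta> v) = M w + M (\<beta> w)"
  using assms forms_mono[of M F d D] by (simp add: agree_def semiinvariants_def)

lemma agree_\<beta>: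
  assumes "agree D v w" "v \<in> V" "w \<in> V"
  shows "agree D v (\<beta> w)"
  unfolding agree_def
proof (intro ballI impI)
  fix M assume M: "M \<in> form_products F D" "\<forall>u\<in>V. M (\<alpha> u) = M u"
  then have "M \<in> semiinvariants 1 D 0" by (simp add: semiinvariants_def)
  then have "M (\<beta> (\<beta> w)) = M w" using semi_invariant assms(3) by (simp add: \<beta>_\<beta>)
  then show "M v + M (\<beta> v) = M (\<beta> w) + M (\<beta> (\<beta> w))"
    using assms(1) M by (simp add: agree_def)
qed

lemma agree_\<alpha>:
  assumes "agree D v w" "w \<in> V"
  shows "agree D v ((\<alpha> ^^ i) w)"
  unfolding agree_def
proof (intro ballI impI)
  fix M assume M: "M \<in> form_products F D" "\<forall>u\<in>V. M (\<alpha> u) = M u"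
  then have inv: "M ((\<alpha> ^^ j) u) = M u" if "u \<in> V" for j u
    using semi_invariant[of M 1 D u j] that by (simp add: semiinvariants_def)
  show "M v + M (\<beta> v) = M ((\<alpha> ^^ i) w) + M (\<beta> ((\<alpha> ^^ i) w))"
    using assms M inv \<beta>_closed by (simp add: agree_def \<beta>_\<alpha>_pow)
qed

text \<open>
  The reflection \<open>\<beta>\<close> acts on the values of \<open>M\<close> and \<open>M'\<close> as a group of order two. The invariants of degree
  two that are needed to compare the orbits of this group are the ones coming from \<open>M M'\<close> and from the square
  of whichever of \<open>M\<close>, \<open>M'\<close> has the smaller degree bound, and all of these stay within \<open>d + d'\<close>.
\<close>

lemma failure_degrees:
  assumes two: "(2::'k) \<noteq> 0" and agree: "agree D v w"
    and M: "M \<in> semiinvariants z d 0" "M' \<in> semiinvariants z d' 0" and D: "d + d' \<le> D" and ne: "M v \<noteq> M w"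
  shows "M' v = M' (\<beta> w)"
proof -
  have sums: "M v + M (\<beta> v) = M w + M (\<beta> w)" "M' v + M' (\<beta> v) = M' w + M' (\<beta> w)"
    using agreeD[OF agree M(1)] agreeD[OF agree M(2)] D by auto
  have mixed: "M v * M' v + M (\<beta> v) * M' (\<beta> v) = M w * M' w + M (\<beta> w) * M' (\<beta> w)"
    using agreeD[OF agree semi_mult[OF M, simplified] D] .
  show ?thesis
  proof (cases "d \<le> d'")
    case True
    have "(M v)\<^sup>2 + (M (\<beta> v))\<^sup>2 = (M w)\<^sup>2 + (M (\<beta> w))\<^sup>2"
      using agreeD[OF agree semi_power[OF M(1), of 2, simplified]] True D by simp
    from swapped_pairs_contradiction[OF two sums this mixed ne] show ?thesis .
  next
    case False
    have sq: "(M' v)\<^sup>2 + (M' (\<beta> v))\<^sup>2 = (M' (\<beta> w))\<^sup>2 + (M' w)\<^sup>2"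
      using agreeD[OF agree semi_power[OF M(2), of 2, simplified]] False D by simp
    show ?thesis
    proof (rule ccontr)
      assume ne': "M' v \<noteq> M' (\<beta> w)"
      have "M v = M w"
        by (rule swapped_pairs_contradiction[OF two _ _ sq _ ne', of "M v" "M (\<beta> v)" "M (\<beta> w)"])
          (use sums mixed in \<open>simp_all add: mult.commute add.commute\<close>)
      then show False using ne by simp
    qed
  qed
qed

end

section \<open>Forms whose weight has small order\<close>

context twisted_action begin

lemma eig_power_semi:
  assumes z: "has_multiplicative_order z N" and f: "f \<in> eigenforms z e" and n: "N dvd n * e"
  shows "(\<lambda>v. f v ^ n) \<in> semiinvariants z n 0"
proof -
  have "(\<lambda>v. f v ^ n) \<in> semiinvariants z (n * 1) (n * e)" by (rule semi_power[OF eig_semi[OF f]])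
  then show ?thesis by (rule semi_mono[OF _ z]) (use n in \<open>simp_all add: cong_0_iff\<close>)
qed

text \<open>
  The number \<open>n\<close> is the order of the weight \<open>e\<close>, so that the \<open>n\<close>-th roots of unity are the values of the
  corresponding character.
\<close>

lemma eig_ratio:
  assumes z: "has_multiplicative_order z N" and f0: "f v \<noteq> 0"
    and eq: "f w ^ n = f v ^ n" and n: "n = N div gcd e N"
  obtains t where "t < N" "f w = z ^ (e * t) * f v"
proof -
  let ?g = "gcd e N"
  have g: "?g > 0" "N = n * ?g" using N_pos n by auto
  have np: "n > 0" using g(2) N_pos by (metis gr0I mult_0)
  have "(f w / f v) ^ n = 1" using eq f0 by (simp add: power_divide)
  then have "(f w / f v) ^ N = 1" using g(2) by (metis power_mult power_one)
  then obtain i where i: "f w / f v = z ^ i" using root_of_unity_is_power[OF z] by metis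
  have "z ^ (i * n) = 1" using \<open>(f w / f v) ^ n = 1\<close> i by (simp add: power_mult)
  then have "n * ?g dvd n * i"
    using g(2) root_of_unity_power_eq_1_iff[OF z] by (metis mult.commute)
  then have "?g dvd i" using np by simp
  then obtain m where m: "i = ?g * m" by (rule dvdE)
  obtain y where "[e * y = ?g] (mod N)" using cong_solve_nat by blast
  then have "[e * y * m = ?g * m] (mod N)" by (rule cong_scalar_right)
  then have t: "[e * (y * m) = i] (mod N)" by (simp only: m mult.assoc)
  define t where "t = y * m"
  note t = t[folded t_def]
  have "z ^ (e * (t mod N)) = z ^ i"
    unfolding root_of_unity_power_eq_iff[OF z] using t
    by (metis cong_def mod_mult_right_eq)
  then have "f w = z ^ (e * (t mod N)) * f v" using i f0 by (simp add: field_simps)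
  then show thesis using that[of "t mod N"] N_pos by simp
qed

text \<open>
  Two eigenforms whose orders are proper divisors of \<open>N\<close> see the same rotation: this
  takes a two-variable monomial of degree at most \<open>N/2\<close>.
\<close>

lemma eig_pair_compatible:
  assumes z: "has_multiplicative_order z N" and vw: "v \<in> V" "w \<in> V"
    and inv: "\<And>M. M \<in> semiinvariants z (N div 2) 0 \<Longrightarrow> M v = M w"
    and f: "f \<in> eigenforms z e" "f v \<noteq> 0" "f w = z ^ (e * t) * f v" "\<not> coprime e N"
    and f': "f' \<in> eigenforms z e'" "f' v \<noteq> 0" "f' w = z ^ (e' * t') * f' v" "\<not> coprime e' N"
  shows "[int t = int t'] (mod gcd (int (N div gcd e N)) (int (N div gcd e' N)))"
proof -
  define n n' where "n = N div gcd e N" "n' = N div gcd e' N"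
  define g where "g = gcd n n'"
  have half: "N div gcd a N \<le> N div 2 \<and> N div gcd a N > 0" if "\<not> coprime a N" for a
  proof -
    have "gcd a N \<noteq> 1" "gcd a N \<noteq> 0" using that N_pos by (auto simp: coprime_iff_gcd_eq_1)
    then have "gcd a N \<ge> 2" by linarith
    then show ?thesis using N_pos by (simp add: div_le_mono2 div_greater_zero_iff gcd_le2_nat)
  qed
  have n: "n \<le> N div 2" "n > 0" and n': "n' \<le> N div 2" "n' > 0"
    using half f(4) f'(4) by (auto simp: n_n'_def)
  have g: "g > 0" using n by (simp add: g_def)
  obtain a b where ab: "n = g * a" "n' = g * b" by (metis dvdE g_def gcd_dvd1 gcd_dvd2)
  \<comment> \<open>\<open>e = gcd e N * u\<close> with \<open>u\<close> coprime to \<open>n\<close>, so \<open>e * a\<close> is \<open>u\<close> times \<open>N / g\<close>\<close>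
  obtain u where u: "e = gcd e N * u" "coprime u n"
  proof -
    have "coprime (e div gcd e N) (N div gcd e N)" using N_pos by (intro div_gcd_coprime) auto
    then show thesis using that[of "e div gcd e N"] by (simp add: n_n'_def)
  qed
  obtain u' where u': "e' = gcd e' N * u'" "coprime u' n'"
  proof -
    have "coprime (e' div gcd e' N) (N div gcd e' N)" using N_pos by (intro div_gcd_coprime) auto
    then show thesis using that[of "e' div gcd e' N"] by (simp add: n_n'_def)
  qed
  have Nn: "N = gcd e N * n" "N = gcd e' N * n'" by (auto simp: n_n'_def)
  define q where "q = gcd e N * a"
  have q: "N = g * q" using Nn(1) ab(1) unfolding q_def by (simp only: mult.left_commute)
  have q': "q = gcd e' N * b" proof -
    have "g * q = g * (gcd e' N * b)"
      using Nn(2) ab(2) q by (simp only: mult.left_commute)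
    then show ?thesis using g by simp
  qed
  have ea: "e * a = q * u" by (subst u(1)) (simp only: q_def ac_simps)
  have eb: "e' * b = q * u'" by (subst u'(1)) (simp only: q' ac_simps)
  have cop: "coprime u g" "coprime u' g"
    using u(2) u'(2) ab by (auto simp: coprime_mult_right_iff)
  obtain j where j: "j < g" "g dvd u + u' * j"
  proof -
    obtain x where x: "[u' * x = 1] (mod g)" using cong_solve_coprime_nat[OF cop(2)] by auto
    let ?j = "(x * ((g - 1) * u)) mod g"
    have "[u + u' * ?j = u + u' * (x * ((g - 1) * u))] (mod g)"
      by (intro cong_add cong_mult) (auto simp: cong_def)
    also have "u + u' * (x * ((g - 1) * u)) = u + (u' * x) * ((g - 1) * u)" by simp
    also have "[u + (u' * x) * ((g - 1) * u) = u + 1 * ((g - 1) * u)] (mod g)"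
      using x by (intro cong_add cong_mult cong_refl) simp
    also have "u + 1 * ((g - 1) * u) = g * u" using g by (cases g) auto
    also have "[g * u = 0] (mod g)" by (simp add: cong_0_iff)
    finally have "g dvd u + u' * ?j" by (simp only: cong_0_iff)
    then show thesis using that[of ?j] g by simp
  qed
  have wt: "N dvd e * a + e' * (b * j)"
  proof -
    have "e * a + e' * (b * j) = q * (u + u' * j)"
      using ea eb by (simp add: algebra_simps)
    then show ?thesis using j(2) q by (simp add: mult.commute mult_dvd_mono)
  qed
  have deg: "a + b * j \<le> N div 2"
  proof -
    have "g * (a + b * j) \<le> g * (a + b * (g - 1))" using j(1) by (intro mult_left_mono add_left_mono) auto
    also have "\<dots> = n + n' * (g - 1)" by (simp add: ab distrib_left)
    also have "\<dots> \<le> N div 2 + (N div 2) * (g - 1)" using n n' by (intro add_mono mult_right_mono) auto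
    also have "\<dots> = g * (N div 2)" using g by (cases g) auto
    finally show ?thesis using g by simp
  qed
  have "(\<lambda>v. f v ^ a * f' v ^ (b * j)) \<in> semiinvariants z (a * 1 + (b * j) * 1) (a * e + (b * j) * e')"
    by (intro semi_mult semi_power eig_semi f(1) f'(1))
  then have "(\<lambda>v. f v ^ a * f' v ^ (b * j)) \<in> semiinvariants z (N div 2) 0"
    by (rule semi_mono[OF _ z]) (use deg wt in \<open>simp_all add: cong_0_iff mult.commute\<close>)
  from inv[OF this]
  have "f v ^ a * f' v ^ (b * j) = f w ^ a * f' w ^ (b * j)" .
  also have "\<dots> = z ^ (e * t * a + e' * t' * (b * j)) * (f v ^ a * f' v ^ (b * j))"
    unfolding f(3) f'(3) by (simp add: power_mult_distrib power_add power_mult)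
  finally have "z ^ (e * t * a + e' * t' * (b * j)) = 1" using f(2) f'(2) by simp
  then have "N dvd e * t * a + e' * t' * (b * j)"
    by (simp only: root_of_unity_power_eq_1_iff[OF z])
  then have "int N dvd int (e * t * a + e' * t' * (b * j))" by (simp only: int_dvd_int_iff)
  moreover have "int N dvd int (e * a + e' * (b * j)) * int t'" using wt by (simp only: int_dvd_int_iff dvd_mult2)
  ultimately have "int N dvd int (e * t * a + e' * t' * (b * j)) - int (e * a + e' * (b * j)) * int t'"
    by (rule dvd_diff)
  also have "\<dots> = int (e * a) * (int t - int t')" by (simp add: algebra_simps)
  also have "\<dots> = int q * (int u * (int t - int t'))" by (simp add: ea)
  finally have "int q * int g dvd int q * (int u * (int t - int t'))" using q by (simp add: mult.commute)
  moreover have "q \<noteq> 0" using q N_pos by auto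
  ultimately have "int g dvd int u * (int t - int t')" by simp
  moreover have "coprime (int g) (int u)" using cop(1) by (simp add: coprime_commute)
  ultimately have "int g dvd int t - int t'" by (simp add: coprime_dvd_mult_right_iff)
  then show ?thesis by (simp add: cong_iff_dvd_diff g_def n_n'_def)
qed

text \<open>
  Each eigenform that does not vanish at \<open>v\<close> prescribes the rotation modulo the order of its weight.
  These congruences are pairwise compatible, so that a single rotation satisfies all of them.
\<close>

lemma rotation_from_unfaithful:
  assumes z: "has_multiplicative_order z N" and vw: "v \<in> V" "w \<in> V"
    and inv: "\<And>M. M \<in> semiinvariants z (N div 2) 0 \<Longrightarrow> M v = M w"
    and faithful: "\<And>e f. f \<in> eigenforms z e \<Longrightarrow> coprime e N \<Longrightarrow> f v = 0 \<and> f w = 0"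
  obtains i where "w = (\<alpha> ^^ i) v"
proof -
  have pow: "f w ^ (N div gcd e N) = f v ^ (N div gcd e N)"
    if "f \<in> eigenforms z e" "\<not> coprime e N" for f e
  proof -
    have "gcd e N \<noteq> 1" "gcd e N \<noteq> 0" using that N_pos by (auto simp: coprime_iff_gcd_eq_1)
    then have "gcd e N \<ge> 2" by linarith
    then have "N div gcd e N \<le> N div 2" by (intro div_le_mono2) auto
    moreover have "N dvd N div gcd e N * e"
      by (metis dvd_div_mult dvd_triv_left gcd_dvd1 gcd_dvd2 mult.commute div_mult_swap)
    ultimately have "(\<lambda>v. f v ^ (N div gcd e N)) \<in> semiinvariants z (N div 2) 0"
      using semi_mono[OF eig_power_semi[OF z that(1)] z _ cong_refl] by simp
    from inv[OF this] show ?thesis by simp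
  qed
  define A where "A = {(int (N div gcd e N), int t) | e t f.
    e < N \<and> t < N \<and> f \<in> eigenforms z e \<and> \<not> coprime e N \<and> f v \<noteq> 0 \<and> f w = z ^ (e * t) * f v}"
  have "A \<subseteq> (\<lambda>(e, t). (int (N div gcd e N), int t)) ` ({..<N} \<times> {..<N})"
    unfolding A_def by auto
  then have "finite A" by (rule finite_subset) simp
  moreover have "[t = t'] (mod gcd n n')" if "(n, t) \<in> A" "(n', t') \<in> A" for n t n' t'
    using that eig_pair_compatible[OF z vw inv] unfolding A_def by blast
  ultimately obtain x where x: "\<And>n t. (n, t) \<in> A \<Longrightarrow> [x = t] (mod n)"
    using pairwise_compatible_congruences[of A] by blast
  define i where "i = nat (x mod int N)"
  have i: "int i = x mod int N" using N_pos by (simp add: i_def)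
  have "w = (\<alpha> ^^ i) v"
  proof (rule ccontr)
    assume "w \<noteq> (\<alpha> ^^ i) v"
    then obtain e f where e: "e < N" and f: "f \<in> eigenforms z e" "f w \<noteq> f ((\<alpha> ^^ i) v)"
      using eig_separates[OF z vw(2) \<alpha>_pow_closed[OF vw(1)]] by blast
    have fi: "f ((\<alpha> ^^ i) v) = z ^ (e * i) * f v" by (rule eig_\<alpha>_pow[OF f(1) vw(1)])
    have nc: "\<not> coprime e N" using faithful[OF f(1)] f(2) fi by auto
    let ?n = "N div gcd e N"
    have n0: "?n > 0" using N_pos by (simp add: div_greater_zero_iff gcd_le2_nat)
    have f0: "f v \<noteq> 0"
    proof
      assume "f v = 0"
      then have "f w = 0" using pow[OF f(1) nc] n0 by (metis power_eq_0_iff power_0_left less_irrefl)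
      then show False using f(2) fi \<open>f v = 0\<close> by simp
    qed
    obtain t where t: "t < N" "f w = z ^ (e * t) * f v"
      using eig_ratio[where e = e and f = f, OF z f0 pow[OF f(1) nc] HOL.refl] by blast
    have "(int ?n, int t) \<in> A" unfolding A_def using e t f(1) nc f0 by blast
    then have "[x = int t] (mod int ?n)" by (rule x)
    moreover have "[int i = x] (mod int ?n)"
    proof (rule cong_dvd_modulus)
      show "[int i = x] (mod int N)" unfolding i by (simp add: cong_def)
      show "int ?n dvd int N"
        unfolding int_dvd_int_iff by (metis dvd_mult_div_cancel dvd_triv_right gcd_dvd2)
    qed
    ultimately have "[i = t] (mod ?n)" by (metis cong_int_iff cong_trans)
    then have "[e * i = e * t] (mod (e * ?n))" by (rule cong_cmult_leftI)
    moreover have "N dvd e * ?n"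
      by (metis dvd_div_mult dvd_triv_left gcd_dvd1 gcd_dvd2 mult.commute div_mult_swap)
    ultimately have "[e * i = e * t] (mod N)" by (rule cong_dvd_modulus_nat)
    then have "z ^ (e * i) = z ^ (e * t)" by (simp only: root_of_unity_power_eq_iff[OF z])
    then show False using f(2) fi t(2) by simp
  qed
  then show thesis by (rule that)
qed

end

section \<open>Two points with the same faithful coordinate\<close>

context twisted_action begin

text \<open>
  The product of \<open>x\<close> and \<open>x \<circ> \<beta>\<close> has weight \<open>e (1 + k)\<close>, and \<open>\<beta>\<close> exchanges its factors up to \<open>z\<^bsup>e s\<^esup>\<close>.
\<close>

lemma norm_agree:
  assumes z: "has_multiplicative_order z N" and two: "(2::'k) \<noteq> 0"
    and vw: "v \<in> V" "w \<in> V" and agree: "agree D v w" and x: "x \<in> eigenforms z e"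
    and t: "N dvd t + k * t" "N dvd s * t" "2 * t \<le> D"
  shows "x v ^ t * x (\<beta> v) ^ t = x w ^ t * x (\<beta> w) ^ t"
proof -
  define M where "M = (\<lambda>v. x v ^ t * x (\<beta> v) ^ t)"
  have "M \<in> semiinvariants z (t * 1 + t * 1) (t * e + t * (k * e))"
    unfolding M_def by (intro semi_mult semi_power eig_semi x eig_\<beta>)
  moreover have "N dvd t * e + t * (k * e)"
    using dvd_mult2[OF t(1), of e] by (simp add: algebra_simps)
  ultimately have M: "M \<in> semiinvariants z (2 * t) 0"
    by (elim semi_mono[OF _ z]) (simp_all add: cong_0_iff)
  have M\<beta>: "M (\<beta> u) = M u" if "u \<in> V" for u
  proof -
    have "(z ^ (e * s)) ^ t = 1"
      unfolding power_mult[symmetric] root_of_unity_power_eq_1_iff[OF z]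
      using t(2) by (simp add: mult.assoc)
    then show ?thesis
      using that by (simp add: M_def eig_\<beta>_\<beta>[OF x] power_mult_distrib mult.commute)
  qed
  have "2 * M v = 2 * M w"
    using agreeD[OF agree M t(3)] M\<beta> vw by simp
  then show ?thesis using two by (simp add: M_def)
qed

text \<open>
  The sum of the values of \<open>x\<^sup>N\<close> at \<open>v\<close> and \<open>\<beta> v\<close> is invariant, and so is their product, a power of the
  norm.
\<close>

lemma top_power_dichotomy:
  assumes z: "has_multiplicative_order z N" and two: "(2::'k) \<noteq> 0"
    and vw: "v \<in> V" "w \<in> V" and agree: "agree D v w" and x: "x \<in> eigenforms z e"
    and t: "N dvd t + k * t" "N dvd s * t" "2 * t \<le> D" "t dvd N" and D: "N \<le> D"
  shows "x v ^ N + x (\<beta> v) ^ N = x w ^ N + x (\<beta> w) ^ N"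
    and "x v ^ N = x w ^ N \<or> x v ^ N = x (\<beta> w) ^ N"
proof -
  show sum: "x v ^ N + x (\<beta> v) ^ N = x w ^ N + x (\<beta> w) ^ N"
    by (rule agreeD[OF agree eig_power_semi[OF z x] D]) simp
  obtain m where m: "N = t * m" using t(4) by (rule dvdE)
  have prod: "x v ^ N * x (\<beta> v) ^ N = x w ^ N * x (\<beta> w) ^ N"
    using arg_cong[OF norm_agree[OF z two vw agree x t(1-3)], of "\<lambda>y. y ^ m"]
    by (simp add: m power_mult power_mult_distrib)
  have "(x v ^ N - x w ^ N) * (x v ^ N - x (\<beta> w) ^ N) =
      x v ^ N * x v ^ N - x v ^ N * (x w ^ N + x (\<beta> w) ^ N) + x w ^ N * x (\<beta> w) ^ N"
    by (simp add: algebra_simps)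
  also have "\<dots> = 0" unfolding sum[symmetric] prod[symmetric] by (simp add: algebra_simps)
  finally show "x v ^ N = x w ^ N \<or> x v ^ N = x (\<beta> w) ^ N" by simp
qed

text \<open>
  A form that distinguishes the two points still does so after multiplication by a power of \<open>x\<close>, which
  makes it invariant.
\<close>

lemma balanced_form:
  assumes z: "has_multiplicative_order z N" and x: "x \<in> eigenforms z 1" and vw: "v \<in> V" "w \<in> V" "v \<noteq> w"
    and xvw: "x v = x w" "x v \<noteq> 0"
  obtains e g f where "f \<in> eigenforms z e" "g < N" "N dvd g + e" "f v \<noteq> f w"
    "(\<lambda>u. x u ^ g * f u) \<in> semiinvariants z (g + 1) 0"
proof -
  obtain e f where f: "e < N" "f \<in> eigenforms z e" "f v \<noteq> f w" by (rule eig_separates[OF z vw])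
  define g where "g = (N - e) mod N"
  have g: "g < N" using N_pos by (simp add: g_def)
  have dvd: "N dvd g + e"
  proof -
    have "(g + e) mod N = (N - e + e) mod N" unfolding g_def by (simp only: mod_add_left_eq)
    then show ?thesis using f(1) by (simp add: mod_0_imp_dvd)
  qed
  have "(\<lambda>u. x u ^ g * f u) \<in> semiinvariants z (g * 1 + 1) (g * 1 + e)"
    by (intro semi_mult semi_power eig_semi x f(2))
  then have "(\<lambda>u. x u ^ g * f u) \<in> semiinvariants z (g + 1) 0"
    by (rule semi_mono[OF _ z]) (use dvd in \<open>simp_all add: cong_0_iff\<close>)
  then show thesis using that f g dvd by blast
qed

text \<open>
  If \<open>x\<^sup>N\<close> takes one value at all four points, it can be cancelled from products that
  would be too long.
\<close>

lemma balanced_product_agree: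
  assumes z: "has_multiplicative_order z N" and agree: "agree D v w" and D: "N + 1 \<le> D"
    and x: "x \<in> eigenforms z 1"
    and const: "x (\<beta> v) ^ N = x v ^ N" "x w ^ N = x v ^ N" "x (\<beta> w) ^ N = x v ^ N"
    and f: "f \<in> eigenforms z e" "g < N" "N dvd g + e"
    and f': "f' \<in> eigenforms z e'" "g' < N" "N dvd g' + e'"
  shows "(x v ^ g * f v) * (x v ^ g' * f' v) + (x (\<beta> v) ^ g * f (\<beta> v)) * (x (\<beta> v) ^ g' * f' (\<beta> v))
       = (x w ^ g * f w) * (x w ^ g' * f' w) + (x (\<beta> w) ^ g * f (\<beta> w)) * (x (\<beta> w) ^ g' * f' (\<beta> w))"
proof -
  define h where "h = (if g + g' < N then g + g' else g + g' - N)"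
  define M where "M = (\<lambda>u. x u ^ h * f u * f' u)"
  have h: "h + 2 \<le> D" using f(2) f'(2) D by (auto simp: h_def)
  have "N dvd (g + e) + (g' + e')" using f(3) f'(3) by (rule dvd_add)
  then have wt: "N dvd h + e + e'"
  proof (cases "g + g' < N")
    case False
    then have "h + e + e' + N = (g + e) + (g' + e')" by (simp add: h_def)
    then have "N dvd h + e + e' + N" using \<open>N dvd (g + e) + (g' + e')\<close> by (simp only:)
    then show ?thesis by (simp only: dvd_add_left_iff dvd_refl)
  qed (simp add: h_def ac_simps)
  have "M \<in> semiinvariants z (h * 1 + 1 + 1) (h * 1 + e + e')"
    unfolding M_def by (intro semi_mult semi_power eig_semi x f(1) f'(1))
  then have "M \<in> semiinvariants z (h + 2) 0"
    by (rule semi_mono[OF _ z]) (use wt in \<open>simp_all add: cong_0_iff\<close>)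
  from agreeD[OF agree this h] have sum: "M v + M (\<beta> v) = M w + M (\<beta> w)" .
  define c where "c = (if g + g' < N then 1 else x v ^ N)"
  have prod: "(x u ^ g * f u) * (x u ^ g' * f' u) = c * M u" if "x u ^ N = x v ^ N" for u
  proof (cases "g + g' < N")
    case False
    then have "x u ^ g * x u ^ g' = x v ^ N * x u ^ h"
      unfolding that[symmetric] by (simp add: h_def flip: power_add)
    then show ?thesis using False by (simp add: M_def c_def mult_ac)
  qed (simp add: M_def c_def h_def power_add mult_ac)
  show ?thesis
    unfolding prod[OF HOL.refl] prod[OF const(1)] prod[OF const(2)] prod[OF const(3)]
    using arg_cong[OF sum, of "\<lambda>y. c * y"] by (simp only: distrib_left)
qed

text \<open>
  Let \<open>x\<^sup>g f\<close> distinguish \<open>v\<close> from \<open>w\<close>. If \<open>x\<^sup>N\<close> does not distinguish \<open>v\<close> from \<open>\<beta> w\<close>, then some \<open>x\<^bsup>g'\<^esup> f'\<close>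
  does, and \<open>balanced_product_agree\<close> leads to the same contradiction as \<open>failure_degrees\<close>. Otherwise
  \<open>x(\<beta> v)\<^sup>N = x(\<beta> w)\<^sup>N\<close> differs from \<open>x(v)\<^sup>N\<close>. For \<open>g \<ge> t\<close> this is refuted by two monomials that are
  linear in \<open>f\<close>. For \<open>0 < g < t\<close> the witness \<open>x\<^sup>g f\<close> is so short that by \<open>failure_degrees\<close> no short monomial
  in \<open>x\<close> and \<open>x \<circ> \<beta>\<close> distinguishes \<open>v\<close> from \<open>\<beta> w\<close>, and there are enough of these to conclude the same of
  \<open>x\<^sup>N\<close>. If the action is of dicyclic type, this step has \<open>g = 1\<close>, and \<open>D \<ge> N + 2\<close> admits \<open>x\<^sup>N\<close> itself.
\<close>

lemma degree_bound_normalized: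
  assumes z: "has_multiplicative_order z N" and two: "(2::'k) \<noteq> 0"
    and vw: "v \<in> V" "w \<in> V" and agree: "agree D v w" and D: "N + 1 \<le> D"
    and D_dic: "N dvd k + 1 \<Longrightarrow> even N \<Longrightarrow> [s = N div 2] (mod N) \<Longrightarrow> N + 2 \<le> D"
    and nc: "\<not> ([k = 1] (mod N) \<and> (odd N \<or> odd s))"
    and x: "x \<in> eigenforms z 1" "x v \<noteq> 0" "x w = x v"
    and central: "[k = 1] (mod N) \<Longrightarrow> x (\<beta> w) ^ N = x w ^ N"
    and ne: "v \<noteq> w" "\<And>i. \<beta> w \<noteq> (\<alpha> ^^ i) v"
  shows False
proof -
  show False
  proof (rule twist_arithmetic[OF N_pos k_square k_s nc], goal_cases)
    case (1 c d t)
    note Ncd = 1(1) and td = 1(2) and t = 1(3,4,5,8) and dk = 1(6) and tk = 1(7) and small = 1(9)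
    have tD: "2 * t \<le> D" and ND: "N \<le> D" using t D by auto
    note dich = top_power_dichotomy[OF z two vw agree x(1) tk t(4) tD t(2) ND]
    have yN: "x (\<beta> v) ^ N = x (\<beta> w) ^ N" using dich(1) x(3) by simp
    obtain e g f where f: "f \<in> eigenforms z e" "g < N" "N dvd g + e" "f v \<noteq> f w"
      and M: "(\<lambda>u. x u ^ g * f u) \<in> semiinvariants z (g + 1) 0"
      by (rule balanced_form[OF z x(1) vw ne(1) x(3)[symmetric] x(2)])
    define M where "M = (\<lambda>u. x u ^ g * f u)"
    note M = M[folded M_def]
    have M_ne: "M v \<noteq> M w" using f(4) x by (simp add: M_def)
    \<comment> \<open>Is \<open>v\<close> distinguished from \<open>\<beta> w\<close> by \<open>x\<^sup>N\<close>? If not, a second form does it.\<close>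
    show False
    proof (cases "x (\<beta> w) ^ N = x v ^ N")
      case True
      \<comment> \<open>some rotation of \<open>\<beta> w\<close> has the same \<open>x\<close>-coordinate as \<open>v\<close>\<close>
      obtain i where i: "x v = z ^ i * x (\<beta> w)"
      proof -
        have "x (\<beta> w) \<noteq> 0" using True x(2) N_pos by (metis power_eq_0_iff)
        moreover from this have "(x v / x (\<beta> w)) ^ N = 1" using True x(2) by (simp add: power_divide)
        then obtain i where "x v / x (\<beta> w) = z ^ i" by (rule root_of_unity_is_power[OF z])
        ultimately show thesis using that[of i] by (simp add: divide_eq_eq)
      qed
      define w' where "w' = (\<alpha> ^^ i) (\<beta> w)"
      have w': "w' \<in> V" using \<beta>_closed[OF vw(2)] \<alpha>_pow_closed by (simp add: w'_def)
      have xw': "x v = x w'" using eig_\<alpha>_pow[OF x(1) \<beta>_closed[OF vw(2)]] i by (simp add: w'_def)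
      have "v \<noteq> w'"
      proof
        assume "v = w'"
        then have "(\<alpha> ^^ ((N - 1) * i)) v = (\<alpha> ^^ ((N - 1) * i + i)) (\<beta> w)"
          by (simp add: w'_def funpow_add)
        also have "(N - 1) * i + i = N * i" using N_pos by (cases N) auto
        finally have "(\<alpha> ^^ ((N - 1) * i)) v = \<beta> w"
          unfolding \<alpha>_pow_mult_order[OF \<beta>_closed[OF vw(2)]] .
        then show False using ne(2)[of "(N - 1) * i"] by simp
      qed
      then obtain e' g' f' where f': "f' \<in> eigenforms z e'" "g' < N" "N dvd g' + e'" "f' v \<noteq> f' w'"
        and M': "(\<lambda>u. x u ^ g' * f' u) \<in> semiinvariants z (g' + 1) 0"
        by (rule balanced_form[OF z x(1) vw(1) w' _ xw' x(2)])
      have const: "x (\<beta> v) ^ N = x v ^ N" "x w ^ N = x v ^ N" "x (\<beta> w) ^ N = x v ^ N"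
        using True yN x(3) by auto
      note prod = balanced_product_agree[OF z agree D x(1) const]
      have "x v ^ g' * f' v = x (\<beta> w) ^ g' * f' (\<beta> w)"
      proof (rule swapped_pairs_contradiction[OF two _ _ _ prod[OF f(1-3) f'(1-3)]])
        show "x v ^ g * f v \<noteq> x w ^ g * f w" using M_ne by (simp add: M_def)
        show "x v ^ g * f v + x (\<beta> v) ^ g * f (\<beta> v) = x w ^ g * f w + x (\<beta> w) ^ g * f (\<beta> w)"
          using agreeD[OF agree M] f(2) D by (simp add: M_def)
        show "x v ^ g' * f' v + x (\<beta> v) ^ g' * f' (\<beta> v) = x w ^ g' * f' w + x (\<beta> w) ^ g' * f' (\<beta> w)"
          using agreeD[OF agree M'] f'(2) D by simp
        show "(x v ^ g * f v)\<^sup>2 + (x (\<beta> v) ^ g * f (\<beta> v))\<^sup>2 = (x w ^ g * f w)\<^sup>2 + (x (\<beta> w) ^ g * f (\<beta> w))\<^sup>2"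
          using prod[OF f(1-3) f(1-3)] by (simp only: power2_eq_square)
      qed
      also have "\<dots> = x w' ^ g' * f' w'"
        using semi_invariant[OF M' \<beta>_closed[OF vw(2)], of i] by (simp add: w'_def)
      finally show False using f'(4) xw' x(2) by simp
    next
      case False
      have not_central: "\<not> [k = 1] (mod N)" using central False x(3) by auto
      have crossed: "M' v = M' (\<beta> w)" if "M' \<in> semiinvariants z d' 0" "g + 1 + d' \<le> D" for M' d'
        by (rule failure_degrees[OF two agree M that M_ne])
      have xN: "(\<lambda>u. x u ^ N) \<in> semiinvariants z N 0" by (rule eig_power_semi[OF z x(1)]) simp
      \<comment> \<open>for \<open>g = 0\<close> the witnesses \<open>f\<close> and \<open>x\<^sup>N\<close> have total degree \<open>N + 1\<close>\<close>
      have g0: "g > 0"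
        using crossed[OF xN] D False by (cases g) auto
      \<comment> \<open>the equation for the monomial \<open>x\<^sup>i y\<^sup>j f\<close>, where \<open>y = x \<circ> \<beta>\<close>\<close>
      have E: "x v ^ i * x (\<beta> v) ^ j * f v + x (\<beta> v) ^ i * (z ^ s * x v) ^ j * f (\<beta> v) =
          x v ^ i * x (\<beta> w) ^ j * f w + x (\<beta> w) ^ i * (z ^ s * x v) ^ j * f (\<beta> w)"
        if "[i + k * j = g] (mod N)" "i + j \<le> N" for i j
      proof -
        define P where "P = (\<lambda>u. x u ^ i * x (\<beta> u) ^ j * f u)"
        have "P \<in> semiinvariants z (i * 1 + j * 1 + 1) (i * 1 + j * (k * 1) + e)"
          unfolding P_def by (intro semi_mult semi_power eig_semi x(1) eig_\<beta> f(1))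
        moreover have "[i * 1 + j * (k * 1) + e = 0] (mod N)"
        proof -
          have "[i + k * j + e = g + e] (mod N)" using that(1) by (intro cong_add cong_refl)
          also have "[g + e = 0] (mod N)" using f(3) by (simp add: cong_0_iff)
          finally show ?thesis by (simp add: mult.commute)
        qed
        ultimately have "P \<in> semiinvariants z (i + j + 1) 0" by (elim semi_mono[OF _ z]) simp_all
        from agreeD[OF agree this] show ?thesis
          using that(2) D vw x(3) by (simp add: P_def eig_\<beta>_\<beta>[OF x(1)])
      qed
      have Eg: "x v ^ g * f v + x (\<beta> v) ^ g * f (\<beta> v) = x v ^ g * f w + x (\<beta> w) ^ g * f (\<beta> w)"
        using E[of g 0] f(2) by simp
      have y0: "x (\<beta> v) \<noteq> 0" "x (\<beta> w) \<noteq> 0"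
      proof -
        have "x (\<beta> v) = 0 \<longleftrightarrow> x (\<beta> w) = 0" 
          using yN N_pos power_eq_0_iff[of "x (\<beta> v)" N] power_eq_0_iff[of "x (\<beta> w)" N] by simp
        moreover have "x (\<beta> v) \<noteq> 0 \<or> x (\<beta> w) \<noteq> 0" using Eg g0 x(2) f(4) by (auto simp: power_0_left)
        ultimately show "x (\<beta> v) \<noteq> 0" "x (\<beta> w) \<noteq> 0" by auto
      qed
      have yt: "x (\<beta> v) ^ t = x (\<beta> w) ^ t"
        using norm_agree[OF z two vw agree x(1) tk t(4) tD] x by simp
      have y_mult: "x (\<beta> v) ^ (t * m) = x (\<beta> w) ^ (t * m)" for m
        using yt by (simp add: power_mult)
      show False
      proof (cases "t \<le> g")
        case True
        \<comment> \<open>The exponents \<open>(g, 0)\<close> and \<open>(g - R, N - R)\<close> give two linear equations in the differences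
          of the values of \<open>f\<close> and of \<open>f \<circ> \<beta>\<close>; their determinant is a multiple of \<open>x(\<beta> v)\<^sup>N - x(v)\<^sup>N\<close>. The
          bounds \<open>g/2 \<le> R \<le> g\<close> keep the exponents nonnegative and the degree within \<open>N + 1\<close>.\<close>
        define R where "R = t * (g div t)"
        have R: "R \<le> g" "g \<le> 2 * R"
        proof -
          show "R \<le> g" by (simp add: R_def)
          have "g < t * (g div t) + t" using dividend_less_times_div[OF t(1), of g] by (simp add: add.commute)
          moreover have "t * 1 \<le> t * (g div t)"
            using True t(1) by (intro mult_left_mono) (simp_all add: div_greater_zero_iff Suc_le_eq)
          ultimately show "g \<le> 2 * R" unfolding R_def by linarith
        qed
        have tNR: "t dvd N - R" using t(2) by (simp add: R_def dvd_diff_nat)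
        then obtain m where m: "N - R = t * m" by (rule dvdE)
        have wt: "[g - R + k * (N - R) = g] (mod N)"
        proof -
          have "N dvd (t + k * t) * m" using tk by simp
          then have "N dvd (N - R) + k * (N - R)" by (simp add: m algebra_simps)
          then have "[g + ((N - R) + k * (N - R)) = g + 0] (mod N)"
            by (intro cong_add cong_refl) (simp only: cong_0_iff)
          moreover have "g - R + k * (N - R) + N = g + ((N - R) + k * (N - R))" using R f(2) by simp
          ultimately have "[g - R + k * (N - R) + N = g + 0] (mod N)" by (simp only:)
          then show ?thesis by (simp add: cong_def)
        qed
        have sNR: "(z ^ s) ^ (N - R) = 1"
          unfolding power_mult[symmetric] root_of_unity_power_eq_1_iff[OF z]
          using dvd_mult2[OF t(4), of m] by (simp add: m mult.assoc)
        have "x v ^ (g - R) * x (\<beta> v) ^ (N - R) * f v + x (\<beta> v) ^ (g - R) * x v ^ (N - R) * f (\<beta> v) =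
            x v ^ (g - R) * x (\<beta> v) ^ (N - R) * f w + x (\<beta> w) ^ (g - R) * x v ^ (N - R) * f (\<beta> w)"
          using E[OF wt] R f(2) y_mult[of m] by (simp add: sNR m[symmetric] power_mult_distrib)
        from arg_cong[OF this, of "\<lambda>a. x v ^ R * x (\<beta> v) ^ R * a"]
        have "(x v ^ R * x v ^ (g - R)) * (x (\<beta> v) ^ R * x (\<beta> v) ^ (N - R)) * f v
            + (x (\<beta> v) ^ R * x (\<beta> v) ^ (g - R)) * (x v ^ R * x v ^ (N - R)) * f (\<beta> v) =
            (x v ^ R * x v ^ (g - R)) * (x (\<beta> v) ^ R * x (\<beta> v) ^ (N - R)) * f w
            + (x (\<beta> v) ^ R * x (\<beta> w) ^ (g - R)) * (x v ^ R * x v ^ (N - R)) * f (\<beta> w)"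
          by (simp only: distrib_left ac_simps)
        moreover have "x (\<beta> v) ^ R * x (\<beta> w) ^ (g - R) = x (\<beta> w) ^ g"
          using y_mult[of "g div t"] R by (simp add: R_def[symmetric] flip: power_add)
        moreover have "y ^ R * y ^ (g - R) = y ^ g" "y ^ R * y ^ (N - R) = y ^ N" for y :: 'k
          using R f(2) by (simp_all flip: power_add)
        ultimately have lhs: "x v ^ g * x (\<beta> v) ^ N * f v + x (\<beta> v) ^ g * x v ^ N * f (\<beta> v) =
            x v ^ g * x (\<beta> v) ^ N * f w + x (\<beta> w) ^ g * x v ^ N * f (\<beta> w)"
          by (simp only:)
        have rhs: "x v ^ N * (x v ^ g * f v + x (\<beta> v) ^ g * f (\<beta> v)) =
            x v ^ N * (x v ^ g * f w + x (\<beta> w) ^ g * f (\<beta> w))"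
          using Eg by simp
        have "x v ^ g * (x (\<beta> v) ^ N - x v ^ N) * (f v - f w) =
            (x v ^ g * x (\<beta> v) ^ N * f v + x (\<beta> v) ^ g * x v ^ N * f (\<beta> v)) -
            (x v ^ g * x (\<beta> v) ^ N * f w + x (\<beta> w) ^ g * x v ^ N * f (\<beta> w)) -
            (x v ^ N * (x v ^ g * f v + x (\<beta> v) ^ g * f (\<beta> v)) -
             x v ^ N * (x v ^ g * f w + x (\<beta> w) ^ g * f (\<beta> w)))"
          by (simp add: algebra_simps)
        also have "\<dots> = 0" unfolding lhs rhs by simp
        finally have "x v ^ g * (x (\<beta> v) ^ N - x v ^ N) * (f v - f w) = 0" .
        then show False using x(2) f(4) False yN by simp
      next
        case gt: False
        \<comment> \<open>Now \<open>x\<^sup>g f\<close> is short, so that all \<open>\<alpha>\<close>-invariant monomials of degree up to \<open>N - g\<close> agree at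
          \<open>v\<close> and \<open>\<beta> w\<close>. The equation for \<open>x\<^sup>i y\<^sup>j\<close> with \<open>\<bar>i - j\<bar> = c\<close>, raised to the power \<open>d\<close> and combined
          with the one for the norm, shows that \<open>x\<^sup>N\<close> agrees there, too.\<close>
        have "1 \<le> g" "g < t" using g0 gt by auto
        from small[OF this not_central] consider
            "g = 1" "N dvd k + 1" "even N" "[s = N div 2] (mod N)"
          | i j where "i = j + c \<or> j = i + c" "N dvd i + k * j" "i + j + g \<le> N"
          by blast
        then show False
        proof cases
          case 1
          then have "g + 1 + N \<le> D" using D_dic by simp
          from crossed[OF xN this] show False using False by simp
        next
          case ij: (2 i j)
          \<comment> \<open>the norm of \<open>x\<close> to the power \<open>d\<close> does not distinguish \<open>v\<close> from \<open>\<beta> w\<close>\<close>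
          have nd: "x (\<beta> v) ^ d = (z ^ s * x (\<beta> w)) ^ d"
            using td
          proof
            assume "t = d"
            then have "(z ^ s) ^ d = 1"
              unfolding power_mult[symmetric] root_of_unity_power_eq_1_iff[OF z] using t(4) by simp
            then show ?thesis using yt \<open>t = d\<close> by (simp add: power_mult_distrib)
          next
            assume t2: "t = 2 * d"
            have "(\<lambda>u. x u ^ d * x (\<beta> u) ^ d) \<in> semiinvariants z (d * 1 + d * 1) (d * 1 + d * (k * 1))"
              by (intro semi_mult semi_power eig_semi x(1) eig_\<beta>)
            then have "(\<lambda>u. x u ^ d * x (\<beta> u) ^ d) \<in> semiinvariants z (2 * d) 0"
              by (rule semi_mono[OF _ z]) (use dk in \<open>simp_all add: cong_0_iff mult.commute\<close>)
            from crossed[OF this] have "x v ^ d * x (\<beta> v) ^ d = x (\<beta> w) ^ d * (z ^ s * x v) ^ d"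
              using t2 gt t(3) D x(3) vw by (simp add: eig_\<beta>_\<beta>[OF x(1)])
            then show ?thesis using x(2) by (simp add: power_mult_distrib)
          qed
          have "(\<lambda>u. x u ^ i * x (\<beta> u) ^ j) \<in> semiinvariants z (i * 1 + j * 1) (i * 1 + j * (k * 1))"
            by (intro semi_mult semi_power eig_semi x(1) eig_\<beta>)
          then have "(\<lambda>u. x u ^ i * x (\<beta> u) ^ j) \<in> semiinvariants z (i + j) 0"
            by (rule semi_mono[OF _ z]) (use ij(2) in \<open>simp_all add: cong_0_iff mult.commute\<close>)
          from crossed[OF this] have eq: "x v ^ i * x (\<beta> v) ^ j = x (\<beta> w) ^ i * (z ^ s * x v) ^ j"
            using ij(3) D x(3) vw by (simp add: eig_\<beta>_\<beta>[OF x(1)])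
          have zN: "(z ^ s) ^ N = 1" by (simp add: root_of_unity_power_eq_1_iff[OF z] flip: power_mult)
          show False
            using ij(1)
          proof
            assume i: "i = j + c"
            have "x v ^ c * x (\<beta> v) ^ j = x (\<beta> w) ^ c * (z ^ s * x (\<beta> w)) ^ j"
              using eq x(2) by (simp add: i power_add power_mult_distrib mult_ac)
            then have "(x v ^ c * x (\<beta> v) ^ j) ^ d = (x (\<beta> w) ^ c * (z ^ s * x (\<beta> w)) ^ j) ^ d"
              by (simp only:)
            then have "x v ^ N * (x (\<beta> v) ^ d) ^ j = x (\<beta> w) ^ N * ((z ^ s * x (\<beta> w)) ^ d) ^ j"
              by (simp only: power_mult_distrib[of "_ ^ c"] power_mult[symmetric] Ncd mult.commute)
            then have "x v ^ N = x (\<beta> w) ^ N" unfolding nd[symmetric] using y0 by simp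
            then show False using False by simp
          next
            assume j: "j = i + c"
            have "x (\<beta> v) ^ c * x (\<beta> v) ^ i = (z ^ s * x v) ^ c * (z ^ s * x (\<beta> w)) ^ i"
              using eq x(2) by (simp add: j power_add power_mult_distrib mult_ac)
            then have "(x (\<beta> v) ^ c * x (\<beta> v) ^ i) ^ d = ((z ^ s * x v) ^ c * (z ^ s * x (\<beta> w)) ^ i) ^ d"
              by (simp only:)
            then have "x (\<beta> v) ^ N * (x (\<beta> v) ^ d) ^ i = (z ^ s * x v) ^ N * ((z ^ s * x (\<beta> w)) ^ d) ^ i"
              by (simp only: power_mult_distrib[of "_ ^ c"] power_mult[symmetric] Ncd mult.commute)
            then have "x (\<beta> v) ^ N = (z ^ s * x v) ^ N" unfolding nd[symmetric] using y0 by simp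
            then show False using False yN zN by (simp add: power_mult_distrib)
          qed
        qed
      qed
    qed
  qed
qed

end

section \<open>Separation of the orbits of a twisted action\<close>

context twisted_action begin

lemma \<alpha>_pow_back:
  assumes "p \<in> V" "(\<alpha> ^^ i) p = q"
  shows "p = (\<alpha> ^^ ((N - 1) * i)) q"
proof -
  have "(\<alpha> ^^ ((N - 1) * i)) q = (\<alpha> ^^ ((N - 1) * i + i)) p"
    using assms(2) by (simp add: funpow_add)
  also have "(N - 1) * i + i = N * i" using N_pos by (cases N) auto
  finally show ?thesis using \<alpha>_pow_mult_order[OF assms(1)] by simp
qed

definition same_rotation_class :: "'v \<Rightarrow> 'v \<Rightarrow> bool" where
  "same_rotation_class v w \<longleftrightarrow> (\<exists>i. w = (\<alpha> ^^ i) v)"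

lemma degree_bound_same_top_power:
  assumes z: "has_multiplicative_order z N" and two: "(2::'k) \<noteq> 0"
    and vw: "v \<in> V" "w \<in> V" and agree: "agree D v w" and D: "N + 1 \<le> D"
    and D_dic: "N dvd k + 1 \<Longrightarrow> even N \<Longrightarrow> [s = N div 2] (mod N) \<Longrightarrow> N + 2 \<le> D"
    and nc: "\<not> ([k = 1] (mod N) \<and> (odd N \<or> odd s))"
    and x: "x \<in> eigenforms z 1" "x v \<noteq> 0" "x w ^ N = x v ^ N"
    and central: "\<And>u. [k = 1] (mod N) \<Longrightarrow> u \<in> V \<Longrightarrow> x (\<beta> u) ^ N = x u ^ N"
    and ne: "\<not> same_rotation_class v w" "\<not> same_rotation_class v (\<beta> w)"
  shows False
proof -
  have xw: "x w \<noteq> 0"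
    using x(2,3) N_pos power_eq_0_iff[of "x v" N] by (auto simp: power_0_left)
  then have "(x v / x w) ^ N = 1" using x(2,3) by (simp add: power_divide)
  then obtain i where "x v / x w = z ^ i" by (rule root_of_unity_is_power[OF z])
  then have i: "x v = z ^ i * x w" using xw by (simp add: divide_eq_eq)
  define w' where "w' = (\<alpha> ^^ i) w"
  have w': "w' \<in> V" using \<alpha>_pow_closed vw by (simp add: w'_def)
  show False
  proof (rule degree_bound_normalized[OF z two vw(1) w' _ D D_dic nc x(1,2)])
    show "agree D v w'" unfolding w'_def by (rule agree_\<alpha>[OF agree vw(2)])
    show "x w' = x v" using eig_\<alpha>_pow[OF x(1) vw(2), of i] i by (simp add: w'_def)
    show "x (\<beta> w') ^ N = x w' ^ N" if "[k = 1] (mod N)" using central[OF that w'] .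
    show "v \<noteq> w'"
      using \<alpha>_pow_back[OF vw(2), of i v] ne(1) by (auto simp: w'_def same_rotation_class_def)
    show "\<beta> w' \<noteq> (\<alpha> ^^ j) v" for j
    proof
      assume "\<beta> w' = (\<alpha> ^^ j) v"
      then have "(\<alpha> ^^ (k * i)) (\<beta> w) = (\<alpha> ^^ j) v" by (simp add: w'_def \<beta>_\<alpha>_pow[OF vw(2)])
      from \<alpha>_pow_back[OF \<beta>_closed[OF vw(2)] this]
      have "\<beta> w = (\<alpha> ^^ ((N - 1) * (k * i) + j)) v" by (simp add: funpow_add)
      then show False using ne(2) unfolding same_rotation_class_def by blast
    qed
  qed simp_all
qed

text \<open>
  Otherwise both \<open>w\<close> and \<open>\<beta> w\<close> would be distinguished from \<open>v\<close> in degree \<open>N/2\<close>.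
\<close>

lemma faithful_form_exists:
  assumes z: "has_multiplicative_order z N" and two: "(2::'k) \<noteq> 0"
    and vw: "v \<in> V" "w \<in> V" and agree: "agree D v w" and D: "N \<le> D"
    and ne: "\<not> same_rotation_class v w" "\<not> same_rotation_class v (\<beta> w)"
  obtains e x where "coprime e N" "x \<in> eigenforms z e" "x v \<noteq> 0 \<or> x w \<noteq> 0"
proof (rule ccontr)
  note witness = that
  assume "\<not> thesis"
  then have van: "x v = 0 \<and> x w = 0" if "x \<in> eigenforms z e" "coprime e N" for x e
    using that witness by blast
  have cop: "coprime (k * e) N" if "coprime e N" for e
    using that square_cong_1_coprime[OF k_square] by simp
  have "\<exists>M. M \<in> semiinvariants z (N div 2) 0 \<and> M v \<noteq> M w"
    using rotation_from_unfaithful[OF z vw] van ne(1) unfolding same_rotation_class_def by metis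
  then obtain M where M: "M \<in> semiinvariants z (N div 2) 0" "M v \<noteq> M w" by blast
  have "x v = 0 \<and> x (\<beta> w) = 0" if "x \<in> eigenforms z e" "coprime e N" for x e
    using van[OF that] van[OF eig_\<beta>[OF that(1)] cop[OF that(2)]] by simp
  then have "\<exists>M. M \<in> semiinvariants z (N div 2) 0 \<and> M v \<noteq> M (\<beta> w)"
    using rotation_from_unfaithful[OF z vw(1) \<beta>_closed[OF vw(2)]] ne(2)
    unfolding same_rotation_class_def by metis
  then obtain M' where M': "M' \<in> semiinvariants z (N div 2) 0" "M' v \<noteq> M' (\<beta> w)" by blast
  have "N div 2 + N div 2 \<le> D" using D by linarith
  from failure_degrees[OF two agree M(1) M'(1) this M(2)] M'(2) show False by simp
qed

text \<open>
  The faithful form may vanish at \<open>v\<close>, but then its translate by \<open>\<beta>\<close> does not, by \<open>top_power_dichotomy\<close>.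
  The same dichotomy allows us to replace \<open>w\<close> by \<open>\<beta> w\<close>, if necessary, so that \<open>x\<^sup>N\<close> agrees at \<open>v\<close> and \<open>w\<close>.
\<close>

theorem orbits_separated:
  fixes z :: 'k
  assumes z: "has_multiplicative_order z N" and two: "(2::'k) \<noteq> 0"
    and vw: "v \<in> V" "w \<in> V" and agree: "agree D v w" and D: "N + 1 \<le> D"
    and D_dic: "N dvd k + 1 \<Longrightarrow> even N \<Longrightarrow> [s = N div 2] (mod N) \<Longrightarrow> N + 2 \<le> D"
    and nc: "\<not> ([k = 1] (mod N) \<and> (odd N \<or> odd s))"
  shows "same_rotation_class v w \<or> same_rotation_class v (\<beta> w)"
proof (rule ccontr)
  assume "\<not> ?thesis"
  then have ne: "\<not> same_rotation_class v w" "\<not> same_rotation_class v (\<beta> w)" by auto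
  have ND: "N \<le> D" using D by simp
  \<comment> \<open>a power of the product of \<open>x\<close> and \<open>x \<circ> \<beta>\<close> that is invariant, for every eigenform \<open>x\<close>\<close>
  obtain t where t: "t dvd N" "2 * t \<le> D" "N dvd t + k * t" "N dvd s * t"
  proof (rule twist_arithmetic[OF N_pos k_square k_s nc], goal_cases)
    case (1 c d t)
    then show ?case using D by (intro that[of t]) auto
  qed
  obtain e x where e: "coprime e N" and x: "x \<in> eigenforms z e" "x v \<noteq> 0"
  proof -
    obtain e x where e: "coprime e N" and x: "x \<in> eigenforms z e" "x v \<noteq> 0 \<or> x w \<noteq> 0"
      by (rule faithful_form_exists[OF z two vw agree ND ne])
    show thesis
    proof (cases "x v = 0")
      case True
      note dich = top_power_dichotomy[OF z two vw agree x(1) t(3,4,2,1) ND]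
      have xw: "x w ^ N \<noteq> 0" using x(2) True by simp
      then have "x (\<beta> w) ^ N = 0" using dich(2) True N_pos by (auto simp: power_0_left)
      then have "x (\<beta> v) ^ N \<noteq> 0" using dich(1) True xw N_pos by (simp add: power_0_left)
      then have "x (\<beta> v) \<noteq> 0" using N_pos by (auto simp: power_0_left)
      moreover have "coprime (k * e) N" using e square_cong_1_coprime[OF k_square] by simp
      ultimately show thesis using that eig_\<beta>[OF x(1)] by blast
    qed (use that e x in blast)
  qed
  \<comment> \<open>If \<open>\<beta>\<close> commutes with \<open>\<alpha>\<close>, then \<open>x\<close> is replaced by a common eigenform; \<open>\<nu>\<close> is a square root of the
    factor by which \<open>\<beta> \<circ> \<beta>\<close> scales \<open>x\<close>, and it exists because \<open>s\<close> is even.\<close>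
  obtain x where x: "x \<in> eigenforms z e" "x v \<noteq> 0"
    and central: "\<And>u. [k = 1] (mod N) \<Longrightarrow> u \<in> V \<Longrightarrow> x (\<beta> u) ^ N = x u ^ N"
  proof (cases "[k = 1] (mod N)")
    case True
    then have even: "even N" "even s" using nc by auto
    then obtain m where m: "s = 2 * m" by (metis evenE)
    define \<mu> where "\<mu> = z ^ ((N - 1) * (e * m))"
    define \<nu> where "\<nu> = z ^ (e * m)"
    have \<mu>\<nu>: "\<mu> * \<nu> = 1"
    proof -
      have "(N - 1) * (e * m) + e * m = N * (e * m)" using N_pos by (cases N) auto
      then show ?thesis
        by (simp add: \<mu>_def \<nu>_def root_of_unity_power_eq_1_iff[OF z] flip: power_add)
    qed
    have \<nu>2: "z ^ (e * s) = \<nu> * \<nu>" by (simp add: \<nu>_def m mult_2 distrib_left power_add)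
    have \<nu>N: "\<nu> ^ N = 1" by (simp add: \<nu>_def root_of_unity_power_eq_1_iff[OF z] flip: power_mult)
    define h where "h c = (\<lambda>u. x u + c * \<mu> * x (\<beta> u))" for c
    have "(\<lambda>u. x (\<beta> u)) \<in> eigenforms z e"
    proof -
      have "[k * e = 1 * e] (mod N)" using True by (rule cong_scalar_right)
      then have "z ^ (k * e) = z ^ e" by (simp add: root_of_unity_power_eq_iff[OF z])
      then show ?thesis using eig_\<beta>[OF x(1)] by (simp add: eigenforms_def)
    qed
    then have y: "(\<lambda>u. x (\<beta> u)) \<in> F" "\<And>u. u \<in> V \<Longrightarrow> x (\<beta> (\<alpha> u)) = z ^ e * x (\<beta> u)"
      by (auto simp: eigenforms_def)
    have h: "h c \<in> eigenforms z e" for c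
      unfolding eigenforms_def
    proof (intro CollectI conjI ballI)
      show "h c \<in> F" unfolding h_def using x(1) y(1) by (intro F_linear) (simp_all add: eigenforms_def)
      show "h c (\<alpha> u) = z ^ e * h c u" if "u \<in> V" for u
        using x(1) y(2) that by (simp add: h_def eigenforms_def algebra_simps)
    qed
    have h\<beta>: "h c (\<beta> u) ^ N = h c u ^ N" if "u \<in> V" "c * c = 1" for c u
    proof -
      have "h c (\<beta> u) = x (\<beta> u) + c * (\<mu> * \<nu>) * \<nu> * x u"
        using that(1) by (simp add: h_def eig_\<beta>_\<beta>[OF x(1)] \<nu>2 mult_ac)
      also have "\<dots> = c * c * (\<mu> * \<nu>) * x (\<beta> u) + c * \<nu> * x u" using \<mu>\<nu> that(2) by simp
      also have "\<dots> = c * \<nu> * h c u" by (simp add: h_def algebra_simps)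
      finally have "h c (\<beta> u) ^ N = c ^ N * \<nu> ^ N * h c u ^ N" by (simp add: power_mult_distrib)
      moreover have "c ^ N = 1"
      proof -
        obtain n where "N = 2 * n" using even(1) by (metis evenE)
        then show ?thesis using that(2) by (simp add: power_mult power2_eq_square)
      qed
      ultimately show ?thesis using \<nu>N by simp
    qed
    have "h 1 v + h (- 1) v = 2 * x v" by (simp add: h_def)
    then have "h 1 v \<noteq> 0 \<or> h (- 1) v \<noteq> 0" using two x(2) by auto
    then show thesis
    proof
      assume "h 1 v \<noteq> 0"
      then show thesis by (rule that[OF h _ h\<beta>]) simp_all
    next
      assume "h (- 1) v \<noteq> 0"
      then show thesis by (rule that[OF h _ h\<beta>]) simp_all
    qed
  qed (use x that in blast)
  \<comment> \<open>with respect to the root \<open>z\<^sup>e\<close> the form \<open>x\<close> has weight 1\<close>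
  define z' where "z' = z ^ e"
  have z': "has_multiplicative_order z' N"
    unfolding z'_def by (rule root_of_unity_power_coprime[OF z e])
  have x': "x \<in> eigenforms z' 1" using x(1) by (simp add: eigenforms_def z'_def)
  show False
    using top_power_dichotomy(2)[OF z' two vw agree x' t(3,4,2,1) ND]
  proof
    assume "x v ^ N = x w ^ N"
    from degree_bound_same_top_power[OF z' two vw agree D D_dic nc x' x(2) this[symmetric] central ne]
    show False .
  next
    assume top: "x v ^ N = x (\<beta> w) ^ N"
    have "\<not> same_rotation_class v (\<beta> (\<beta> w))"
    proof
      assume "same_rotation_class v (\<beta> (\<beta> w))"
      then obtain i where "(\<alpha> ^^ s) w = (\<alpha> ^^ i) v"
        unfolding same_rotation_class_def \<beta>_\<beta>[OF vw(2)] by blast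
      from \<alpha>_pow_back[OF vw(2) this] have "w = (\<alpha> ^^ ((N - 1) * s + i)) v" by (simp add: funpow_add)
      then show False using ne(1) unfolding same_rotation_class_def by blast
    qed
    from degree_bound_same_top_power[OF z' two vw(1) \<beta>_closed[OF vw(2)] agree_\<beta>[OF agree vw]
        D D_dic nc x' x(2) top[symmetric] central ne(2) this]
    show False .
  qed
qed

end

section \<open>Substitution, homogeneous components and linear forms\<close>

lemma const_zero [simp]: "const 0 = 0" by (simp add: const_def)
lemma const_one [simp]: "const 1 = 1" by (simp add: const_def)
lemma const_add: "const (a + b) = const a + const b" by (simp add: const_def single_add)
lemma const_mult: "const (a * b) = const a * const b" by (simp add: const_def mult_single)
lemma const_sum: "const (\<Sum>x\<in>S. f x) = (\<Sum>x\<in>S. const (f x))"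
  by (induction S rule: infinite_finite_induct) (auto simp: const_add)

definition power_product :: "(nat \<Rightarrow> 'r::comm_monoid_mult) \<Rightarrow> (nat \<Rightarrow>\<^sub>0 nat) \<Rightarrow> 'r" where
  "power_product \<sigma> m = (\<Prod>i\<in>Poly_Mapping.keys m. \<sigma> i ^ Poly_Mapping.lookup m i)"

lemma power_product_superset:
  assumes "finite S" "Poly_Mapping.keys m \<subseteq> S"
  shows "power_product \<sigma> m = (\<Prod>i\<in>S. \<sigma> i ^ Poly_Mapping.lookup m i)"
  unfolding power_product_def using assms by (intro prod.mono_neutral_left) (auto simp: in_keys_iff)

lemma power_product_add: "power_product \<sigma> (l + m) = power_product \<sigma> l * power_product \<sigma> m"
proof -
  let ?S = "Poly_Mapping.keys l \<union> Poly_Mapping.keys m"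
  have S: "finite ?S" "Poly_Mapping.keys l \<subseteq> ?S" "Poly_Mapping.keys m \<subseteq> ?S"
    "Poly_Mapping.keys (l + m) \<subseteq> ?S"
    using Poly_Mapping.keys_add[of l m] by auto
  show ?thesis
    unfolding power_product_superset[OF S(1,2)] power_product_superset[OF S(1,3)]
      power_product_superset[OF S(1,4)]
    by (simp add: lookup_add power_add prod.distrib)
qed

lemma poly_subst_superset:
  assumes "finite S" "Poly_Mapping.keys p \<subseteq> S"
  shows "poly_subst \<sigma> p = (\<Sum>m\<in>S. const (Poly_Mapping.lookup p m) * power_product \<sigma> m)"
  unfolding poly_subst_def power_product_def[symmetric] using assms
  by (intro sum.mono_neutral_left) (auto simp: in_keys_iff)

lemma poly_subst_zero [simp]: "poly_subst \<sigma> 0 = 0"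
  by (simp add: poly_subst_def)

lemma poly_subst_add: "poly_subst \<sigma> (p + q) = poly_subst \<sigma> p + poly_subst \<sigma> q"
proof -
  let ?S = "Poly_Mapping.keys p \<union> Poly_Mapping.keys q"
  have S: "finite ?S" "Poly_Mapping.keys p \<subseteq> ?S" "Poly_Mapping.keys q \<subseteq> ?S"
    "Poly_Mapping.keys (p + q) \<subseteq> ?S"
    using Poly_Mapping.keys_add[of p q] by auto
  show ?thesis
    unfolding poly_subst_superset[OF S(1,2)] poly_subst_superset[OF S(1,3)]
      poly_subst_superset[OF S(1,4)]
    by (simp add: lookup_add const_add distrib_right sum.distrib)
qed

lemma poly_subst_sum: "poly_subst \<sigma> (\<Sum>x\<in>S. f x) = (\<Sum>x\<in>S. poly_subst \<sigma> (f x))"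
  by (induction S rule: infinite_finite_induct) (auto simp: poly_subst_add)

lemma poly_subst_single: "poly_subst \<sigma> (Poly_Mapping.single m c) = const c * power_product \<sigma> m"
  using poly_subst_superset[of "{m}" "Poly_Mapping.single m c" \<sigma>] by simp

lemma poly_subst_mult: "poly_subst \<sigma> (p * q) = poly_subst \<sigma> p * poly_subst \<sigma> q"
proof -
  have *: "poly_subst \<sigma> (p * Poly_Mapping.single m c) =
      poly_subst \<sigma> p * poly_subst \<sigma> (Poly_Mapping.single m c)" for p m c
  proof (induction p rule: polynomial_induct)
    case (add_monomial f l b)
    have "poly_subst \<sigma> (Poly_Mapping.single l b * Poly_Mapping.single m c) =
        poly_subst \<sigma> (Poly_Mapping.single l b) * poly_subst \<sigma> (Poly_Mapping.single m c)"
      unfolding mult_single poly_subst_single power_product_add const_mult by (simp add: mult_ac)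
    with add_monomial show ?case
      by (simp only: distrib_right poly_subst_add)
  qed simp
  show ?thesis
  proof (induction q rule: polynomial_induct)
    case (add_monomial f m c)
    then show ?case by (simp only: * distrib_left poly_subst_add)
  qed simp
qed

lemma poly_subst_const [simp]: "poly_subst \<sigma> (const c) = const c"
  unfolding const_def poly_subst_single by (simp add: power_product_def const_def)

lemma poly_subst_one [simp]: "poly_subst \<sigma> 1 = 1"
  using poly_subst_const[of \<sigma> 1] by simp

lemma poly_subst_var [simp]: "poly_subst \<sigma> (var i) = \<sigma> i"
  unfolding var_def poly_subst_single by (simp add: power_product_def)

lemma poly_subst_prod_list: "poly_subst \<sigma> (\<Prod>x\<leftarrow>xs. f x) = (\<Prod>x\<leftarrow>xs. poly_subst \<sigma> (f x))"
  by (induction xs) (auto simp: poly_subst_mult)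

lemma monomial_degree_superset:
  assumes "finite S" "Poly_Mapping.keys m \<subseteq> S"
  shows "monomial_degree m = (\<Sum>i\<in>S. Poly_Mapping.lookup m i)"
  unfolding monomial_degree_def using assms by (intro sum.mono_neutral_left) (auto simp: in_keys_iff)

lemma monomial_degree_add: "monomial_degree (l + m) = monomial_degree l + monomial_degree m"
proof -
  let ?S = "Poly_Mapping.keys l \<union> Poly_Mapping.keys m"
  have S: "finite ?S" "Poly_Mapping.keys l \<subseteq> ?S" "Poly_Mapping.keys m \<subseteq> ?S"
    "Poly_Mapping.keys (l + m) \<subseteq> ?S"
    using Poly_Mapping.keys_add[of l m] by auto
  show ?thesis
    unfolding monomial_degree_superset[OF S(1,2)] monomial_degree_superset[OF S(1,3)]
      monomial_degree_superset[OF S(1,4)]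
    by (simp add: lookup_add sum.distrib)
qed

definition component :: "nat \<Rightarrow> nat \<Rightarrow> 'k::field polynomial set" where
  "component n e = {p \<in> coordinate_ring n. homogeneous e p}"

lemma component_zero: "0 \<in> component n e"
  by (simp add: component_def coordinate_ring_def homogeneous_def)

lemma component_add:
  assumes "p \<in> component n e" "q \<in> component n e"
  shows "p + q \<in> component n e"
  using assms Poly_Mapping.keys_add[of p q]
  unfolding component_def coordinate_ring_def homogeneous_def by blast

lemma component_sum: "(\<And>x. x \<in> S \<Longrightarrow> f x \<in> component n e) \<Longrightarrow> (\<Sum>x\<in>S. f x) \<in> component n e"
  by (induction S rule: infinite_finite_induct) (auto intro: component_zero component_add)

lemma component_mult:
  assumes p: "p \<in> component n e" and q: "q \<in> component n e'"
  shows "p * q \<in> component n (e + e')"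
proof -
  have "Poly_Mapping.keys m \<subseteq> {..<n} \<and> monomial_degree m = e + e'"
    if "m \<in> Poly_Mapping.keys (p * q)" for m
  proof -
    obtain a b where ab: "m = a + b" "a \<in> Poly_Mapping.keys p" "b \<in> Poly_Mapping.keys q"
      using \<open>m \<in> _\<close> Poly_Mapping.keys_mult[of p q] by blast
    then have "Poly_Mapping.keys a \<subseteq> {..<n}" "Poly_Mapping.keys b \<subseteq> {..<n}"
      "monomial_degree a = e" "monomial_degree b = e'"
      using p q by (auto simp: component_def coordinate_ring_def homogeneous_def)
    then show ?thesis
      using Poly_Mapping.keys_add[of a b] by (auto simp: ab(1) monomial_degree_add)
  qed
  then show ?thesis
    unfolding component_def coordinate_ring_def homogeneous_def by blast
qed

lemma component_const: "const c \<in> component n 0"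
  by (simp add: component_def coordinate_ring_def homogeneous_def const_def monomial_degree_def)

lemma component_var: "i < n \<Longrightarrow> var i \<in> component n 1"
  by (simp add: component_def coordinate_ring_def homogeneous_def var_def monomial_degree_def)

lemma component_prod_list:
  "(\<And>x. x \<in> set xs \<Longrightarrow> f x \<in> component n 1) \<Longrightarrow> (\<Prod>x\<leftarrow>xs. f x) \<in> component n (length xs)"
proof (induction xs)
  case Nil
  then show ?case using component_const[of 1 n] by simp
next
  case (Cons x xs)
  then show ?case using component_mult[of "f x" n 1] by simp
qed

definition linear_form :: "nat \<Rightarrow> 'k::field vec \<Rightarrow> 'k polynomial" where
  "linear_form n u = (\<Sum>j<n. const (u $ j) * var j)"

lemma linear_form_component: "linear_form n u \<in> component n 1"
  unfolding linear_form_def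
  using component_mult[OF component_const component_var] by (intro component_sum) simp

lemma poly_eval_prod_list: "poly_eval (\<Prod>x\<leftarrow>xs. f x) v = (\<Prod>x\<leftarrow>xs. poly_eval (f x) v)"
  by (induction xs) (auto simp: poly_eval_mult)

lemma poly_eval_linear_form:
  assumes "v \<in> carrier_vec n"
  shows "poly_eval (linear_form n u) v = u \<bullet> v"
  using assms unfolding linear_form_def scalar_prod_def
  by (simp add: poly_eval_sum poly_eval_mult lessThan_atLeast0)

lemma poly_subst_linear_form:
  assumes M: "M \<in> carrier_mat n n" and u: "u \<in> carrier_vec n"
  shows "poly_subst (\<lambda>i. \<Sum>j<n. const (M $$ (i, j)) * var j) (linear_form n u) =
    linear_form n (transpose_mat M *\<^sub>v u)"
proof -
  have entry: "(transpose_mat M *\<^sub>v u) $ j = (\<Sum>i<n. u $ i * M $$ (i, j))" if "j < n" for j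
    using that M u by (simp add: scalar_prod_def lessThan_atLeast0 mult.commute)
  have "poly_subst (\<lambda>i. \<Sum>j<n. const (M $$ (i, j)) * var j) (linear_form n u) =
      (\<Sum>i<n. \<Sum>j<n. const (u $ i * M $$ (i, j)) * var j)"
    unfolding linear_form_def
    by (simp add: poly_subst_sum poly_subst_mult sum_distrib_left const_mult mult.assoc)
  also have "\<dots> = (\<Sum>j<n. const (\<Sum>i<n. u $ i * M $$ (i, j)) * var j)"
    by (subst sum.swap) (simp add: const_sum sum_distrib_right)
  also have "\<dots> = linear_form n (transpose_mat M *\<^sub>v u)"
    unfolding linear_form_def by (intro sum.cong) (simp_all add: entry)
  finally show ?thesis .
qed

section \<open>Representations\<close>

lemma representation_matrix:
  assumes "\<rho> \<in> representations G n" "g \<in> carrier G"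
  shows "\<rho> g \<in> carrier_mat n n"
  using assms
  by (auto simp: representations_def general_linear_group_def hom_def units_of_def Units_def ring_mat_def)

lemma representation_mult:
  assumes "\<rho> \<in> representations G n" "g \<in> carrier G" "h \<in> carrier G"
  shows "\<rho> (g \<otimes>\<^bsub>G\<^esub> h) = \<rho> g * \<rho> h"
  using assms
  by (auto simp: representations_def general_linear_group_def hom_def units_of_def ring_mat_def)

lemma group_general_linear_group: "group (general_linear_group TYPE('k::field) n)"
proof -
  interpret R: ring "ring_mat TYPE('k) n ()" by (rule ring_mat)
  show ?thesis unfolding general_linear_group_def by (rule R.units_group)
qed

lemma representation_one:
  fixes \<rho> :: "'g \<Rightarrow> 'k::field mat"
  assumes G: "group G" and \<rho>: "\<rho> \<in> representations G n"
  shows "\<rho> \<one>\<^bsub>G\<^esub> = 1\<^sub>m n"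
proof -
  interpret group_hom G "general_linear_group TYPE('k) n" \<rho>
    using G \<rho> group_general_linear_group
    by (simp add: group_hom_def group_hom_axioms_def representations_def)
  show ?thesis using hom_one by (simp add: general_linear_group_def units_of_def ring_mat_def)
qed

lemma representation_mult_vec:
  assumes "\<rho> \<in> representations G n" "g \<in> carrier G" "h \<in> carrier G" "v \<in> carrier_vec n"
  shows "\<rho> (g \<otimes>\<^bsub>G\<^esub> h) *\<^sub>v v = \<rho> g *\<^sub>v (\<rho> h *\<^sub>v v)"
  unfolding representation_mult[OF assms(1-3)]
  by (rule assoc_mult_mat_vec[OF representation_matrix[OF assms(1,2)]
        representation_matrix[OF assms(1,3)] assms(4)])

lemma representation_vec_closed:
  assumes "\<rho> \<in> representations G n" "g \<in> carrier G" "v \<in> carrier_vec n"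
  shows "\<rho> g *\<^sub>v v \<in> carrier_vec n"
  using representation_matrix[OF assms(1,2)] assms(3) by simp

lemma sum_over_group_inv:
  assumes "group G"
  shows "(\<Sum>g\<in>carrier G. f (inv\<^bsub>G\<^esub> g)) = (\<Sum>g\<in>carrier G. f g)"
  using assms
  by (intro sum.reindex_bij_witness[of _ "\<lambda>g. inv\<^bsub>G\<^esub> g" "\<lambda>g. inv\<^bsub>G\<^esub> g"])
    (auto simp: group.inv_closed group.inv_inv)

lemma poly_action_prod_linear_forms:
  assumes \<rho>: "\<rho> \<in> representations G n" and G: "group G" and g: "g \<in> carrier G"
    and us: "set us \<subseteq> carrier_vec n"
  shows "poly_action G n \<rho> g (\<Prod>u\<leftarrow>us. linear_form n u) =
    (\<Prod>u\<leftarrow>us. linear_form n (transpose_mat (\<rho> (inv\<^bsub>G\<^esub> g)) *\<^sub>v u))"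
proof -
  have M: "\<rho> (inv\<^bsub>G\<^esub> g) \<in> carrier_mat n n"
    by (rule representation_matrix[OF \<rho> group.inv_closed[OF G g]])
  show ?thesis
    unfolding poly_action_def poly_subst_prod_list
    by (rule arg_cong[of _ _ prod_list], rule map_cong)
      (use us poly_subst_linear_form[OF M] in auto)
qed

text \<open>
  The sum over the group of the translates of a product of linear forms is an invariant
  polynomial. Over a finite field this has to be seen on the polynomials, not on the functions
  that they induce.
\<close>

lemma orbit_sum_invariant:
  fixes \<rho> :: "'g \<Rightarrow> 'k::field mat"
  assumes G: "group G" and fin: "finite (carrier G)" and \<rho>: "\<rho> \<in> representations G n"
    and us: "set us \<subseteq> carrier_vec n"
  defines "Q \<equiv> \<Sum>g\<in>carrier G. poly_action G n \<rho> g (\<Prod>u\<leftarrow>us. linear_form n u)"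
  shows "Q \<in> invariants G n \<rho>" "homogeneous (length us) Q"
    and "v \<in> carrier_vec n \<Longrightarrow> poly_eval Q v = (\<Sum>g\<in>carrier G. \<Prod>u\<leftarrow>us. u \<bullet> (\<rho> g *\<^sub>v v))"
proof -
  let ?P = "\<Prod>u\<leftarrow>us. linear_form n u"
  interpret group G by (rule G)
  note act = poly_action_prod_linear_forms[OF \<rho> G _ us]
  have P: "?P \<in> component n (length us)" by (intro component_prod_list linear_form_component)
  have "Q \<in> component n (length us)"
    unfolding Q_def
  proof (rule component_sum)
    fix g assume "g \<in> carrier G"
    then show "poly_action G n \<rho> g ?P \<in> component n (length us)"
      unfolding act[OF \<open>g \<in> carrier G\<close>] by (intro component_prod_list linear_form_component)
  qed
  then have Q: "Q \<in> coordinate_ring n" and homog: "homogeneous (length us) Q"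
    by (auto simp: component_def)
  show "homogeneous (length us) Q" by (rule homog)
  have "poly_action G n \<rho> h Q = Q" if h: "h \<in> carrier G" for h
  proof -
    have step: "poly_action G n \<rho> h (poly_action G n \<rho> g ?P) = poly_action G n \<rho> (h \<otimes>\<^bsub>G\<^esub> g) ?P"
      if g: "g \<in> carrier G" for g
    proof -
      let ?us = "map (\<lambda>u. transpose_mat (\<rho> (inv\<^bsub>G\<^esub> g)) *\<^sub>v u) us"
      have Mg: "\<rho> (inv\<^bsub>G\<^esub> g) \<in> carrier_mat n n" and Mh: "\<rho> (inv\<^bsub>G\<^esub> h) \<in> carrier_mat n n"
        using representation_matrix[OF \<rho>] g h by auto
      have us': "set ?us \<subseteq> carrier_vec n" using us Mg by auto
      have "poly_action G n \<rho> g ?P = (\<Prod>u\<leftarrow>?us. linear_form n u)"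
        unfolding act[OF g] by (simp add: o_def)
      then have "poly_action G n \<rho> h (poly_action G n \<rho> g ?P) =
          (\<Prod>u\<leftarrow>?us. linear_form n (transpose_mat (\<rho> (inv\<^bsub>G\<^esub> h)) *\<^sub>v u))"
        using poly_action_prod_linear_forms[OF \<rho> G h us'] by simp
      also have "\<dots> = (\<Prod>u\<leftarrow>us. linear_form n (transpose_mat (\<rho> (inv\<^bsub>G\<^esub> (h \<otimes>\<^bsub>G\<^esub> g))) *\<^sub>v u))"
      proof -
        have "transpose_mat (\<rho> (inv\<^bsub>G\<^esub> h)) *\<^sub>v (transpose_mat (\<rho> (inv\<^bsub>G\<^esub> g)) *\<^sub>v u) =
            transpose_mat (\<rho> (inv\<^bsub>G\<^esub> (h \<otimes>\<^bsub>G\<^esub> g))) *\<^sub>v u" if "u \<in> set us" for u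
        proof -
          have "u \<in> carrier_vec n" using us that by auto
          then show ?thesis
            using Mg Mh g h
            by (simp add: inv_mult_group representation_mult[OF \<rho>] transpose_mult)
        qed
        then show ?thesis by (auto simp: o_def intro!: arg_cong[of _ _ prod_list])
      qed
      also have "\<dots> = poly_action G n \<rho> (h \<otimes>\<^bsub>G\<^esub> g) ?P" using act[of "h \<otimes>\<^bsub>G\<^esub> g"] g h by simp
      finally show ?thesis .
    qed
    have "poly_action G n \<rho> h Q = (\<Sum>g\<in>carrier G. poly_action G n \<rho> h (poly_action G n \<rho> g ?P))"
      by (simp add: Q_def poly_action_def poly_subst_sum)
    also have "\<dots> = (\<Sum>g\<in>carrier G. poly_action G n \<rho> (h \<otimes>\<^bsub>G\<^esub> g) ?P)"
      using step by (rule sum.cong[OF HOL.refl])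
    also have "\<dots> = Q"
      unfolding Q_def using h
      by (intro sum.reindex_bij_witness[of _ "\<lambda>g. inv\<^bsub>G\<^esub> h \<otimes>\<^bsub>G\<^esub> g" "\<lambda>g. h \<otimes>\<^bsub>G\<^esub> g"])
        (auto simp: m_assoc[symmetric])
    finally show ?thesis .
  qed
  then show "Q \<in> invariants G n \<rho>" using Q by (simp add: invariants_def)
  show "poly_eval Q v = (\<Sum>g\<in>carrier G. \<Prod>u\<leftarrow>us. u \<bullet> (\<rho> g *\<^sub>v v))" if v: "v \<in> carrier_vec n"
  proof -
    have "poly_eval Q v = (\<Sum>g\<in>carrier G. poly_eval ?P (\<rho> (inv\<^bsub>G\<^esub> g) *\<^sub>v v))"
      unfolding Q_def poly_eval_sum
      using P by (intro sum.cong poly_eval_poly_action[OF G \<rho>] v) (auto simp: component_def)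
    also have "\<dots> = (\<Sum>g\<in>carrier G. poly_eval ?P (\<rho> g *\<^sub>v v))"
      by (rule sum_over_group_inv[OF G, of "\<lambda>g. poly_eval ?P (\<rho> g *\<^sub>v v)"])
    also have "\<dots> = (\<Sum>g\<in>carrier G. \<Prod>u\<leftarrow>us. u \<bullet> (\<rho> g *\<^sub>v v))"
      using representation_vec_closed[OF \<rho> _ v]
      by (intro sum.cong) (simp_all add: poly_eval_prod_list poly_eval_linear_form)
    finally show ?thesis .
  qed
qed

lemma invariants_subset_invariants_upto:
  assumes "Q \<in> invariants G n \<rho>" "homogeneous e Q" "e \<le> d"
  shows "Q \<in> invariants_upto G n \<rho> d"
proof -
  have "0 \<in> invariants G n \<rho>"
    by (simp add: invariants_def coordinate_ring_def poly_action_def)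
  moreover have "(\<Sum>i\<le>d. if i = e then Q else 0) = Q" using assms(3) by simp
  ultimately show ?thesis
    unfolding invariants_upto_def using assms
    by (intro CollectI exI[of _ "\<lambda>i. if i = e then Q else 0"]) (auto simp: homogeneous_def)
qed

lemma invariants_upto_subset: "invariants_upto G n \<rho> d \<subseteq> invariants G n \<rho>"
proof -
  have add: "p + q \<in> invariants G n \<rho>" if "p \<in> invariants G n \<rho>" "q \<in> invariants G n \<rho>" for p q
  proof -
    have "p + q \<in> coordinate_ring n"
      using that Poly_Mapping.keys_add[of p q] unfolding invariants_def coordinate_ring_def by blast
    then show ?thesis using that by (simp add: invariants_def poly_action_def poly_subst_add)
  qed
  have zero: "0 \<in> invariants G n \<rho>"
    by (simp add: invariants_def coordinate_ring_def poly_action_def)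
  have "(\<Sum>e\<in>S. h e) \<in> invariants G n \<rho>" if "\<And>e. e \<in> S \<Longrightarrow> h e \<in> invariants G n \<rho>" for S :: "nat set" and h
    using that by (induction S rule: infinite_finite_induct) (auto intro: add zero)
  then show ?thesis unfolding invariants_upto_def by force
qed

text \<open>
  An invariant is, up to the nonzero factor \<open>\<bar>G\<bar>\<close>, the sum of its translates, and its values are therefore
  determined by the orbit sums of monomials.
\<close>

lemma invariants_upto_eqI:
  fixes \<rho> :: "'g \<Rightarrow> 'k::field mat"
  assumes G: "group G" and \<rho>: "\<rho> \<in> representations G n"
    and card: "of_nat (card (carrier G)) \<noteq> (0 :: 'k)"
    and vw: "v \<in> carrier_vec n" "w \<in> carrier_vec n"
    and eq: "\<And>m. Poly_Mapping.keys m \<subseteq> {..<n} \<Longrightarrow> monomial_degree m \<le> d \<Longrightarrow>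
      (\<Sum>g\<in>carrier G. power_product (($) (\<rho> g *\<^sub>v v)) m) =
      (\<Sum>g\<in>carrier G. power_product (($) (\<rho> g *\<^sub>v w)) m)"
    and f: "f \<in> invariants_upto G n \<rho> d"
  shows "poly_eval f v = poly_eval f w"
proof -
  have hom: "poly_eval p v = poly_eval p w"
    if p: "p \<in> invariants G n \<rho>" "homogeneous e p" and e: "e \<le> d" for p e
  proof -
    have avg: "of_nat (card (carrier G)) * poly_eval p u =
        (\<Sum>m\<in>Poly_Mapping.keys p. Poly_Mapping.lookup p m *
          (\<Sum>g\<in>carrier G. power_product (($) (\<rho> g *\<^sub>v u)) m))" if u: "u \<in> carrier_vec n" for u
    proof -
      have "(\<Sum>g\<in>carrier G. poly_eval p (\<rho> g *\<^sub>v u)) = (\<Sum>g\<in>carrier G. poly_eval p (\<rho> (inv\<^bsub>G\<^esub> g) *\<^sub>v u))"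
        by (rule sum_over_group_inv[OF G, of "\<lambda>g. poly_eval p (\<rho> g *\<^sub>v u)", symmetric])
      also have "\<dots> = (\<Sum>g\<in>carrier G. poly_eval p u)"
      proof (rule sum.cong)
        fix g assume g: "g \<in> carrier G"
        have "poly_eval (poly_action G n \<rho> g p) u = poly_eval p (\<rho> (inv\<^bsub>G\<^esub> g) *\<^sub>v u)"
          using p(1) by (intro poly_eval_poly_action[OF G \<rho> g _ u]) (simp add: invariants_def)
        then show "poly_eval p (\<rho> (inv\<^bsub>G\<^esub> g) *\<^sub>v u) = poly_eval p u"
          using p(1) g by (simp add: invariants_def)
      qed simp
      finally show ?thesis
        by (simp add: poly_eval_def power_product_def sum_distrib_left sum.swap[of _ "carrier G"])
    qed
    have "of_nat (card (carrier G)) * poly_eval p v = of_nat (card (carrier G)) * poly_eval p w"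
      unfolding avg[OF vw(1)] avg[OF vw(2)]
      using p e by (intro sum.cong) (auto simp: invariants_def coordinate_ring_def homogeneous_def eq)
    then show ?thesis using card by simp
  qed
  obtain h where h: "f = (\<Sum>e\<le>d. h e)" "\<And>e. e \<le> d \<Longrightarrow> h e \<in> invariants G n \<rho> \<and> homogeneous e (h e)"
    using f by (auto simp: invariants_upto_def)
  show ?thesis unfolding h(1) poly_eval_sum
    by (intro sum.cong HOL.refl) (use h(2) hom in auto)
qed

section \<open>Groups with a cyclic subgroup of index two\<close>

lemma (in group) conjugate_pow:
  assumes x: "x \<in> carrier G" and y: "y \<in> carrier G" and y_x: "y \<otimes> x = x [^] (k :: nat) \<otimes> y"
  shows "y \<otimes> x [^] (i :: nat) = x [^] (k * i) \<otimes> y"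
proof (induction i)
  case (Suc i)
  have "y \<otimes> (x [^] i \<otimes> x) = (x [^] (k * i) \<otimes> y) \<otimes> x"
    using x y by (simp add: m_assoc[symmetric] Suc)
  also have "\<dots> = x [^] (k * i) \<otimes> (x [^] k \<otimes> y)" using x y by (simp add: m_assoc y_x)
  also have "\<dots> = (x [^] (k * i) \<otimes> x [^] k) \<otimes> y" using x y by (simp add: m_assoc)
  finally show ?case using x by (simp add: nat_pow_mult add.commute)
qed (use y in simp)

lemma (in group) pow_mod_exponent:
  assumes x: "x \<in> carrier G" and one: "x [^] (n :: nat) = \<one>"
  shows "x [^] (i mod n) = x [^] i"
proof -
  have "x [^] i = x [^] (n * (i div n) + i mod n)" by simp
  also have "\<dots> = (x [^] n) [^] (i div n) \<otimes> x [^] (i mod n)"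
    using x by (simp only: nat_pow_mult[symmetric] nat_pow_pow[symmetric] nat_pow_closed)
  finally show ?thesis using x by (simp add: one)
qed

text \<open>
  The elements \<open>a\<^sup>i\<close> will be called rotations and the elements \<open>a\<^sup>i b\<close> reflections, as in a dihedral group.
  The cardinality of the carrier makes all of these elements distinct.
\<close>

locale cyclic_index_two = group G for G :: "('g, 'b) monoid_scheme" (structure) +
  fixes a b :: 'g and N k s :: nat
  assumes a: "a \<in> carrier G" and b: "b \<in> carrier G" and N_pos: "N > 0"
    and a_order: "a [^] N = \<one>"
    and carrier_eq: "carrier G = (\<lambda>i. a [^] i) ` {..<N} \<union> (\<lambda>i. a [^] i \<otimes> b) ` {..<N}"
    and card_carrier: "card (carrier G) = 2 * N"
    and b_a: "b \<otimes> a = a [^] k \<otimes> b"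
    and b_b: "b \<otimes> b = a [^] s"
begin

lemma
  shows inj_rotations: "inj_on (\<lambda>i. a [^] i) {..<N}"
    and inj_reflections: "inj_on (\<lambda>i. a [^] i \<otimes> b) {..<N}"
    and rotations_reflections_disjoint:
      "(\<lambda>i. a [^] i) ` {..<N} \<inter> (\<lambda>i. a [^] i \<otimes> b) ` {..<N} = {}"
proof -
  let ?A = "(\<lambda>i. a [^] i) ` {..<N}" and ?B = "(\<lambda>i. a [^] i \<otimes> b) ` {..<N}"
  have "card ?A \<le> N" "card ?B \<le> N"
    using card_image_le[of "{..<N}"] by (metis card_lessThan finite_lessThan)+
  moreover have "card ?A + card ?B = card (?A \<union> ?B) + card (?A \<inter> ?B)"
    by (rule card_Un_Int) auto
  moreover have "card (?A \<union> ?B) = 2 * N" using card_carrier carrier_eq by simp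
  ultimately have *: "card ?A = N" "card ?B = N" "card (?A \<inter> ?B) = 0" by linarith+
  show "inj_on (\<lambda>i. a [^] i) {..<N}" "inj_on (\<lambda>i. a [^] i \<otimes> b) {..<N}"
    using * by (auto intro!: eq_card_imp_inj_on)
  show "?A \<inter> ?B = {}" using *(3) by simp
qed

lemma finite_carrier: "finite (carrier G)"
  using card_carrier N_pos by (intro card_ge_0_finite) simp

lemma pow_mod: "a [^] (i mod N) = a [^] (i :: nat)"
  by (rule pow_mod_exponent[OF a a_order])

lemma rotation_eq_iff: "a [^] (i :: nat) = a [^] (j :: nat) \<longleftrightarrow> [i = j] (mod N)"
proof
  assume "a [^] i = a [^] j"
  then have "a [^] (i mod N) = a [^] (j mod N)" by (simp add: pow_mod)
  then show "[i = j] (mod N)" using inj_rotations N_pos by (auto simp: inj_on_def cong_def)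
next
  assume "[i = j] (mod N)"
  then show "a [^] i = a [^] j" using pow_mod by (metis cong_def)
qed

lemma rotation_ne_reflection: "a [^] (i :: nat) \<noteq> a [^] (j :: nat) \<otimes> b"
proof
  assume "a [^] i = a [^] j \<otimes> b"
  then have "a [^] (i mod N) = a [^] (j mod N) \<otimes> b" by (simp add: pow_mod)
  then show False using rotations_reflections_disjoint N_pos mod_less_divisor by blast
qed

lemma sum_carrier:
  "(\<Sum>g\<in>carrier G. f g) = (\<Sum>i<N. f (a [^] i)) + (\<Sum>i<N. f (a [^] i \<otimes> b))"
  unfolding carrier_eq using rotations_reflections_disjoint
  by (simp add: sum.union_disjoint sum.reindex inj_rotations inj_reflections)

lemma carrier_cases:
  assumes "g \<in> carrier G"
  obtains i :: nat where "g = a [^] i" | i :: nat where "g = a [^] i \<otimes> b"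
  using assms unfolding carrier_eq by auto

lemma b_pow: "b \<otimes> a [^] (i :: nat) = a [^] (k * i) \<otimes> b"
  by (rule conjugate_pow[OF a b b_a])

lemma k_square: "[k * k = 1] (mod N)"
proof -
  have "a [^] s \<otimes> a = b \<otimes> (b \<otimes> a)" using a b by (simp add: b_b[symmetric] m_assoc)
  also have "\<dots> = (b \<otimes> a [^] k) \<otimes> b" using a b by (simp add: b_a m_assoc)
  also have "\<dots> = a [^] (k * k) \<otimes> a [^] s" using a b by (simp add: b_pow m_assoc b_b)
  finally have "a [^] (s + 1) = a [^] (k * k + s)" using a by (simp add: nat_pow_mult[symmetric])
  then have "[1 + s = k * k + s] (mod N)" unfolding rotation_eq_iff by (simp only: add.commute)
  then have "[1 = k * k] (mod N)" by (simp only: cong_add_rcancel_nat)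
  then show ?thesis by (rule cong_sym)
qed

lemma k_s: "[k * s = s] (mod N)"
proof -
  have "a [^] (k * s) \<otimes> b = b \<otimes> (b \<otimes> b)" by (simp add: b_b b_pow)
  also have "\<dots> = (b \<otimes> b) \<otimes> b" using b by (simp only: m_assoc)
  also have "\<dots> = a [^] s \<otimes> b" by (simp only: b_b)
  finally have "a [^] (k * s) = a [^] s" using a b by simp
  then show ?thesis by (simp add: rotation_eq_iff)
qed

text \<open>
  If \<open>a\<close> and \<open>b\<close> commute, then \<open>(a\<^sup>j b)\<^sup>2 = a\<^bsup>s + 2 j\<^esup>\<close>, and if \<open>N\<close> or \<open>s\<close> is odd, then
  \<open>j\<close> can be chosen such that this is \<open>a\<close>.
\<close>

lemma noncyclic_imp:
  assumes "\<not> cyclic_group G"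
  shows "\<not> ([k = 1] (mod N) \<and> (odd N \<or> odd s))"
proof
  assume *: "[k = 1] (mod N) \<and> (odd N \<or> odd s)"
  obtain j where j: "[s + 2 * j = 1] (mod N)"
  proof (cases "odd s")
    case True
    then obtain m where "s = 2 * m + 1" by (rule oddE)
    moreover have "m * N - m + m = N * m" using N_pos by (cases N) auto
    ultimately have "s + 2 * (m * N - m) = N * (2 * m) + 1" by (simp add: algebra_simps)
    then have "[s + 2 * (m * N - m) = 1] (mod N)" unfolding cong_def by (simp only: mod_mult_self4)
    then show thesis by (rule that)
  next
    case False
    then obtain n where n: "N = 2 * n + 1" using * by (auto elim: oddE)
    have "s + 2 * ((n + 1) * (1 + (N - 1) * s)) = 1 + N * (1 + (N - 1) * s + s)"
      using n by (simp add: algebra_simps)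
    then have "[s + 2 * ((n + 1) * (1 + (N - 1) * s)) = 1] (mod N)"
      unfolding cong_def by (simp only: mod_mult_self2)
    then show thesis by (rule that)
  qed
  have com: "b \<otimes> a [^] i = a [^] i \<otimes> b" for i :: nat
  proof -
    have "[k * i = 1 * i] (mod N)" using * by (intro cong_scalar_right) simp
    then have "a [^] (k * i) = a [^] i" by (simp add: rotation_eq_iff)
    then show ?thesis by (simp add: b_pow)
  qed
  \<comment> \<open>a square root of \<open>a\<close> outside the rotations\<close>
  define d where "d = a [^] j \<otimes> b"
  have d: "d \<in> carrier G" using a b by (simp add: d_def)
  have "d \<otimes> d = a [^] j \<otimes> (b \<otimes> a [^] j) \<otimes> b" using a b by (simp add: d_def m_assoc)
  also have "\<dots> = (a [^] j \<otimes> a [^] j) \<otimes> (b \<otimes> b)" using a b by (simp add: com m_assoc)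
  also have "\<dots> = a [^] (j + j + s)" using a by (simp add: b_b nat_pow_mult)
  also have "j + j + s = s + 2 * j" by simp
  also have "a [^] (s + 2 * j) = a [^] (1 :: nat)" unfolding rotation_eq_iff by (rule j)
  finally have dd: "d [^] (2 :: nat) = a" using a d by (simp add: numeral_2_eq_2)
  have rot: "a [^] i = d [^] (2 * i)" for i :: nat
    using d by (simp add: dd[symmetric] nat_pow_pow)
  have refl: "a [^] i \<otimes> b = d [^] (2 * (i + (N - 1) * j) + 1)" for i :: nat
  proof -
    have "d [^] (2 * (i + (N - 1) * j) + 1) = a [^] (i + (N - 1) * j) \<otimes> (a [^] j \<otimes> b)"
      by (subst d_def[symmetric], subst rot) simp
    also have "\<dots> = a [^] (i + (N - 1) * j + j) \<otimes> b"
      using a b by (simp add: m_assoc[symmetric] nat_pow_mult)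
    also have "i + (N - 1) * j + j = N * j + i" using N_pos by (cases N) auto
    also have "a [^] (N * j + i) = a [^] i" unfolding rotation_eq_iff by (simp add: cong_def)
    finally show ?thesis ..
  qed
  have "carrier G = range (\<lambda>n::int. d [^] n)"
  proof
    show "carrier G \<subseteq> range (\<lambda>n::int. d [^] n)"
    proof
      fix g assume "g \<in> carrier G"
      then obtain n :: nat where "g = d [^] n"
        by (cases rule: carrier_cases) (use rot refl in blast)+
      then show "g \<in> range (\<lambda>n::int. d [^] n)" by (metis int_pow_int rangeI)
    qed
  qed (use d in auto)
  then have "cyclic_group G" unfolding cyclic_group using d by blast
  then show False using assms by simp
qed

end

lemma cyclic_index_two_exists:
  fixes G :: "('g, 'b) monoid_scheme" (structure)
  assumes G: "group G" and fin: "finite (carrier G)" and C: "subgroup C G"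
    and cyc: "cyclic_group (subgroup_generated G C)" and index: "card (rcosets C) = 2"
  obtains a b N k s where "cyclic_index_two G a b N k s"
proof -
  interpret group G by (rule G)
  interpret C: subgroup C G by (rule C)
  interpret H: group "subgroup_generated G C" by (rule group_subgroup_generated)
  have CH: "carrier (subgroup_generated G C) = C" by (rule C.carrier_subgroup_generated_subgroup)
  obtain a where a: "a \<in> C" and C_int: "C = range (\<lambda>n::int. a [^] n)"
    using cyc CH unfolding H.cyclic_group by (auto simp: int_pow_subgroup_generated)
  have aG: "a \<in> carrier G" using a by (rule C.mem_carrier)
  define N where "N = group.ord G a"
  have N: "N > 0" using ord_ge_1[OF fin aG] by (simp add: N_def)
  have aN: "a [^] N = \<one>" unfolding N_def by (rule pow_ord_eq_1[OF aG])
  have C_nat: "C = (\<lambda>i::nat. a [^] i) ` {..<N}"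
  proof
    show "C \<subseteq> (\<lambda>i::nat. a [^] i) ` {..<N}"
    proof
      fix x assume "x \<in> C"
      then obtain n :: int where "x = a [^] n" using C_int by auto
      also have "\<dots> = a [^] (n mod int N)"
        unfolding int_pow_eq[OF aG] N_def[symmetric] by (simp add: mod_eq_dvd_iff[symmetric])
      also have "\<dots> = a [^] nat (n mod int N)"
        using N by (simp add: int_pow_int[symmetric])
      finally show "x \<in> (\<lambda>i::nat. a [^] i) ` {..<N}"
        by (rule image_eqI) (use N in \<open>simp add: nat_less_iff\<close>)
    qed
    show "(\<lambda>i::nat. a [^] i) ` {..<N} \<subseteq> C"
      unfolding C_int by (auto simp: int_pow_int[symmetric])
  qed
  have cardC: "card C = N"
  proof -
    have "{..<N} = {0..group.ord G a - 1}" using N by (auto simp: N_def)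
    then have "inj_on (\<lambda>i::nat. a [^] i) {..<N}" using ord_inj[OF aG] by simp
    then show ?thesis unfolding C_nat by (simp add: card_image)
  qed
  have card: "card (carrier G) = 2 * N"
    using lagrange[OF C] index cardC unfolding Coset.order_def by simp
  obtain b where b: "b \<in> carrier G" "b \<notin> C"
  proof -
    have "carrier G \<noteq> C" using card cardC N by auto
    then show thesis using that C.subset by blast
  qed
  let ?B = "(\<lambda>x. x \<otimes> b) ` C"
  have finC: "finite C" using C.subset fin by (rule finite_subset)
  have disj: "C \<inter> ?B = {}"
  proof (rule ccontr)
    assume "C \<inter> ?B \<noteq> {}"
    then obtain x where x: "x \<in> C" "x \<otimes> b \<in> C" by auto
    then have "inv x \<otimes> (x \<otimes> b) \<in> C"
      by (intro C.m_closed[OF C.m_inv_closed])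
    moreover have "inv x \<otimes> (x \<otimes> b) = b"
      using C.mem_carrier[OF x(1)] b(1) by (simp add: m_assoc[symmetric])
    ultimately show False using b(2) by (simp only:)
  qed
  have "card ?B = N"
  proof -
    have "inj_on (\<lambda>x. x \<otimes> b) C" using b C.mem_carrier by (auto simp: inj_on_def)
    then show ?thesis using cardC by (simp add: card_image)
  qed
  then have "card (C \<union> ?B) = card (carrier G)"
    using card cardC finC disj by (simp add: card_Un_disjoint)
  moreover have "C \<union> ?B \<subseteq> carrier G" using b C.mem_carrier by auto
  ultimately have carr: "carrier G = C \<union> ?B" using fin by (metis card_subset_eq)
  have "b \<otimes> a \<notin> C"
  proof
    assume "b \<otimes> a \<in> C"
    then have "(b \<otimes> a) \<otimes> inv a \<in> C" using a by (rule C.m_closed[OF _ C.m_inv_closed])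
    moreover have "(b \<otimes> a) \<otimes> inv a = b" using b(1) aG by (simp add: m_assoc)
    ultimately show False using b(2) by (simp only:)
  qed
  moreover have "b \<otimes> a \<in> carrier G" using b(1) aG by simp
  ultimately have "b \<otimes> a \<in> ?B" unfolding carr by blast
  then obtain k :: nat where k: "b \<otimes> a = a [^] k \<otimes> b" unfolding C_nat by auto
  have "b \<otimes> b \<notin> ?B"
  proof
    assume "b \<otimes> b \<in> ?B"
    then obtain x where "x \<in> C" "b \<otimes> b = x \<otimes> b" by auto
    then show False using b C.mem_carrier by simp
  qed
  moreover have "b \<otimes> b \<in> carrier G" using b(1) by simp
  ultimately have "b \<otimes> b \<in> C" unfolding carr by blast
  then obtain s :: nat where s: "b \<otimes> b = a [^] s" unfolding C_nat by auto
  have "cyclic_index_two G a b N k s"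
    by unfold_locales (use aG b N aN carr card k s in \<open>auto simp: C_nat image_image\<close>)
  then show thesis by (rule that)
qed

section \<open>The upper bound\<close>

lemma prod_list_map_transfer:
  "list_all2 (\<lambda>x y. f x = g y) xs ys \<Longrightarrow> (\<Prod>x\<leftarrow>xs. f x) = (\<Prod>y\<leftarrow>ys. g y)"
  by (induction rule: list_all2_induct) auto

context cyclic_index_two begin

text \<open>
  The orbit sums of products of linear forms turn equality on the invariants into the equations of
  \<open>twisted_action.agree\<close>, where the factor \<open>N\<close> is cancelled.
\<close>

lemma separating_set_invariants_upto:
  fixes \<rho> :: "'g \<Rightarrow> 'k::field mat" and z :: 'k
  assumes \<rho>: "\<rho> \<in> representations G n" and z: "has_multiplicative_order z (2 * N)"
    and nc: "\<not> cyclic_group G" and D: "N + 1 \<le> D"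
    and D_dic: "N dvd k + 1 \<Longrightarrow> even N \<Longrightarrow> [s = N div 2] (mod N) \<Longrightarrow> N + 2 \<le> D"
  shows "separating_set G n \<rho> (invariants_upto G n \<rho> D)"
  unfolding separating_set_def
proof (intro conjI ballI impI)
  show "invariants_upto G n \<rho> D \<subseteq> invariants G n \<rho>" by (rule invariants_upto_subset)
next
  fix v w :: "'k vec"
  assume vw: "v \<in> carrier_vec n" "w \<in> carrier_vec n"
    and eq: "\<forall>f\<in>invariants_upto G n \<rho> D. poly_eval f v = poly_eval f w"
  have "of_nat (2 * N) \<noteq> (0 :: 'k)" by (rule root_of_unity_order_ne_0[OF z])
  then have two: "(2 :: 'k) \<noteq> 0" and N0: "of_nat N \<noteq> (0 :: 'k)" by auto
  have z2: "has_multiplicative_order (z ^ 2) N" by (rule root_of_unity_square[OF z])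
  define F where
    "F = {f :: 'k vec \<Rightarrow> 'k. \<exists>u\<in>carrier_vec n. \<forall>v\<in>carrier_vec n. f v = u \<bullet> v}"
  let ?\<alpha> = "\<lambda>v. \<rho> a *\<^sub>v v" and ?\<beta> = "\<lambda>v. \<rho> b *\<^sub>v v"
  note closed = representation_vec_closed[OF \<rho>]
  have pow: "(?\<alpha> ^^ i) v = \<rho> (a [^] i) *\<^sub>v v" if "v \<in> carrier_vec n" for i :: nat and v
  proof (induction i)
    case 0
    then show ?case using that by (simp add: representation_one[OF is_group \<rho>])
  next
    case (Suc i)
    have "(?\<alpha> ^^ Suc i) v = \<rho> (a \<otimes> a [^] i) *\<^sub>v v"
      using that a by (simp add: Suc representation_mult_vec[OF \<rho>])
    also have "a \<otimes> a [^] i = a [^] Suc i" using a by (rule nat_pow_Suc2[symmetric])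
    finally show ?case .
  qed
  have F_comp: "(\<lambda>v. f (\<rho> g *\<^sub>v v)) \<in> F" if f: "f \<in> F" and g: "g \<in> carrier G" for f g
  proof -
    obtain u where u: "u \<in> carrier_vec n" "\<And>v. v \<in> carrier_vec n \<Longrightarrow> f v = u \<bullet> v"
      using f unfolding F_def by blast
    have M: "\<rho> g \<in> carrier_mat n n" by (rule representation_matrix[OF \<rho> g])
    show ?thesis
      unfolding F_def
    proof (intro CollectI bexI[of _ "transpose_mat (\<rho> g) *\<^sub>v u"] ballI)
      show "f (\<rho> g *\<^sub>v v) = (transpose_mat (\<rho> g) *\<^sub>v u) \<bullet> v" if v: "v \<in> carrier_vec n" for v
        unfolding u(2)[OF closed[OF g v]] by (rule transpose_vec_mult_scalar[OF M v u(1), symmetric])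
      show "transpose_mat (\<rho> g) *\<^sub>v u \<in> carrier_vec n" using M u(1) by simp
    qed
  qed
  interpret A: twisted_action "carrier_vec n" ?\<alpha> ?\<beta> N k s F
  proof
    show "(?\<alpha> ^^ N) v = v" if "v \<in> carrier_vec n" for v
      using that by (simp only: pow[OF that] a_order) (simp add: representation_one[OF is_group \<rho>])
    show "?\<beta> (?\<alpha> v) = (?\<alpha> ^^ k) (?\<beta> v)" if v: "v \<in> carrier_vec n" for v
      unfolding pow[OF closed[OF b v]]
        representation_mult_vec[OF \<rho> b a v, symmetric] b_a
      by (rule representation_mult_vec[OF \<rho> nat_pow_closed[OF a] b v])
    show "?\<beta> (?\<beta> v) = (?\<alpha> ^^ s) v" if v: "v \<in> carrier_vec n" for v
      unfolding pow[OF v] representation_mult_vec[OF \<rho> b b v, symmetric] b_b ..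
    show "(\<lambda>v. 0) \<in> F" unfolding F_def by (intro CollectI bexI[of _ "0\<^sub>v n"]) auto
    show "(\<lambda>v. f v + c * g v) \<in> F" if fg: "f \<in> F" "g \<in> F" for f g c
    proof -
      obtain u where "u \<in> carrier_vec n" "\<And>v. v \<in> carrier_vec n \<Longrightarrow> f v = u \<bullet> v"
        using fg(1) unfolding F_def by blast
      moreover obtain u' where "u' \<in> carrier_vec n" "\<And>v. v \<in> carrier_vec n \<Longrightarrow> g v = u' \<bullet> v"
        using fg(2) unfolding F_def by blast
      ultimately show ?thesis
        unfolding F_def by (intro CollectI bexI[of _ "u + c \<cdot>\<^sub>v u'"])
          (auto simp: add_scalar_prod_distrib[where n = n])
    qed
    show "p = q" if pq: "p \<in> carrier_vec n" "q \<in> carrier_vec n" and "\<And>f. f \<in> F \<Longrightarrow> f p = f q" for p q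
    proof (rule eq_vecI)
      show "dim_vec p = dim_vec q" using pq by simp
      fix i assume "i < dim_vec q"
      then have i: "i < n" using pq by simp
      have "(\<lambda>v. unit_vec n i \<bullet> v) \<in> F" unfolding F_def by auto
      then have "unit_vec n i \<bullet> p = unit_vec n i \<bullet> q" using that(3) by blast
      then show "p $ i = q $ i" using pq i by simp
    qed
    show "N > 0" by (rule N_pos)
    show "[k * k = 1] (mod N)" by (rule k_square)
    show "[k * s = s] (mod N)" by (rule k_s)
    show "?\<alpha> v \<in> carrier_vec n" "?\<beta> v \<in> carrier_vec n" if "v \<in> carrier_vec n" for v
      using closed a b that by blast+
    show "(\<lambda>v. f (?\<alpha> v)) \<in> F" "(\<lambda>v. f (?\<beta> v)) \<in> F" if "f \<in> F" for f
      using F_comp a b that by blast+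
  qed
  have "A.agree D v w"
    unfolding A.agree_def
  proof (intro ballI impI)
    fix M assume M: "M \<in> form_products F D" and inv: "\<forall>u\<in>carrier_vec n. M (\<rho> a *\<^sub>v u) = M u"
    then obtain fs where fs: "M = (\<lambda>v. \<Prod>f\<leftarrow>fs. f v)" "set fs \<subseteq> F" "length fs \<le> D"
      by (auto simp: form_products_def)
    define rep where "rep f = (SOME u. u \<in> carrier_vec n \<and> (\<forall>v\<in>carrier_vec n. f v = u \<bullet> v))"
      for f :: "'k vec \<Rightarrow> 'k"
    have rep: "rep f \<in> carrier_vec n \<and> (\<forall>v\<in>carrier_vec n. f v = rep f \<bullet> v)" if "f \<in> F" for f
      unfolding rep_def by (rule someI_ex) (use that in \<open>unfold F_def, blast\<close>)
    have M_rep: "M v = (\<Prod>u\<leftarrow>map rep fs. u \<bullet> v)" if "v \<in> carrier_vec n" for v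
      unfolding fs(1) using fs(2) rep that
      by (intro prod_list_map_transfer) (simp add: list_all2_conv_all_nth subset_iff)
    have us: "set (map rep fs) \<subseteq> carrier_vec n" using fs(2) rep by auto
    define Q where "Q = (\<Sum>g\<in>carrier G. poly_action G n \<rho> g (\<Prod>u\<leftarrow>map rep fs. linear_form n u))"
    note Q = orbit_sum_invariant[OF is_group finite_carrier \<rho> us, folded Q_def]
    have "Q \<in> invariants_upto G n \<rho> D"
      by (rule invariants_subset_invariants_upto[OF Q(1,2)]) (simp add: fs(3))
    then have "poly_eval Q v = poly_eval Q w" using eq by blast
    moreover have "poly_eval Q v = of_nat N * (M v + M (\<rho> b *\<^sub>v v))" if v: "v \<in> carrier_vec n" for v
    proof -
      have "M \<in> A.semiinvariants 1 D 0" using M inv by (simp add: A.semiinvariants_def)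
      then have M_pow: "M (\<rho> (a [^] i) *\<^sub>v u) = M u" if "u \<in> carrier_vec n" for i :: nat and u
        using A.semi_invariant that by (simp add: pow[symmetric])
      have "poly_eval Q v = (\<Sum>g\<in>carrier G. M (\<rho> g *\<^sub>v v))"
        unfolding Q(3)[OF v] using closed v by (intro sum.cong) (simp_all add: M_rep)
      also have "\<dots> = (\<Sum>i<N. M (\<rho> (a [^] i) *\<^sub>v v)) + (\<Sum>i<N. M (\<rho> (a [^] i) *\<^sub>v (\<rho> b *\<^sub>v v)))"
        using a b v by (simp add: sum_carrier representation_mult_vec[OF \<rho>])
      also have "\<dots> = of_nat N * (M v + M (\<rho> b *\<^sub>v v))"
        using M_pow v closed[OF b v] by (simp add: distrib_left)
      finally show ?thesis .
    qed
    ultimately show "M v + M (\<rho> b *\<^sub>v v) = M w + M (\<rho> b *\<^sub>v w)" using N0 vw by simp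
  qed
  from A.orbits_separated[OF z2 two vw this D D_dic noncyclic_imp[OF nc]]
  show "same_orbit G \<rho> v w"
  proof
    assume "A.same_rotation_class v w"
    then obtain i :: nat where "w = \<rho> (a [^] i) *\<^sub>v v" using pow[OF vw(1)] unfolding A.same_rotation_class_def by auto
    then show ?thesis using a unfolding same_orbit_def by blast
  next
    assume "A.same_rotation_class v (\<rho> b *\<^sub>v w)"
    then obtain i :: nat where i: "\<rho> b *\<^sub>v w = \<rho> (a [^] i) *\<^sub>v v"
      using pow[OF vw(1)] unfolding A.same_rotation_class_def by auto
    have "w = \<rho> (inv b \<otimes> b) *\<^sub>v w" using b vw by (simp add: representation_one[OF is_group \<rho>])
    also have "\<dots> = \<rho> (inv b \<otimes> a [^] i) *\<^sub>v v"
      using a b vw i by (simp only: representation_mult_vec[OF \<rho>] inv_closed nat_pow_closed)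
    finally show ?thesis using a b unfolding same_orbit_def by blast
  qed
qed

end

section \<open>The lower bounds\<close>

context cyclic_index_two begin

text \<open>
  The relations between \<open>a\<close> and \<open>b\<close> recorded in the locale are a presentation of the group.
\<close>

lemma extend_to_hom:
  assumes H: "group H" and A: "A \<in> carrier H" and B: "B \<in> carrier H"
    and A_order: "A [^]\<^bsub>H\<^esub> N = \<one>\<^bsub>H\<^esub>"
    and B_A: "B \<otimes>\<^bsub>H\<^esub> A = A [^]\<^bsub>H\<^esub> k \<otimes>\<^bsub>H\<^esub> B"
    and B_B: "B \<otimes>\<^bsub>H\<^esub> B = A [^]\<^bsub>H\<^esub> s"
  obtains \<phi> where "\<phi> \<in> hom G H" "\<phi> a = A" "\<phi> b = B"
proof -
  interpret H: group H by (rule H)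
  have A_mod: "A [^]\<^bsub>H\<^esub> (i :: nat) = A [^]\<^bsub>H\<^esub> (j :: nat)" if "[i = j] (mod N)" for i j
    using H.pow_mod_exponent[OF A A_order, of i] H.pow_mod_exponent[OF A A_order, of j] that
    by (simp only: cong_def)
  note B_pow = H.conjugate_pow[OF A B B_A]
  define \<phi> where "\<phi> g = (if \<exists>i::nat. g = a [^] i then A [^]\<^bsub>H\<^esub> (SOME i::nat. g = a [^] i)
    else A [^]\<^bsub>H\<^esub> (SOME i::nat. g = a [^] i \<otimes> b) \<otimes>\<^bsub>H\<^esub> B)" for g
  have rot: "\<phi> (a [^] i) = A [^]\<^bsub>H\<^esub> i" for i :: nat
  proof -
    have "a [^] i = a [^] (SOME j::nat. a [^] i = a [^] j)" by (rule someI) (rule HOL.refl)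
    then have "A [^]\<^bsub>H\<^esub> (SOME j::nat. a [^] i = a [^] j) = A [^]\<^bsub>H\<^esub> i"
      by (intro A_mod) (simp only: rotation_eq_iff cong_sym_eq)
    then show ?thesis unfolding \<phi>_def by auto
  qed
  have refl: "\<phi> (a [^] i \<otimes> b) = A [^]\<^bsub>H\<^esub> i \<otimes>\<^bsub>H\<^esub> B" for i :: nat
  proof -
    have "a [^] i \<otimes> b = a [^] (SOME j::nat. a [^] i \<otimes> b = a [^] j \<otimes> b) \<otimes> b"
      by (rule someI[of "\<lambda>j::nat. a [^] i \<otimes> b = a [^] j \<otimes> b"]) (rule HOL.refl)
    then have "a [^] i = a [^] (SOME j::nat. a [^] i \<otimes> b = a [^] j \<otimes> b)" using a b by simp
    then have "A [^]\<^bsub>H\<^esub> (SOME j::nat. a [^] i \<otimes> b = a [^] j \<otimes> b) = A [^]\<^bsub>H\<^esub> i"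
      by (intro A_mod) (simp only: rotation_eq_iff cong_sym_eq)
    then show ?thesis using rotation_ne_reflection unfolding \<phi>_def by metis
  qed
  have "\<phi> \<in> hom G H"
  proof (rule homI)
    show "\<phi> g \<in> carrier H" if "g \<in> carrier G" for g
      using that A B by (cases rule: carrier_cases) (simp_all add: rot refl)
    fix g h assume gh: "g \<in> carrier G" "h \<in> carrier G"
    show "\<phi> (g \<otimes> h) = \<phi> g \<otimes>\<^bsub>H\<^esub> \<phi> h"
      using gh(1)
    proof (cases rule: carrier_cases)
      case g: (1 i)
      show ?thesis
        using gh(2)
      proof (cases rule: carrier_cases)
        case (1 j)
        then show ?thesis using g a A by (simp add: nat_pow_mult rot H.nat_pow_mult)
      next
        case (2 j)
        then have "g \<otimes> h = a [^] (i + j) \<otimes> b" using g a b by (simp add: nat_pow_mult m_assoc[symmetric])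
        then show ?thesis using g 2 A B by (simp add: rot refl H.nat_pow_mult[symmetric] H.m_assoc)
      qed
    next
      case g: (2 i)
      show ?thesis
        using gh(2)
      proof (cases rule: carrier_cases)
        case (1 j)
        then have "g \<otimes> h = a [^] (i + k * j) \<otimes> b"
          using g a b by (simp add: m_assoc b_pow nat_pow_mult[symmetric])
        then show ?thesis using g 1 A B by (simp add: rot refl H.nat_pow_mult[symmetric] H.m_assoc B_pow)
      next
        case (2 j)
        have "g \<otimes> h = a [^] i \<otimes> (b \<otimes> a [^] j) \<otimes> b" using g 2 a b by (simp add: m_assoc)
        also have "\<dots> = a [^] i \<otimes> a [^] (k * j) \<otimes> (b \<otimes> b)" using a b by (simp add: m_assoc b_pow)
        also have "\<dots> = a [^] (i + k * j + s)" using a by (simp add: b_b nat_pow_mult)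
        finally have "\<phi> (g \<otimes> h) = A [^]\<^bsub>H\<^esub> i \<otimes>\<^bsub>H\<^esub> A [^]\<^bsub>H\<^esub> (k * j) \<otimes>\<^bsub>H\<^esub> (B \<otimes>\<^bsub>H\<^esub> B)"
          using A by (simp add: rot H.nat_pow_mult B_B)
        also have "\<dots> = A [^]\<^bsub>H\<^esub> i \<otimes>\<^bsub>H\<^esub> (B \<otimes>\<^bsub>H\<^esub> A [^]\<^bsub>H\<^esub> j) \<otimes>\<^bsub>H\<^esub> B" using A B by (simp add: H.m_assoc B_pow)
        also have "\<dots> = \<phi> g \<otimes>\<^bsub>H\<^esub> \<phi> h" using g 2 A B by (simp add: refl H.m_assoc)
        finally show ?thesis .
      qed
    qed
  qed
  moreover have "\<phi> a = A" using rot[of 1] a A by simp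
  moreover have "\<phi> b = B" using refl[of 0] b B by simp
  ultimately show thesis by (rule that)
qed

end

definition diag3 :: "'k::field \<Rightarrow> 'k \<Rightarrow> 'k \<Rightarrow> 'k mat" where
  "diag3 p q r = mat 3 3 (\<lambda>(i, j). if i = j then (if i = 0 then p else if i = 1 then q else r) else 0)"

definition swap3 :: "'k::field \<Rightarrow> 'k \<Rightarrow> 'k \<Rightarrow> 'k mat" where
  "swap3 p q r = mat 3 3 (\<lambda>(i, j). if i = 0 \<and> j = 1 then p else if i = 1 \<and> j = 0 then q
     else if i = 2 \<and> j = 2 then r else 0)"

definition vec3 :: "'k::field \<Rightarrow> 'k \<Rightarrow> 'k \<Rightarrow> 'k vec" where
  "vec3 x y t = vec 3 (\<lambda>i. if i = 0 then x else if i = 1 then y else t)"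

lemma less_3_cases: "i < (3::nat) \<Longrightarrow> i = 0 \<or> i = 1 \<or> i = 2" by auto

lemma sum_3: "(\<Sum>i = 0..<3. f i) = f 0 + f 1 + f (2::nat)"
  by (simp add: numeral_3_eq_3 numeral_2_eq_2)

lemma
  shows diag3_carrier [simp]: "diag3 p q r \<in> carrier_mat 3 3"
    and swap3_carrier [simp]: "swap3 p q r \<in> carrier_mat 3 3"
    and vec3_carrier [simp]: "vec3 x y t \<in> carrier_vec 3"
  by (simp_all add: diag3_def swap3_def vec3_def)

lemma
  shows diag3_diag3: "diag3 p q r * diag3 p' q' r' = diag3 (p * p') (q * q') (r * r')"
    and diag3_swap3: "diag3 p q r * swap3 p' q' r' = swap3 (p * p') (q * q') (r * r')"
    and swap3_diag3: "swap3 p q r * diag3 p' q' r' = swap3 (p * q') (q * p') (r * r')"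
    and swap3_swap3: "swap3 p q r * swap3 p' q' r' = diag3 (p * q') (q * p') (r * r')"
    and diag3_one: "diag3 1 1 1 = 1\<^sub>m 3"
    and diag3_vec3: "diag3 p q r *\<^sub>v vec3 x y t = vec3 (p * x) (q * y) (r * t)"
    and swap3_vec3: "swap3 p q r *\<^sub>v vec3 x y t = vec3 (p * y) (q * x) (r * t)"
  by (intro eq_matI eq_vecI; force simp: diag3_def swap3_def vec3_def scalar_prod_def sum_3 dest!: less_3_cases)+

lemma vec3_eq_iff: "vec3 x y t = vec3 x' y' t' \<longleftrightarrow> x = x' \<and> y = y' \<and> t = t'"
proof
  assume eq: "vec3 x y t = vec3 x' y' t'"
  have "vec3 x y t $ i = vec3 x' y' t' $ i" for i by (simp add: eq)
  from this[of 0] this[of 1] this[of 2] show "x = x' \<and> y = y' \<and> t = t'" by (simp add: vec3_def)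
qed simp

lemma power_product_vec3:
  assumes "Poly_Mapping.keys m \<subseteq> {..<3}"
  shows "power_product (($) (vec3 x y t)) m =
    x ^ Poly_Mapping.lookup m 0 * y ^ Poly_Mapping.lookup m (Suc 0) * t ^ Poly_Mapping.lookup m 2"
  using power_product_superset[of "{..<3}" m "($) (vec3 x y t)"] assms
  by (simp add: numeral_3_eq_3 numeral_2_eq_2 vec3_def lessThan_Suc mult_ac)

lemma monomial_degree_3:
  assumes "Poly_Mapping.keys m \<subseteq> {..<3}"
  shows "monomial_degree m =
    Poly_Mapping.lookup m 0 + Poly_Mapping.lookup m (Suc 0) + Poly_Mapping.lookup m 2"
  using monomial_degree_superset[of "{..<3}" m] assms
  by (simp add: numeral_3_eq_3 numeral_2_eq_2 lessThan_Suc)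

lemma general_linear_group_simps:
  "mult (general_linear_group TYPE('k::field) n) = (*)"
  "one (general_linear_group TYPE('k::field) n) = 1\<^sub>m n"
  by (simp_all add: general_linear_group_def units_of_def ring_mat_def)

lemma general_linear_groupI:
  assumes "A \<in> carrier_mat n n" "B \<in> carrier_mat n n" "A * B = 1\<^sub>m n" "B * A = 1\<^sub>m n"
  shows "A \<in> carrier (general_linear_group TYPE('k::field) n)"
  using assms by (auto simp: general_linear_group_def units_of_def Units_def ring_mat_def)

context cyclic_index_two begin

text \<open>
  The sum of the representation induced from the character \<open>a \<mapsto> z\<close> of \<open>\<langle>a\<rangle>\<close> and of the
  sign character of \<open>G/\<langle>a\<rangle>\<close>.
\<close>

lemma induced_representation:
  fixes z :: "'k::field"
  assumes z: "has_multiplicative_order z N"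
  obtains \<rho> :: "'g \<Rightarrow> 'k mat" where "\<rho> \<in> representations G 3"
    "\<And>i x y t. \<rho> (a [^] (i :: nat)) *\<^sub>v vec3 x y t = vec3 (z ^ i * x) (z ^ (k * i) * y) t"
    "\<And>i x y t. \<rho> (a [^] (i :: nat) \<otimes> b) *\<^sub>v vec3 x y t =
      vec3 (z ^ i * y) (z ^ (k * i + s) * x) (- t)"
proof -
  let ?GL = "general_linear_group TYPE('k) 3"
  interpret H: group ?GL by (rule group_general_linear_group)
  define A where "A = diag3 z (z ^ k) 1"
  define B where "B = swap3 1 (z ^ s) (- 1)"
  have z0: "z \<noteq> 0" using z N_pos by (auto simp: has_multiplicative_order_def power_0_left)
  have zN: "z ^ N = 1" using z by (simp add: has_multiplicative_order_def)
  have A: "A \<in> carrier ?GL"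
    by (rule general_linear_groupI[of _ _ "diag3 (inverse z) (inverse (z ^ k)) 1"])
      (use z0 in \<open>simp_all add: A_def diag3_diag3 diag3_one\<close>)
  have B: "B \<in> carrier ?GL"
    by (rule general_linear_groupI[of _ _ "swap3 (inverse (z ^ s)) 1 (- 1)"])
      (use z0 in \<open>simp_all add: B_def swap3_swap3 diag3_one\<close>)
  have A_pow: "A [^]\<^bsub>?GL\<^esub> i = diag3 (z ^ i) (z ^ (k * i)) 1" for i :: nat
    by (induction i)
      (simp_all add: general_linear_group_simps diag3_one A_def diag3_diag3 power_add mult.commute)
  have zk: "z ^ (k * k) = z" "z ^ (k * s) = z ^ s"
    using k_square k_s root_of_unity_power_eq_iff[OF z, of "k * k" 1]
      root_of_unity_power_eq_iff[OF z, of "k * s" s] by auto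
  have "z ^ (k * N) = 1" by (simp add: root_of_unity_power_eq_1_iff[OF z])
  then have A_N: "A [^]\<^bsub>?GL\<^esub> N = \<one>\<^bsub>?GL\<^esub>"
    by (simp add: A_pow zN diag3_one general_linear_group_simps)
  have B_A: "B \<otimes>\<^bsub>?GL\<^esub> A = A [^]\<^bsub>?GL\<^esub> k \<otimes>\<^bsub>?GL\<^esub> B"
    unfolding A_pow general_linear_group_simps
    by (simp add: A_def B_def diag3_swap3 swap3_diag3 zk mult.commute)
  have B_B: "B \<otimes>\<^bsub>?GL\<^esub> B = A [^]\<^bsub>?GL\<^esub> s"
    by (simp add: A_pow general_linear_group_simps B_def swap3_swap3 zk)
  obtain \<rho> where \<rho>: "\<rho> \<in> hom G ?GL" "\<rho> a = A" "\<rho> b = B"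
    by (rule extend_to_hom[OF H.is_group A B A_N B_A B_B])
  have rep: "\<rho> \<in> representations G 3" using \<rho>(1) by (simp add: representations_def)
  have rot: "\<rho> (a [^] i) *\<^sub>v vec3 x y t = vec3 (z ^ i * x) (z ^ (k * i) * y) t" for i :: nat and x y t
  proof (induction i)
    case 0
    show ?case by (simp add: representation_one[OF is_group rep])
  next
    case (Suc i)
    have "\<rho> (a [^] Suc i) *\<^sub>v vec3 x y t = \<rho> a *\<^sub>v (\<rho> (a [^] i) *\<^sub>v vec3 x y t)"
      using a by (simp only: nat_pow_Suc2 representation_mult_vec[OF rep] nat_pow_closed vec3_carrier)
    then show ?case by (simp add: Suc \<rho>(2) A_def diag3_vec3 power_add mult.assoc)
  qed
  have "\<rho> (a [^] i \<otimes> b) *\<^sub>v vec3 x y t = vec3 (z ^ i * y) (z ^ (k * i + s) * x) (- t)"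
    for i :: nat and x y t
    using a b by (simp add: representation_mult_vec[OF rep] \<rho>(3) B_def swap3_vec3 rot power_add mult.assoc)
  with rep rot show thesis by (rule that)
qed

text \<open>
  The two vectors differ in the sign of the last coordinate. A monomial in which this coordinate has an odd
  exponent and whose orbit sum does not vanish at these vectors contains the \<open>N\<close>-th power of one of the first
  two coordinates and thus has degree greater than \<open>N\<close>; for the powers of the last coordinate alone, the
  rotations and the reflections cancel.
\<close>

lemma not_separating_degree_N:
  fixes z :: "'k::field"
  assumes z: "has_multiplicative_order z (2 * N)"
  obtains \<rho> :: "'g \<Rightarrow> 'k mat" where "\<rho> \<in> representations G 3"
    "\<And>d. d \<le> N \<Longrightarrow> \<not> separating_set G 3 \<rho> (invariants_upto G 3 \<rho> d)"
proof -
  have zz: "has_multiplicative_order (z ^ 2) N" by (rule root_of_unity_square[OF z])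
  define y where "y = z ^ 2"
  note y = zz[folded y_def]
  have G0: "of_nat (card (carrier G)) \<noteq> (0 :: 'k)"
    using root_of_unity_order_ne_0[OF z] by (simp add: card_carrier)
  then have two: "(2 :: 'k) \<noteq> 0" by (auto simp: card_carrier)
  obtain \<rho> :: "'g \<Rightarrow> 'k mat" where \<rho>: "\<rho> \<in> representations G 3"
    and rot: "\<And>i x y' t. \<rho> (a [^] (i :: nat)) *\<^sub>v vec3 x y' t = vec3 (y ^ i * x) (y ^ (k * i) * y') t"
    and refl: "\<And>i x y' t. \<rho> (a [^] (i :: nat) \<otimes> b) *\<^sub>v vec3 x y' t =
      vec3 (y ^ i * y') (y ^ (k * i + s) * x) (- t)"
    using induced_representation[OF y] by blast
  let ?v = "vec3 1 0 1 :: 'k vec" and ?w = "vec3 1 0 (- 1) :: 'k vec"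
  have not_orbit: "\<not> same_orbit G \<rho> ?v ?w"
  proof
    assume "same_orbit G \<rho> ?v ?w"
    then obtain g where g: "g \<in> carrier G" "?w = \<rho> g *\<^sub>v ?v" by (auto simp: same_orbit_def)
    have neg: "(- 1 :: 'k) \<noteq> 1" using two by (metis one_add_one add.right_inverse)
    from g(1) show False
      by (cases rule: carrier_cases) (use g(2) neg in \<open>auto simp: rot refl vec3_eq_iff\<close>)
  qed
  have "\<not> separating_set G 3 \<rho> (invariants_upto G 3 \<rho> d)" if d: "d \<le> N" for d
  proof
    assume sep: "separating_set G 3 \<rho> (invariants_upto G 3 \<rho> d)"
    have "poly_eval f ?v = poly_eval f ?w" if f: "f \<in> invariants_upto G 3 \<rho> d" for f
    proof (rule invariants_upto_eqI[OF is_group \<rho> G0 _ _ _ f])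
      fix m assume m: "Poly_Mapping.keys m \<subseteq> {..<3}" "monomial_degree m \<le> d"
      define p q r where "p = Poly_Mapping.lookup m 0" "q = Poly_Mapping.lookup m (Suc 0)"
        "r = Poly_Mapping.lookup m 2"
      have deg: "p + q + r \<le> N" using m d monomial_degree_3[OF m(1)] by (simp add: p_q_r_def)
      define S where "S = (\<Sum>i<N. y ^ (p * i)) * (0 ^ q :: 'k)"
      define T where "T = 0 ^ p * (\<Sum>i<N. (y ^ (k * i + s)) ^ q)"
      have sum: "(\<Sum>g\<in>carrier G. power_product (($) (\<rho> g *\<^sub>v vec3 1 0 t)) m) = S * t ^ r + T * (- t) ^ r" for t
        unfolding sum_carrier S_def T_def
        by (simp add: rot refl power_product_vec3[OF m(1)] p_q_r_def[symmetric] sum_distrib_right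
            sum_distrib_left power_mult[symmetric] mult.commute)
      have ST: "S = T" if "r > 0"
      proof (cases "p = 0"; cases "q = 0")
        assume "p = 0" "q = 0"
        then show ?thesis by (simp add: S_def T_def)
      next
        assume "p = 0" "q \<noteq> 0"
        have "N dvd k * q \<longleftrightarrow> N dvd q"
          using square_cong_1_coprime[OF k_square] by (simp add: coprime_dvd_mult_right_iff coprime_commute)
        moreover have "\<not> N dvd q" using deg \<open>q \<noteq> 0\<close> that by (auto dest!: dvd_imp_le)
        ultimately have "(\<Sum>i<N. y ^ ((k * q) * i)) = 0" using sum_root_powers[OF y, of "k * q"] by simp
        moreover have "T = y ^ (s * q) * (\<Sum>i<N. y ^ ((k * q) * i))"
          unfolding T_def sum_distrib_left
          using \<open>p = 0\<close> by (simp add: power_mult[symmetric] power_add[symmetric] algebra_simps)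
        ultimately show ?thesis using \<open>q \<noteq> 0\<close> by (simp add: S_def)
      next
        assume "p \<noteq> 0" "q = 0"
        moreover have "\<not> N dvd p" using deg \<open>p \<noteq> 0\<close> that by (auto dest!: dvd_imp_le)
        ultimately show ?thesis using sum_root_powers[OF y, of p] by (simp add: S_def T_def)
      next
        assume "p \<noteq> 0" "q \<noteq> 0"
        then show ?thesis by (simp add: S_def T_def zero_power)
      qed
      show "(\<Sum>g\<in>carrier G. power_product (($) (\<rho> g *\<^sub>v ?v)) m) =
          (\<Sum>g\<in>carrier G. power_product (($) (\<rho> g *\<^sub>v ?w)) m)"
        unfolding sum using ST by (cases "r = 0") (simp_all add: add.commute)
    qed simp_all
    then have "same_orbit G \<rho> ?v ?w" using sep unfolding separating_set_def by simp
    then show False using not_orbit by simp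
  qed
  with \<rho> show thesis by (rule that)
qed

text \<open>
  The vectors \<open>(1, z, 0)\<close> and \<open>(z, 1, 0)\<close> are exchanged by the swap of the first two coordinates. The orbit
  sum of \<open>x\<^sup>p y\<^sup>q\<close> vanishes unless \<open>N\<close> divides \<open>p - q\<close>. In degree at most \<open>N + 1\<close> this leaves
  \<open>p = q\<close> and the monomials \<open>x\<^sup>N\<close> and \<open>y\<^sup>N\<close>, whose orbit sums are symmetric. The swap is not realized on these
  vectors by an element of \<open>G\<close>: a rotation would make \<open>z\<close> an even power of itself, although its order
  is even, and a reflection changes a sign.
\<close>

lemma not_separating_degree_Suc_N:
  fixes z :: "'k::field"
  assumes z: "has_multiplicative_order z (2 * N)" and k: "N dvd k + 1" and N: "N = 2 * s"
  obtains \<rho> :: "'g \<Rightarrow> 'k mat" where "\<rho> \<in> representations G 3"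
    "\<And>d. d \<le> N + 1 \<Longrightarrow> \<not> separating_set G 3 \<rho> (invariants_upto G 3 \<rho> d)"
proof -
  have zz: "has_multiplicative_order (z ^ 2) N" by (rule root_of_unity_square[OF z])
  define y where "y = z ^ 2"
  note y = zz[folded y_def]
  have G0: "of_nat (card (carrier G)) \<noteq> (0 :: 'k)"
    using root_of_unity_order_ne_0[OF z] by (simp add: card_carrier)
  then have two: "(2 :: 'k) \<noteq> 0" by (auto simp: card_carrier)
  have neg: "(- 1 :: 'k) \<noteq> 1" using two by (metis one_add_one add.right_inverse)
  have z0: "z \<noteq> 0" using z N_pos by (auto simp: has_multiplicative_order_def power_0_left)
  have zN: "z ^ N = - 1"
  proof -
    have "(z ^ N) ^ 2 = 1" using z by (simp add: has_multiplicative_order_def mult.commute flip: power_mult)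
    moreover have "z ^ N \<noteq> 1" using z N_pos by (simp add: has_multiplicative_order_def)
    ultimately show ?thesis by (simp add: power2_eq_1_iff)
  qed
  have ys: "y ^ s = - 1" using zN by (simp add: y_def N power_mult[symmetric])
  obtain \<rho> :: "'g \<Rightarrow> 'k mat" where \<rho>: "\<rho> \<in> representations G 3"
    and rot: "\<And>i x y' t. \<rho> (a [^] (i :: nat)) *\<^sub>v vec3 x y' t = vec3 (y ^ i * x) (y ^ (k * i) * y') t"
    and refl: "\<And>i x y' t. \<rho> (a [^] (i :: nat) \<otimes> b) *\<^sub>v vec3 x y' t =
      vec3 (y ^ i * y') (y ^ (k * i + s) * x) (- t)"
    using induced_representation[OF y] by blast
  let ?v = "vec3 1 z 0 :: 'k vec" and ?w = "vec3 z 1 0 :: 'k vec"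
  have not_orbit: "\<not> same_orbit G \<rho> ?v ?w"
  proof
    assume "same_orbit G \<rho> ?v ?w"
    then obtain g where g: "g \<in> carrier G" "?w = \<rho> g *\<^sub>v ?v" by (auto simp: same_orbit_def)
    from g(1) show False
    proof (cases rule: carrier_cases)
      case (1 i)
      then have "z ^ 1 = z ^ (2 * i)" using g(2) by (simp add: rot vec3_eq_iff y_def power_mult)
      then have "[1 = 2 * i] (mod (2 * N))" by (simp only: root_of_unity_power_eq_iff[OF z])
      then have "[1 = 2 * i] (mod 2)" by (rule cong_dvd_modulus_nat) simp
      then show False by (simp add: cong_def)
    next
      case (2 i)
      then have "z = y ^ i * z" "1 = y ^ (k * i + s)" using g(2) by (simp_all add: refl vec3_eq_iff)
      moreover have "y ^ (k * i + s) = y ^ s * (y ^ i) ^ k"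
        by (simp add: power_add power_mult[symmetric] mult.commute)
      ultimately have "y ^ i = 1" "1 = y ^ s * (y ^ i) ^ k" using z0 by simp_all
      then have "1 = y ^ s" by (simp only: power_one mult_1_right)
      then show False using ys neg by simp
    qed
  qed
  have "\<not> separating_set G 3 \<rho> (invariants_upto G 3 \<rho> d)" if d: "d \<le> N + 1" for d
  proof
    assume sep: "separating_set G 3 \<rho> (invariants_upto G 3 \<rho> d)"
    have "poly_eval f ?v = poly_eval f ?w" if f: "f \<in> invariants_upto G 3 \<rho> d" for f
    proof (rule invariants_upto_eqI[OF is_group \<rho> G0 _ _ _ f])
      fix m assume m: "Poly_Mapping.keys m \<subseteq> {..<3}" "monomial_degree m \<le> d"
      define p q r where "p = Poly_Mapping.lookup m 0" "q = Poly_Mapping.lookup m (Suc 0)"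
        "r = Poly_Mapping.lookup m 2"
      have deg: "p + q + r \<le> N + 1" using m d monomial_degree_3[OF m(1)] by (simp add: p_q_r_def)
      define S where "S = (\<Sum>i<N. y ^ ((p + k * q) * i))"
      have sum: "(\<Sum>g\<in>carrier G. power_product (($) (\<rho> g *\<^sub>v vec3 x x' 0)) m) =
          S * (x ^ p * x' ^ q + (- 1) ^ q * (x' ^ p * x ^ q)) * 0 ^ r" for x x'
      proof -
        have "(\<Sum>i<N. power_product (($) (\<rho> (a [^] i) *\<^sub>v vec3 x x' 0)) m) =
            (\<Sum>i<N. y ^ ((p + k * q) * i) * (x ^ p * x' ^ q * 0 ^ r))"
          by (intro sum.cong) (simp_all add: rot power_product_vec3[OF m(1)] p_q_r_def[symmetric]
              power_mult_distrib power_mult[symmetric] power_add algebra_simps)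
        moreover have "(\<Sum>i<N. power_product (($) (\<rho> (a [^] i \<otimes> b) *\<^sub>v vec3 x x' 0)) m) =
            (\<Sum>i<N. y ^ ((p + k * q) * i) * ((- 1) ^ q * (x' ^ p * x ^ q) * 0 ^ r))"
          unfolding ys[symmetric]
          by (intro sum.cong) (simp_all add: refl power_product_vec3[OF m(1)] p_q_r_def[symmetric]
              power_mult_distrib power_mult[symmetric] power_add algebra_simps)
        ultimately show ?thesis
          unfolding sum_carrier S_def by (simp only: sum_distrib_right[symmetric]) (simp add: algebra_simps)
      qed
      have key: "1 ^ p * z ^ q + (- 1) ^ q * (z ^ p * 1 ^ q) = z ^ p * 1 ^ q + (- 1) ^ q * (1 ^ p * z ^ q)"
        if "N dvd p + k * q" "r = 0"
      proof -
        have "int N dvd int (p + k * q) - int (k + 1) * int q"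
          using that(1) k by (intro dvd_diff dvd_mult2) (simp_all only: int_dvd_int_iff)
        then have "int N dvd int p - int q" by (simp add: algebra_simps)
        then obtain c where c: "int p - int q = int N * c" by (rule dvdE)
        have "N \<ge> 2" using N N_pos by presburger
        have "\<bar>int N * c\<bar> < int N * 2" unfolding c[symmetric] using deg \<open>N \<ge> 2\<close> by linarith
        then have "int N * \<bar>c\<bar> < int N * 2" by (simp add: abs_mult)
        then have "\<bar>c\<bar> < 2" using N_pos by (simp only: mult_less_cancel_left_pos of_nat_0_less_iff)
        then consider "c = 0" | "c = 1" | "c = - 1" by linarith
        then show ?thesis
        proof cases
          case 1
          then show ?thesis using c by simp
        next
          case 2
          then have "int p = int q + int N" using c by simp
          then have "q = 0" using deg by presburger
          then show ?thesis by simp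
        next
          case 3
          then have "int q = int p + int N" using c by simp
          then have "p = 0" "q = N" using deg by presburger+
          then show ?thesis by (simp add: N)
        qed
      qed
      show "(\<Sum>g\<in>carrier G. power_product (($) (\<rho> g *\<^sub>v ?v)) m) =
          (\<Sum>g\<in>carrier G. power_product (($) (\<rho> g *\<^sub>v ?w)) m)"
      proof (cases "N dvd p + k * q \<and> r = 0")
        case True
        then show ?thesis unfolding sum using key by simp
      next
        case False
        then have "S * 0 ^ r = 0"
          using sum_root_powers[OF y, of "p + k * q"] by (cases "r = 0") (simp_all add: S_def zero_power)
        then show ?thesis unfolding sum by auto
      qed
    qed simp_all
    then have "same_orbit G \<rho> ?v ?w" using sep unfolding separating_set_def by simp
    then show False using not_orbit by simp
  qed
  with \<rho> show thesis by (rule that)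
qed

end

section \<open>Dicyclic groups\<close>

definition dicyclic_relations :: "nat \<Rightarrow> (dic_generator word \<times> dic_generator word) set" where
  "dicyclic_relations m =
     {(replicate (2 * m) (Dic_a, True), []),
      ([(Dic_b, True), (Dic_b, True)], replicate m (Dic_a, True)),
      ([(Dic_b, True), (Dic_a, True), (Dic_b, False)], [(Dic_a, False)])}"

lemma dicyclic_group_eq: "dicyclic_group m = presented_group (dicyclic_relations m)"
  by (simp add: dicyclic_group_def dicyclic_relations_def)

text \<open>
  Left multiplication by the generators on the normal forms, with \<open>(i, False)\<close> for \<open>a\<^sup>i\<close> and \<open>(i, True)\<close>
  for \<open>a\<^sup>i b\<close>. It respects the relations, which therefore do not identify different normal forms.
\<close>

fun normal_form_action :: "nat \<Rightarrow> dic_generator \<times> bool \<Rightarrow> int \<times> bool \<Rightarrow> int \<times> bool" where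
  "normal_form_action m (Dic_a, e) (i, f) = ((i + (if e then 1 else - 1)) mod (2 * int m), f)"
| "normal_form_action m (Dic_b, True) (i, f) =
     ((if f then int m - i else - i) mod (2 * int m), \<not> f)"
| "normal_form_action m (Dic_b, False) (i, f) =
     ((if f then - i else int m - i) mod (2 * int m), \<not> f)"

definition word_action :: "nat \<Rightarrow> dic_generator word \<Rightarrow> int \<times> bool \<Rightarrow> int \<times> bool" where
  "word_action m u x = foldr (normal_form_action m) u x"

lemma word_action_append: "word_action m (u @ v) x = word_action m u (word_action m v x)"
  by (simp add: word_action_def)

lemma word_action_replicate:
  "word_action m (replicate n (Dic_a, True)) (i mod (2 * int m), f) = ((i + int n) mod (2 * int m), f)"
  by (induction n) (simp_all add: word_action_def mod_simps algebra_simps)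

lemma normal_form_action_range:
  "\<exists>j g. normal_form_action m l x = (j mod (2 * int m), g)"
proof -
  obtain x1 e where l: "l = (x1, e)" by (cases l)
  obtain i f where x: "x = (i, f)" by (cases x)
  show ?thesis unfolding l x by (cases x1; cases e) auto
qed

lemma word_action_range:
  "\<exists>j g. word_action m u (i mod (2 * int m), f) = (j mod (2 * int m), g)"
proof (cases u)
  case (Cons l u)
  then show ?thesis using normal_form_action_range by (simp add: word_action_def)
qed (auto simp: word_action_def)

lemma mod_double_minus: "(i - int m) mod (2 * int m) = (i + int m) mod (2 * int m)"
proof -
  have "i + int m = i - int m + 2 * int m" by simp
  then show ?thesis by (simp only: mod_add_self2)
qed

lemma word_action_cong:
  assumes "word_cong (dicyclic_relations m) u v"
  shows "word_action m u (i mod (2 * int m), f) = word_action m v (i mod (2 * int m), f)"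
  using assms
proof (induction arbitrary: i f)
  case (relation u v)
  then consider "u = replicate (2 * m) (Dic_a, True)" "v = []"
    | "u = [(Dic_b, True), (Dic_b, True)]" "v = replicate m (Dic_a, True)"
    | "u = [(Dic_b, True), (Dic_a, True), (Dic_b, False)]" "v = [(Dic_a, False)]"
    by (auto simp: dicyclic_relations_def)
  then show ?case
  proof cases
    case 1
    then show ?thesis by (simp add: word_action_replicate) (simp add: word_action_def)
  next
    case 2
    then show ?thesis
      unfolding 2(2) word_action_replicate
      using mod_double_minus[of i m]
      by (cases f) (simp_all add: word_action_def mod_simps algebra_simps)
  next
    case 3
    then show ?thesis
      by (cases f) (simp_all add: word_action_def mod_simps algebra_simps)
  qed
next
  case (cancel x e)
  show ?case
    by (cases x; cases e; cases f) (simp_all add: word_action_def mod_simps)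
next
  case (append u v u' v')
  obtain j g where "word_action m v' (i mod (2 * int m), f) = (j mod (2 * int m), g)"
    using word_action_range by blast
  then show ?case by (simp add: word_action_append append.IH)
qed simp_all

text \<open>
  Every word is congruent to a normal form, so that there are at most \<open>4 m\<close> classes. They are distinct because their
  actions on the normal form of the unit are.
\<close>

lemma dicyclic_cyclic_index_two:
  fixes G (structure)
  assumes m: "m > 0"
  defines "G \<equiv> dicyclic_group m"
  shows "cyclic_index_two G
    (word_class (dicyclic_relations m) [(Dic_a, True)])
    (word_class (dicyclic_relations m) [(Dic_b, True)]) (2 * m) (2 * m - 1) m"
proof -
  let ?R = "dicyclic_relations m"
  let ?a = "word_class ?R [(Dic_a, True)]" and ?b = "word_class ?R [(Dic_b, True)]"
  let ?a' = "word_class ?R [(Dic_a, False)]" and ?b' = "word_class ?R [(Dic_b, False)]"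
  interpret group G unfolding G_def dicyclic_group_eq by (rule group_presented_group)
  have carr: "carrier G = range (word_class ?R)"
    and one: "\<one> = word_class ?R []"
    and mult: "word_class ?R u \<otimes> word_class ?R v = word_class ?R (u @ v)" for u v
    by (simp_all add: G_def dicyclic_group_eq presented_group_mult) (simp_all add: presented_group_def)
  have clos: "word_class ?R u \<in> carrier G" for u by (simp add: carr)
  have pow: "?a [^] i = word_class ?R (replicate i (Dic_a, True))" for i :: nat
    by (induction i) (simp_all add: one mult replicate_append_same)
  have rel: "word_class ?R u = word_class ?R v" if "(u, v) \<in> ?R" for u v
    unfolding word_class_eq_iff by (rule word_cong.relation[OF that])
  have a_order: "?a [^] (2 * m) = \<one>"
    unfolding pow one by (rule rel) (simp add: dicyclic_relations_def)
  have b_b: "?b \<otimes> ?b = ?a [^] m"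
    unfolding pow mult by (rule rel) (simp add: dicyclic_relations_def)
  have cancel: "word_class ?R [(x, False)] \<otimes> word_class ?R [(x, True)] = \<one>" for x
    unfolding mult one word_class_eq_iff using word_cong.cancel[of ?R x False] by simp
  have a': "?a' = inv ?a" by (rule inv_equality[OF cancel clos clos, symmetric])
  have b': "?b' = inv ?b" by (rule inv_equality[OF cancel clos clos, symmetric])
  have a_inv: "inv ?a = ?a [^] (2 * m - 1)"
  proof (rule inv_equality)
    have "?a [^] (2 * m - 1) \<otimes> ?a = ?a [^] Suc (2 * m - 1)" by simp
    also have "Suc (2 * m - 1) = 2 * m" using m by simp
    finally show "?a [^] (2 * m - 1) \<otimes> ?a = \<one>" by (simp only: a_order)
  qed (simp_all add: clos)
  have b_a: "?b \<otimes> ?a = ?a [^] (2 * m - 1) \<otimes> ?b"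
  proof -
    have "(?b \<otimes> ?a) \<otimes> ?b' = ?a'"
      unfolding mult using rel[of "[(Dic_b, True), (Dic_a, True), (Dic_b, False)]" "[(Dic_a, False)]"]
      by (simp add: dicyclic_relations_def)
    then have "((?b \<otimes> ?a) \<otimes> inv ?b) \<otimes> ?b = inv ?a \<otimes> ?b"
      by (simp only: a' b')
    then show ?thesis using clos by (simp add: m_assoc a_inv)
  qed
  note b_pow = conjugate_pow[OF clos clos b_a]
  define S where "S = range (\<lambda>i::nat. ?a [^] i) \<union> range (\<lambda>i::nat. ?a [^] i \<otimes> ?b)"
  have S_a: "?a \<otimes> x \<in> S" if "x \<in> S" for x
  proof -
    have Suc: "?a \<otimes> ?a [^] (i :: nat) = ?a [^] Suc i" for i
      by (rule nat_pow_Suc2[symmetric]) (rule clos)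
    have "?a \<otimes> (?a [^] i \<otimes> ?b) = ?a [^] Suc i \<otimes> ?b" for i :: nat
      using clos by (simp only: m_assoc[symmetric] Suc nat_pow_closed)
    with Suc show ?thesis using that unfolding S_def by blast
  qed
  have S_b: "?b \<otimes> x \<in> S" if "x \<in> S" for x
  proof -
    have "?b \<otimes> (?a [^] (i :: nat) \<otimes> ?b) = ?a [^] ((2 * m - 1) * i + m)" for i
    proof -
      have "?b \<otimes> (?a [^] i \<otimes> ?b) = ?a [^] ((2 * m - 1) * i) \<otimes> (?b \<otimes> ?b)"
        using clos by (simp only: m_assoc[symmetric] b_pow nat_pow_closed)
      then show ?thesis using clos by (simp only: b_b nat_pow_mult)
    qed
    then show ?thesis using that unfolding S_def by (auto simp: b_pow)
  qed
  have S_a_pow: "?a [^] (i :: nat) \<otimes> x \<in> S" if "x \<in> S" "x \<in> carrier G" for i x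
  proof (induction i)
    case (Suc i)
    have "?a [^] Suc i \<otimes> x = ?a \<otimes> (?a [^] i \<otimes> x)"
      using clos that(2) by (simp only: nat_pow_Suc2 m_assoc nat_pow_closed)
    then show ?case using S_a[OF Suc] by simp
  qed (use that in simp)
  have b_inv: "inv ?b = ?b \<otimes> ?a [^] m"
  proof (rule inv_equality)
    have "?b \<otimes> ?a [^] m \<otimes> ?b = (?b \<otimes> ?b) \<otimes> (?b \<otimes> ?b)"
      using clos by (simp only: b_b[symmetric] m_assoc m_closed)
    also have "\<dots> = ?a [^] (m + m)" using clos by (simp only: b_b nat_pow_mult)
    also have "m + m = 2 * m" by simp
    finally show "?b \<otimes> ?a [^] m \<otimes> ?b = \<one>" by (simp only: a_order)
  qed (use clos in simp_all)
  have gen: "word_class ?R u \<in> S" for u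
  proof (induction u)
    case Nil
    have "\<one> = ?a [^] (0 :: nat)" by simp
    then show ?case unfolding S_def one by blast
  next
    case (Cons l u)
    obtain x e where l: "l = (x, e)" by (cases l)
    have eq: "word_class ?R (l # u) = word_class ?R [l] \<otimes> word_class ?R u" by (simp add: mult)
    note ih = Cons clos[of u]
    show ?case
    proof (cases x; cases e)
      assume "x = Dic_a" "e"
      then show ?thesis unfolding eq using l S_a[OF Cons] by simp
    next
      assume "x = Dic_a" "\<not> e"
      then show ?thesis unfolding eq using l S_a_pow[OF ih, of "2 * m - 1"] by (simp add: a' a_inv)
    next
      assume "x = Dic_b" "e"
      then show ?thesis unfolding eq using l S_b[OF Cons] by simp
    next
      assume "x = Dic_b" "\<not> e"
      then show ?thesis unfolding eq
        using l S_b[OF S_a_pow[OF ih, of m]] clos by (simp add: b' b_inv m_assoc)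
    qed
  qed
  note pow_mod = pow_mod_exponent[OF clos a_order, symmetric]
  let ?A = "(\<lambda>i::nat. ?a [^] i) ` {..<2 * m}"
  let ?B = "(\<lambda>i::nat. ?a [^] i \<otimes> ?b) ` {..<2 * m}"
  have carrier_eq: "carrier G = ?A \<union> ?B"
  proof
    have "S \<subseteq> ?A \<union> ?B"
    proof
      fix x assume "x \<in> S"
      then consider i :: nat where "x = ?a [^] i" | i :: nat where "x = ?a [^] i \<otimes> ?b"
        unfolding S_def by blast
      then show "x \<in> ?A \<union> ?B"
      proof cases
        case (1 i)
        then have "x = ?a [^] (i mod (2 * m))" using pow_mod by (rule HOL.trans)
        then show ?thesis using m by (intro UnI1 image_eqI) auto
      next
        case (2 i)
        then have "x = ?a [^] (i mod (2 * m)) \<otimes> ?b" 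
          using arg_cong[OF pow_mod[of i], of "\<lambda>y. y \<otimes> ?b"] by (rule HOL.trans)
        then show ?thesis using m by (intro UnI2 image_eqI) auto
      qed
    qed
    then show "carrier G \<subseteq> ?A \<union> ?B" using gen unfolding carr by blast
    show "?A \<union> ?B \<subseteq> carrier G" 
      by (intro Un_least image_subsetI nat_pow_closed m_closed clos)
  qed
  \<comment> \<open>the normal forms are distinguished by their action on the normal form of the unit\<close>
  have act: "word_action m u (0, False) = word_action m v (0, False)"
    if "word_class ?R u = word_class ?R v" for u v
    using word_action_cong[of m u v 0 False] that by (simp add: word_class_eq_iff)
  have act_a: "word_action m (replicate i (Dic_a, True)) (0, False) = (int i, False)" if "i < 2 * m" for i
    using word_action_replicate[of m i 0 False] that by simp
  have act_b: "word_action m (replicate i (Dic_a, True) @ [(Dic_b, True)]) (0, False) = (int i, True)"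
    if "i < 2 * m" for i
    using word_action_replicate[of m i 0 True] that
    by (simp only: word_action_append) (simp add: word_action_def)
  have pow_b: "?a [^] (i :: nat) \<otimes> ?b = word_class ?R (replicate i (Dic_a, True) @ [(Dic_b, True)])" for i
    by (simp only: pow mult)
  have inj_A: "inj_on (\<lambda>i::nat. ?a [^] i) {..<2 * m}"
  proof (rule inj_onI)
    fix i j assume ij: "i \<in> {..<2 * m}" "j \<in> {..<2 * m}" "?a [^] i = ?a [^] j"
    have "i < 2 * m" "j < 2 * m" using ij(1,2) by simp_all
    then have "(int i, False) = (int j, False)"
      using act[OF ij(3)[unfolded pow]] by (simp only: act_a)
    then show "i = j" by simp
  qed
  have inj_B: "inj_on (\<lambda>i::nat. ?a [^] i \<otimes> ?b) {..<2 * m}"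
  proof (rule inj_onI)
    fix i j assume ij: "i \<in> {..<2 * m}" "j \<in> {..<2 * m}"
      "?a [^] i \<otimes> ?b = ?a [^] j \<otimes> ?b"
    have "i < 2 * m" "j < 2 * m" using ij(1,2) by simp_all
    then have "(int i, True) = (int j, True)"
      using act[OF ij(3)[unfolded pow_b]] by (simp only: act_b)
    then show "i = j" by simp
  qed
  have disj: "?A \<inter> ?B = {}"
  proof (rule ccontr)
    assume "?A \<inter> ?B \<noteq> {}"
    then obtain i j where ij: "i < 2 * m" "j < 2 * m"
      "?a [^] i = ?a [^] j \<otimes> ?b"
      by auto
    show False using act[OF ij(3)[unfolded pow_b, unfolded pow]] unfolding act_a[OF ij(1)] act_b[OF ij(2)] by simp
  qed
  have "card (carrier G) = 2 * (2 * m)"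
    unfolding carrier_eq
    by (subst card_Un_disjoint[OF _ _ disj]) (simp_all add: card_image[OF inj_A] card_image[OF inj_B])
  note card = this
  show ?thesis
    by (intro cyclic_index_two.intro cyclic_index_two_axioms.intro is_group clos a_order
        carrier_eq card b_a b_b) (use m in simp)
qed

lemma cyclic_index_two_iso:
  assumes "cyclic_index_two G a b N k s" and H: "group H" and \<phi>: "\<phi> \<in> iso G H"
  shows "cyclic_index_two H (\<phi> a) (\<phi> b) N k s"
proof -
  interpret G: cyclic_index_two G a b N k s by (rule assms)
  interpret H: group H by (rule H)
  interpret \<phi>: group_hom G H \<phi>
    using \<phi> by (simp add: group_hom_def group_hom_axioms_def iso_def G.is_group H)
  have bij: "bij_betw \<phi> (carrier G) (carrier H)" using \<phi> by (simp add: iso_def)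
  have pow: "\<phi> (a [^]\<^bsub>G\<^esub> i) = \<phi> a [^]\<^bsub>H\<^esub> i" for i :: nat using \<phi>.hom_nat_pow G.a by simp
  show ?thesis
  proof
    show "\<phi> a \<in> carrier H" "\<phi> b \<in> carrier H" using G.a G.b by simp_all
    show "N > 0" by (rule G.N_pos)
    show "\<phi> a [^]\<^bsub>H\<^esub> N = \<one>\<^bsub>H\<^esub>" unfolding pow[symmetric] G.a_order by simp
    have pow_b: "\<phi> (a [^]\<^bsub>G\<^esub> i \<otimes>\<^bsub>G\<^esub> b) = \<phi> a [^]\<^bsub>H\<^esub> i \<otimes>\<^bsub>H\<^esub> \<phi> b" for i :: nat
      using G.a G.b by (simp add: pow)
    have "carrier H = \<phi> ` carrier G" using bij unfolding bij_betw_def by simp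
    also have "\<dots> = (\<lambda>i. \<phi> (a [^]\<^bsub>G\<^esub> i)) ` {..<N} \<union> (\<lambda>i. \<phi> (a [^]\<^bsub>G\<^esub> i \<otimes>\<^bsub>G\<^esub> b)) ` {..<N}"
      unfolding G.carrier_eq image_Un image_image ..
    finally show "carrier H = (\<lambda>i. \<phi> a [^]\<^bsub>H\<^esub> i) ` {..<N} \<union> (\<lambda>i. \<phi> a [^]\<^bsub>H\<^esub> i \<otimes>\<^bsub>H\<^esub> \<phi> b) ` {..<N}"
      unfolding pow pow_b .
    show "card (carrier H) = 2 * N" using bij_betw_same_card[OF bij] G.card_carrier by simp
    show "\<phi> b \<otimes>\<^bsub>H\<^esub> \<phi> a = \<phi> a [^]\<^bsub>H\<^esub> k \<otimes>\<^bsub>H\<^esub> \<phi> b"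
      using arg_cong[OF G.b_a, of \<phi>] G.a G.b by (simp add: pow)
    show "\<phi> b \<otimes>\<^bsub>H\<^esub> \<phi> b = \<phi> a [^]\<^bsub>H\<^esub> s"
      using arg_cong[OF G.b_b, of \<phi>] G.a G.b by (simp add: pow)
  qed
qed

text \<open>
  The relations give a homomorphism onto the dicyclic group, and both groups have order \<open>2 N\<close>. The case
  \<open>m = 1\<close> would be the cyclic group of order four.
\<close>

lemma (in cyclic_index_two) iso_dicyclic:
  assumes nc: "\<not> cyclic_group G" and k: "N dvd k + 1" and N: "even N" and s: "[s = N div 2] (mod N)"
  shows "\<exists>m>1. G \<cong> dicyclic_group m"
proof -
  obtain m where m: "N = 2 * m" using N by (rule evenE)
  have m0: "m > 0" using m N_pos by simp
  interpret D: cyclic_index_two "dicyclic_group m"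
    "word_class (dicyclic_relations m) [(Dic_a, True)]"
    "word_class (dicyclic_relations m) [(Dic_b, True)]" "2 * m" "2 * m - 1" m
    by (rule dicyclic_cyclic_index_two[OF m0])
  let ?D = "dicyclic_group m"
  let ?A = "word_class (dicyclic_relations m) [(Dic_a, True)]"
  let ?B = "word_class (dicyclic_relations m) [(Dic_b, True)]"
  have "m \<noteq> 1"
  proof
    assume "m = 1"
    then have N2: "N = 2" using m by simp
    have "odd k" using k by (simp add: N2)
    then have "[k = 1] (mod N)" unfolding cong_def N2 odd_iff_mod_2_eq_one by simp
    moreover have "odd s" using s unfolding cong_def N2 odd_iff_mod_2_eq_one by simp
    ultimately show False using noncyclic_imp[OF nc] by simp
  qed
  have "[k = 2 * m - 1] (mod (2 * m))"
  proof -
    have "[k + 1 = 2 * m - 1 + 1] (mod (2 * m))" using k m m0 by (simp add: cong_def mod_eq_0_iff_dvd)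
    then show ?thesis by (simp only: cong_add_rcancel_nat)
  qed
  then have Ak: "?A [^]\<^bsub>?D\<^esub> k = ?A [^]\<^bsub>?D\<^esub> (2 * m - 1)"
    by (simp only: D.rotation_eq_iff)
  have As: "?A [^]\<^bsub>?D\<^esub> s = ?A [^]\<^bsub>?D\<^esub> m"
    using s m by (simp add: D.rotation_eq_iff)
  have relations: "?A [^]\<^bsub>?D\<^esub> N = \<one>\<^bsub>?D\<^esub>"
    "?B \<otimes>\<^bsub>?D\<^esub> ?A = ?A [^]\<^bsub>?D\<^esub> k \<otimes>\<^bsub>?D\<^esub> ?B"
    "?B \<otimes>\<^bsub>?D\<^esub> ?B = ?A [^]\<^bsub>?D\<^esub> s"
    unfolding m Ak As by (rule D.a_order D.b_a D.b_b)+
  obtain \<phi> where \<phi>: "\<phi> \<in> hom G (dicyclic_group m)" "\<phi> a = ?A" "\<phi> b = ?B"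
    by (rule extend_to_hom[OF D.is_group D.a D.b relations])
  interpret \<phi>: group_hom G "dicyclic_group m" \<phi>
    using \<phi> by (simp add: group_hom_def group_hom_axioms_def is_group D.is_group)
  have surj: "\<phi> ` carrier G = carrier (dicyclic_group m)"
  proof
    show "carrier (dicyclic_group m) \<subseteq> \<phi> ` carrier G"
    proof
      fix x assume "x \<in> carrier (dicyclic_group m)"
      then show "x \<in> \<phi> ` carrier G"
      proof (cases rule: D.carrier_cases)
        case (1 i)
        then have "x = \<phi> (a [^] i)" using a \<phi> by (simp add: \<phi>.hom_nat_pow)
        then show ?thesis using a by simp
      next
        case (2 i)
        then have "x = \<phi> (a [^] i \<otimes> b)" using a b \<phi> by (simp add: \<phi>.hom_nat_pow)
        then show ?thesis by (rule image_eqI) (use a b in simp)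
      qed
    qed
  qed auto
  have "card (\<phi> ` carrier G) = card (carrier G)"
    unfolding surj by (simp add: D.card_carrier card_carrier m)
  then have "inj_on \<phi> (carrier G)" using finite_carrier by (intro eq_card_imp_inj_on) auto
  then have "\<phi> \<in> iso G (dicyclic_group m)" using \<phi>(1) surj by (simp add: iso_def bij_betw_def)
  then show ?thesis using m0 \<open>m \<noteq> 1\<close> by (intro exI[of _ m]) (auto simp: is_iso_def)
qed

section \<open>The separating Noether number\<close>

lemma beta_sep_eqI:
  fixes G :: "('g, 'b) monoid_scheme"
  assumes upper: "\<And>n (\<rho> :: 'g \<Rightarrow> 'k::field mat). \<rho> \<in> representations G n \<Longrightarrow>
      separating_set G n \<rho> (invariants_upto G n \<rho> D)"
    and lower: "(\<rho> :: 'g \<Rightarrow> 'k mat) \<in> representations G n"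
      "\<And>d. d < D \<Longrightarrow> \<not> separating_set G n \<rho> (invariants_upto G n \<rho> d)"
  shows "beta_sep TYPE('k) G = enat D"
proof (rule antisym)
  show "beta_sep TYPE('k) G \<le> enat D"
    unfolding beta_sep_def
  proof (rule Sup_least)
    fix x assume "x \<in> {beta_sep_rep G n \<rho> |n (\<rho> :: 'g \<Rightarrow> 'k mat). \<rho> \<in> representations G n}"
    then obtain n and \<rho> :: "'g \<Rightarrow> 'k mat" where x: "x = beta_sep_rep G n \<rho>" "\<rho> \<in> representations G n"
      by blast
    show "x \<le> enat D" unfolding x beta_sep_rep_def
      by (rule Inf_lower) (use upper[OF x(2)] in blast)
  qed
  have "enat D \<le> beta_sep_rep G n \<rho>"
    unfolding beta_sep_rep_def
  proof (rule Inf_greatest)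
    fix x assume "x \<in> {enat d |d. separating_set G n \<rho> (invariants_upto G n \<rho> d)}"
    then obtain d where "x = enat d" "separating_set G n \<rho> (invariants_upto G n \<rho> d)" by blast
    moreover from this have "\<not> d < D" using lower(2) by blast
    ultimately show "enat D \<le> x" by simp
  qed
  also have "\<dots> \<le> beta_sep TYPE('k) G"
    unfolding beta_sep_def by (rule Sup_upper) (use lower(1) in blast)
  finally show "enat D \<le> beta_sep TYPE('k) G" .
qed

theorem theorem2p1:
  fixes G :: "('g, 'b) monoid_scheme"
  assumes "group G" and "finite (carrier G)"
    and "\<not> cyclic_group G"
    and "\<exists>C. subgroup C G \<and> cyclic_group (subgroup_generated G C) \<and> card (rcosets\<^bsub>G\<^esub> C) = 2"
    and "\<exists>z :: 'k::field. has_multiplicative_order z (Coset.order G)"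
  shows "beta_sep TYPE('k) G =
    enat (Coset.order G div 2 + (if \<exists>m>1. G \<cong> dicyclic_group m then 2 else 1))"
proof -
  obtain a b N k s where "cyclic_index_two G a b N k s"
    using assms(4) cyclic_index_two_exists[OF assms(1,2)] by blast
  then interpret cyclic_index_two G a b N k s .
  have order: "Coset.order G = 2 * N" by (simp add: Coset.order_def card_carrier)
  obtain z :: 'k where z: "has_multiplicative_order z (2 * N)" using assms(5) order by auto
  show ?thesis
  proof (cases "\<exists>m>1. G \<cong> dicyclic_group m")
    case True
    then obtain m where m: "m > 1" "G \<cong> dicyclic_group m" by blast
    have m0: "m > 0" using m(1) by simp
    note dic = dicyclic_cyclic_index_two[OF m0]
    have "dicyclic_group m \<cong> G" by (rule iso_sym[OF m(2)])
    then obtain \<phi> where "\<phi> \<in> iso (dicyclic_group m) G" unfolding is_iso_def by blast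
    from cyclic_index_two_iso[OF dic assms(1) this]
    obtain a' b' where "cyclic_index_two G a' b' (2 * m) (2 * m - 1) m" by blast
    then interpret dic: cyclic_index_two G a' b' "2 * m" "2 * m - 1" m .
    have N: "N = 2 * m" using card_carrier dic.card_carrier by simp
    have "2 * m dvd 2 * m - 1 + 1" using m0 by simp
    then obtain \<rho> :: "'g \<Rightarrow> 'k mat" where \<rho>: "\<rho> \<in> representations G 3"
      and "\<And>d. d \<le> 2 * m + 1 \<Longrightarrow> \<not> separating_set G 3 \<rho> (invariants_upto G 3 \<rho> d)"
      using dic.not_separating_degree_Suc_N[OF z[unfolded N]] by blast
    then have "\<not> separating_set G 3 \<rho> (invariants_upto G 3 \<rho> d)" if "d < N + 2" for d
      using that N by simp
    moreover have "separating_set G n \<rho>' (invariants_upto G n \<rho>' (N + 2))"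
      if "\<rho>' \<in> representations G n" for n and \<rho>' :: "'g \<Rightarrow> 'k mat"
      by (rule separating_set_invariants_upto[OF that z assms(3)]) simp_all
    ultimately have "beta_sep TYPE('k) G = enat (N + 2)" using \<rho> by (intro beta_sep_eqI)
    then show ?thesis using True order by simp
  next
    case False
    obtain \<rho> :: "'g \<Rightarrow> 'k mat" where \<rho>: "\<rho> \<in> representations G 3"
      and "\<And>d. d \<le> N \<Longrightarrow> \<not> separating_set G 3 \<rho> (invariants_upto G 3 \<rho> d)"
      using not_separating_degree_N[OF z] by blast
    then have "\<not> separating_set G 3 \<rho> (invariants_upto G 3 \<rho> d)" if "d < N + 1" for d
      using that by simp
    moreover have "separating_set G n \<rho>' (invariants_upto G n \<rho>' (N + 1))"
      if "\<rho>' \<in> representations G n" for n and \<rho>' :: "'g \<Rightarrow> 'k mat"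
      by (rule separating_set_invariants_upto[OF that z assms(3)])
        (use iso_dicyclic[OF assms(3)] False in auto)
    ultimately have "beta_sep TYPE('k) G = enat (N + 1)" using \<rho> by (intro beta_sep_eqI)
    then show ?thesis using False order by simp
  qed
qed

end
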